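(* In the setting described in the context, let $Y\subset\mathbb{R}^n\times H(f)$ be a connected compact hyperbolic invariant set and let $N=\dim M^u(y)$ ($=\dim V^u(y)$, independent of $y\in Y$). Then for every $y=(x_0,g)\in Y$: (a) for every $x^s\in M^s(y)\setminus\{x_0\}$ with $x^s-x_0\in\Lambda$, one has $\sigma(x^s-x_0)\ge N$; (b) for every $x^u\in M^u(y)\setminus\{x_0\}$ with $x^u-x_0\in\Lambda$, one has $\sigma(x^u-x_0)\le N-1$.
   Context: $\Lambda=\{x\in\mathbb{R}^n: x_1\ne0,\ x_n\ne0,\ \text{and if } x_i=0 \text{ for some } 2\le i\le n-1 \text{ then } x_{i-1}x_{i+1}<0\}$, $\sigma(x)=\#\{i:x_i=0\text{ or }x_ix_{i+1}<0\}$ for $x\in\Lambda$. Setting: the tridiagonal system $\dot x_1=f_1(t,x_1,x_2)$, $\dot x_i=f_i(t,x_{i-1},x_i,x_{i+1})$, $\dot x_n=f_n(t,x_{n-1},x_n)$, with $f$ $C^1$-admissible and $\partial f_i/\partial x_{i+1}\ge\varepsilon_0$, $\partial f_{i+1}/\partial x_i\ge\varepsilon_0>0$; hull $H(f)$ and skew-product flow $\Pi_t(x,g)=(x(t,x,g),g\cdot t)$. For $y=(x_0,g)\in Y$, linearization $\dot z=B(y\cdot t)z$ with $B(y\cdot t)=D_xg(t,x(t,x_0,g))$, fundamental matrix $\Phi(t,y)$. $Y$ hyperbolic: exponential dichotomy over $Y$ (continuous invariant projection $Q(y)$, $K,\alpha>0$, $|\Phi(t,y)(I-Q(y))|\le Ke^{-\alpha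 t}$ for $t\ge0$, $|\Phi(t,y)Q(y)|\le Ke^{\alpha t}$ for $t\le 0$) with $\mathrm{Im}\,Q(y)\ne\{0\}$; $V^u(y)=\mathrm{Im}\,Q(y)$, $V^s(y)=\ker Q(y)$. $W^s(y),W^u(y)$ are the standard local stable/unstable manifolds of $z=0$ for $\dot z=B(y\cdot t)z+G(z,y\cdot t)$ (equation of $z=x-x(t,x_0,g)$): graphs $\{v+h^{s}(v,y):v\in V^s(y),|v|<\delta_*\}$ and $\{v+h^u(v,y):v\in V^u(y),|v|<\delta_*\}$ of $C^1$ maps with $h=o(|v|)$ and derivative norm $\le C_0<1$, satisfying $|\Psi_t(x_s,y)|\le Ce^{-(\alpha/2)t}|x_s|$ ($t\ge0$, $x_s\in W^s(y)$), $|\Psi_t(x_u,y)|\le Ce^{(\alpha/2)t}|x_u|$ ($t\le 0$, $x_u\in W^u(y)$), and overflowing invariance $\Psi_t(W^s(y),y)\subset W^s(y\cdot t)$ for $t\gg1$, $\Psi_t(W^u(y),y)\subset W^u(y\cdot t)$ for $t\ll-1$. $M^{s}(y)=x_0+W^{s}(y)$, $M^u(y)=x_0+W^u(y)$. *)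

theory Defs
  imports "HOL-Analysis.Analysis"
begin

text \<open>Vectors in R^n are elements of (real^'n::{finite,linorder}) with a finite linearly ordered index type 'n::{finite,linorder};
  n = CARD('n), and the coordinates are numbered 1..n following the order on 'n::{finite,linorder}.
  A time-dependent vector field g(t,x) is a curried function real => (real^'n::{finite,linorder}) => (real^'n::{finite,linorder}).\<close>

definition ix :: "nat \<Rightarrow> 'n::{finite,linorder}" where
  "ix i = sorted_list_of_set (UNIV::'n::{finite,linorder} set) ! (i - 1)"

definition cmp :: "(real^'n::{finite,linorder}) \<Rightarrow> nat \<Rightarrow> real" where
  "cmp x i = x $ ix i"

definition Lambda_set :: "(real^'n::{finite,linorder}) set" where
  "Lambda_set = {x. cmp x 1 \<noteq> 0 \<and> cmp x CARD('n) \<noteq> 0 \<and>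
     (\<forall>i. 2 \<le> i \<and> i \<le> CARD('n) - 1 \<and> cmp x i = 0 \<longrightarrow> cmp x (i - 1) * cmp x (i + 1) < 0)}"

definition sigma_num :: "(real^'n::{finite,linorder}) \<Rightarrow> nat" where
  "sigma_num x = card {i \<in> {1..<CARD('n)}. cmp x i = 0 \<or> cmp x i * cmp x (i + 1) < 0}"

definition admissible :: "(real \<Rightarrow> 'a::euclidean_space \<Rightarrow> 'b::real_normed_vector) \<Rightarrow> bool" where
  "admissible h \<longleftrightarrow> (\<forall>K. compact K \<longrightarrow>
      bounded ((\<lambda>(t,x). h t x) ` (UNIV \<times> K)) \<and> uniformly_continuous_on (UNIV \<times> K) (\<lambda>(t,x). h t x))"

definition C1_admissible :: "(real \<Rightarrow> (real^'n::{finite,linorder}) \<Rightarrow> (real^'n::{finite,linorder})) \<Rightarrow> bool" where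
  "C1_admissible f \<longleftrightarrow> (\<exists>Df :: real \<Rightarrow> (real^'n::{finite,linorder}) \<Rightarrow> ((real^'n::{finite,linorder}) \<Rightarrow>\<^sub>L (real^'n::{finite,linorder})).
      (\<forall>t x. (f t has_derivative blinfun_apply (Df t x)) (at x)) \<and> admissible f \<and> admissible Df)"

definition tridiagonal :: "(real \<Rightarrow> (real^'n::{finite,linorder}) \<Rightarrow> (real^'n::{finite,linorder})) \<Rightarrow> bool" where
  "tridiagonal f \<longleftrightarrow> (\<forall>i\<in>{1..CARD('n)}. \<forall>t x x'.
      (\<forall>j\<in>{1..CARD('n)}. i \<le> j + 1 \<and> j \<le> i + 1 \<longrightarrow> cmp x j = cmp x' j) \<longrightarrow>
      cmp (f t x) i = cmp (f t x') i)"

definition pd :: "(real \<Rightarrow> (real^'n::{finite,linorder}) \<Rightarrow> (real^'n::{finite,linorder})) \<Rightarrow> nat \<Rightarrow> nat \<Rightarrow> real \<Rightarrow> (real^'n::{finite,linorder}) \<Rightarrow> real" where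
  "pd f i j t x = cmp (frechet_derivative (f t) (at x) (axis (ix j) 1)) i"

definition coop_bound :: "(real \<Rightarrow> (real^'n::{finite,linorder}) \<Rightarrow> (real^'n::{finite,linorder})) \<Rightarrow> real \<Rightarrow> bool" where
  "coop_bound f e \<longleftrightarrow> (\<forall>i\<in>{1..<CARD('n)}. \<forall>t x. pd f i (i + 1) t x \<ge> e \<and> pd f (i + 1) i t x \<ge> e)"

text \<open>Hull: closure of the time translates in the compact-open topology (metrizable, so
  sequential closure with respect to uniform convergence on compact sets).\<close>

definition hull_H :: "(real \<Rightarrow> (real^'n::{finite,linorder}) \<Rightarrow> (real^'n::{finite,linorder})) \<Rightarrow> (real \<Rightarrow> (real^'n::{finite,linorder}) \<Rightarrow> (real^'n::{finite,linorder})) set" where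
  "hull_H f = {g. \<exists>\<tau>::nat \<Rightarrow> real. \<forall>K :: (real \<times> (real^'n::{finite,linorder})) set. compact K \<longrightarrow>
      uniform_limit K (\<lambda>k (t,x). f (t + \<tau> k) x) (\<lambda>(t,x). g t x) sequentially}"

definition cc_top :: "(real \<Rightarrow> (real^'n::{finite,linorder}) \<Rightarrow> (real^'n::{finite,linorder})) topology" where
  "cc_top = topology (\<lambda>U. \<forall>g\<in>U. \<exists>K :: (real \<times> (real^'n::{finite,linorder})) set. \<exists>e>0. compact K \<and>
      (\<forall>h. (\<forall>(t,x)\<in>K. dist (h t x) (g t x) < e) \<longrightarrow> h \<in> U))"

definition state_top :: "((real^'n::{finite,linorder}) \<times> (real \<Rightarrow> (real^'n::{finite,linorder}) \<Rightarrow> (real^'n::{finite,linorder}))) topology" where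
  "state_top = prod_topology euclidean cc_top"

definition shift :: "(real \<Rightarrow> 'a) \<Rightarrow> real \<Rightarrow> real \<Rightarrow> 'a" where
  "shift g s = (\<lambda>t. g (t + s))"

definition is_sol :: "(real \<Rightarrow> (real^'n::{finite,linorder}) \<Rightarrow> (real^'n::{finite,linorder})) \<Rightarrow> (real^'n::{finite,linorder}) \<Rightarrow> real set \<Rightarrow> (real \<Rightarrow> (real^'n::{finite,linorder})) \<Rightarrow> bool" where
  "is_sol g x0 I \<phi> \<longleftrightarrow> is_interval I \<and> 0 \<in> I \<and> \<phi> 0 = x0 \<and>
      (\<forall>t\<in>I. (\<phi> has_vector_derivative g t (\<phi> t)) (at t within I))"

definition traj :: "(real \<Rightarrow> (real^'n::{finite,linorder}) \<Rightarrow> (real^'n::{finite,linorder})) \<Rightarrow> (real^'n::{finite,linorder}) \<Rightarrow> real \<Rightarrow> (real^'n::{finite,linorder})" where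
  "traj g x0 = (SOME \<phi>. is_sol g x0 UNIV \<phi>)"

definition skew :: "real \<Rightarrow> (real^'n::{finite,linorder}) \<times> (real \<Rightarrow> (real^'n::{finite,linorder}) \<Rightarrow> (real^'n::{finite,linorder})) \<Rightarrow> (real^'n::{finite,linorder}) \<times> (real \<Rightarrow> (real^'n::{finite,linorder}) \<Rightarrow> (real^'n::{finite,linorder}))" where
  "skew t y = (traj (snd y) (fst y) t, shift (snd y) t)"

definition invariant_set :: "((real^'n::{finite,linorder}) \<times> (real \<Rightarrow> (real^'n::{finite,linorder}) \<Rightarrow> (real^'n::{finite,linorder}))) set \<Rightarrow> bool" where
  "invariant_set Y \<longleftrightarrow> (\<forall>y\<in>Y. \<exists>\<phi>. is_sol (snd y) (fst y) UNIV \<phi>) \<and> (\<forall>t. skew t ` Y = Y)"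

definition Blin :: "(real^'n::{finite,linorder}) \<times> (real \<Rightarrow> (real^'n::{finite,linorder}) \<Rightarrow> (real^'n::{finite,linorder})) \<Rightarrow> real \<Rightarrow> ((real^'n::{finite,linorder}) \<Rightarrow>\<^sub>L (real^'n::{finite,linorder}))" where
  "Blin y t = Blinfun (frechet_derivative (snd y t) (at (traj (snd y) (fst y) t)))"

definition fund :: "(real^'n::{finite,linorder}) \<times> (real \<Rightarrow> (real^'n::{finite,linorder}) \<Rightarrow> (real^'n::{finite,linorder})) \<Rightarrow> real \<Rightarrow> ((real^'n::{finite,linorder}) \<Rightarrow>\<^sub>L (real^'n::{finite,linorder}))" where
  "fund y = (SOME \<Phi>. \<Phi> 0 = id_blinfun \<and> (\<forall>t. (\<Phi> has_vector_derivative (Blin y t o\<^sub>L \<Phi> t)) (at t)))"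

definition exp_dichotomy ::
  "((real^'n::{finite,linorder}) \<times> (real \<Rightarrow> (real^'n::{finite,linorder}) \<Rightarrow> (real^'n::{finite,linorder}))) set \<Rightarrow>
   ((real^'n::{finite,linorder}) \<times> (real \<Rightarrow> (real^'n::{finite,linorder}) \<Rightarrow> (real^'n::{finite,linorder})) \<Rightarrow> ((real^'n::{finite,linorder}) \<Rightarrow>\<^sub>L (real^'n::{finite,linorder}))) \<Rightarrow> real \<Rightarrow> real \<Rightarrow> bool" where
  "exp_dichotomy Y Q K \<alpha> \<longleftrightarrow> K > 0 \<and> \<alpha> > 0 \<and>
     continuous_map (subtopology state_top Y) euclidean Q \<and>
     (\<forall>y\<in>Y. Q y o\<^sub>L Q y = Q y \<and>
        (\<forall>t. fund y t o\<^sub>L Q y = Q (skew t y) o\<^sub>L fund y t) \<and>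
        (\<forall>t\<ge>0. norm (fund y t o\<^sub>L (id_blinfun - Q y)) \<le> K * exp (- \<alpha> * t)) \<and>
        (\<forall>t\<le>0. norm (fund y t o\<^sub>L Q y) \<le> K * exp (\<alpha> * t)))"

definition Vu where "Vu Q y = range (blinfun_apply (Q y))"
definition Vs where "Vs Q y = {v. blinfun_apply (Q y) v = 0}"

text \<open>Local stable / unstable manifolds (in the z = x - x(t,x0,g) coordinates), with the
  properties listed in the setting.  Psi_t(z,y) = x(t, x0+z, g) - x(t, x0, g).\<close>

definition graph_manifold ::
  "(real^'n::{finite,linorder}) set \<Rightarrow> (real^'n::{finite,linorder}) set \<Rightarrow> (real^'n::{finite,linorder}) set \<Rightarrow> real \<Rightarrow> real \<Rightarrow> bool" where
  "graph_manifold W V V' \<delta> C0 \<longleftrightarrow> (\<exists>h :: (real^'n::{finite,linorder}) \<Rightarrow> (real^'n::{finite,linorder}). \<exists>Dh :: (real^'n::{finite,linorder}) \<Rightarrow> ((real^'n::{finite,linorder}) \<Rightarrow>\<^sub>L (real^'n::{finite,linorder})).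
      W = {v + h v | v. v \<in> V \<and> norm v < \<delta>} \<and>
      (\<forall>v\<in>V \<inter> ball 0 \<delta>. h v \<in> V') \<and>
      (\<forall>\<epsilon>>0. \<exists>r>0. \<forall>v\<in>V \<inter> ball 0 \<delta>. norm v < r \<longrightarrow> norm (h v) \<le> \<epsilon> * norm v) \<and>
      (\<forall>v\<in>V \<inter> ball 0 \<delta>. (h has_derivative blinfun_apply (Dh v)) (at v within (V \<inter> ball 0 \<delta>)) \<and>
          (\<forall>w\<in>V. norm (Dh v w) \<le> C0 * norm w)) \<and>
      continuous_on (V \<inter> ball 0 \<delta>) Dh)"

definition stable_family where
  "stable_family Y Q \<alpha> Ws \<longleftrightarrow> (\<exists>\<delta> C C0. \<delta> > 0 \<and> C > 0 \<and> 0 \<le> C0 \<and> C0 < 1 \<and>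
     (\<forall>y\<in>Y. graph_manifold (Ws y) (Vs Q y) (Vu Q y) \<delta> C0) \<and>
     (\<forall>y\<in>Y. \<forall>z\<in>Ws y. \<exists>\<phi>. is_sol (snd y) (fst y + z) {0..} \<phi> \<and>
        (\<forall>t\<ge>0. norm (\<phi> t - traj (snd y) (fst y) t) \<le> C * exp (- (\<alpha> / 2) * t) * norm z)) \<and>
     (\<exists>T. \<forall>y\<in>Y. \<forall>z\<in>Ws y. \<forall>\<phi>. is_sol (snd y) (fst y + z) {0..} \<phi> \<longrightarrow>
        (\<forall>t\<ge>T. \<phi> t - traj (snd y) (fst y) t \<in> Ws (skew t y))))"

definition unstable_family where
  "unstable_family Y Q \<alpha> Wu \<longleftrightarrow> (\<exists>\<delta> C C0. \<delta> > 0 \<and> C > 0 \<and> 0 \<le> C0 \<and> C0 < 1 \<and>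
     (\<forall>y\<in>Y. graph_manifold (Wu y) (Vu Q y) (Vs Q y) \<delta> C0) \<and>
     (\<forall>y\<in>Y. \<forall>z\<in>Wu y. \<exists>\<phi>. is_sol (snd y) (fst y + z) {..0} \<phi> \<and>
        (\<forall>t\<le>0. norm (\<phi> t - traj (snd y) (fst y) t) \<le> C * exp ((\<alpha> / 2) * t) * norm z)) \<and>
     (\<exists>T. \<forall>y\<in>Y. \<forall>z\<in>Wu y. \<forall>\<phi>. is_sol (snd y) (fst y + z) {..0} \<phi> \<longrightarrow>
        (\<forall>t\<le>T. \<phi> t - traj (snd y) (fst y) t \<in> Wu (skew t y))))"

end

theory Submission
  imports Defs "HOL-Computational_Algebra.Polynomial"
begin

text \<open>The difference \<open>z\<close> of two solutions solves a linear tridiagonal system \<open>z' = A(t) z\<close> with positive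
  off-diagonal entries, where \<open>A\<close> is an average of the Jacobian and is asymptotic to the linearization
  along the orbit in \<open>Y\<close>. The number of sign changes does not increase along such systems, and for
  nontrivial \<open>z\<close> there are arbitrarily late times with \<open>z(t) \<in> \<Lambda>\<close>, near which this number is locally
  constant. If \<open>z(t) \<rightarrow> 0\<close> forwards with fewer than \<open>N\<close> sign changes, then the span of \<open>z(T)\<close> and the
  \<open>N\<close>-dimensional space of initial values at time \<open>T\<close> whose solutions stay bounded away from 0 has
  dimension \<open>N + 1\<close>, so at every later time it contains a vector whose first \<open>N\<close> moments vanish and
  which therefore has at least \<open>N\<close> sign changes; comparing with large multiples of \<open>z\<close>
  shows that its component in the \<open>N\<close>-dimensional space is of the order of \<open>z\<close>, a contradiction.
  Part (b) is part (a) after reversing time and flipping the sign of every other coordinate.\<close>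

text \<open>The obstacle is that the dichotomy belongs to the linearization \<open>B\<close>, while
  sign changes are controlled along \<open>A\<close>, which is only asymptotic to \<open>B\<close>.
  No dichotomy is built for \<open>A\<close>; one estimate survives the perturbation: a solution of
  \<open>A\<close> that starts in the unstable subspace of \<open>B\<close> at a late time
  \<open>T\<close> never falls below 1 / (2 K) of its initial norm. Sign changes are counted
  one-sidedly, by "at least m alternations". This condition is open and inherited backwards in time,
  so its negation is closed and persists forwards; the instants where the count drops need no
  discussion. Lambda makes the failure of the condition at z(T) stable under perturbation, whence a
  threshold \<open>b0\<close>: for unit u, the vector u + b z(T) has too few alternations once |b|
  reaches \<open>b0\<close>. Vanishing moments do the opposite: they give enough alternations with a
  margin proportional to the norm. Moving the coefficient of z to \<open>b0\<close> loses the
  alternations, so this move, of size at most 2 \<open>b0\<close> |z(j)| at time j, must exceed the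
  margin. That bounds the unstable component by a multiple of z(j).\<close>

section \<open>Sign alternations\<close>

text \<open>The number of sign changes of \<open>c 1, \<dots>, c n\<close>, zeros being ignored, is at least \<open>m\<close>.\<close>

definition alternates :: "nat \<Rightarrow> nat \<Rightarrow> (nat \<Rightarrow> real) \<Rightarrow> bool" where
  "alternates n m c \<longleftrightarrow> (\<exists>p. (\<forall>j\<le>m. p j \<in> {1..n} \<and> c (p j) \<noteq> 0) \<and>
     (\<forall>j<m. p j < p (Suc j) \<and> c (p j) * c (p (Suc j)) < 0))"

lemma alternates_0: "i \<in> {1..n} \<Longrightarrow> c i \<noteq> 0 \<Longrightarrow> alternates n 0 c"
  unfolding alternates_def by (intro exI[of _ "\<lambda>_. i"]) auto

lemma alternates_mult:
  assumes "a \<noteq> 0" "alternates n m (\<lambda>i. a * c i)"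
  shows "alternates n m c"
proof -
  obtain p where p: "\<forall>j\<le>m. p j \<in> {1..n} \<and> a * c (p j) \<noteq> 0"
    "\<forall>j<m. p j < p (Suc j) \<and> (a * c (p j)) * (a * c (p (Suc j))) < 0"
    using assms(2) unfolding alternates_def by auto
  have "c i * c k < 0" if "(a * c i) * (a * c k) < 0" for i k
  proof -
    have "(a * c i) * (a * c k) = a\<^sup>2 * (c i * c k)" by (simp add: power2_eq_square)
    moreover have "a\<^sup>2 > 0" using assms(1) by simp
    ultimately show ?thesis using that by (metis mult_less_cancel_left_pos mult_zero_right)
  qed
  then show ?thesis using p unfolding alternates_def by (intro exI[of _ p]) auto
qed

text \<open>Each selected index i is replaced by an index \<open>f i\<close> at distance at most 1
  where \<open>x\<close> has the sign of \<open>y i\<close>. Opposite signs keep the new indices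
  distinct. Their order could only be reversed by a swap of two neighbours i and k, and then
  \<open>x k\<close> would have the sign of \<open>y i\<close> as well as that of
  \<open>y k\<close>; the last sign condition in \<open>sgn\<close> is there to exclude
  this.\<close>

lemma alternates_transfer:
  assumes alt: "alternates n m y"
    and sgn: "\<And>i. i \<in> {1..n} \<Longrightarrow> y i \<noteq> 0 \<Longrightarrow>
      x i * y i > 0 \<or> (\<exists>j\<in>{1..n}. (j = i + 1 \<or> i = j + 1) \<and> x j * y i > 0 \<and> x j * y j > 0)"
  shows "alternates n m x"
proof -
  obtain p where p: "\<And>j. j \<le> m \<Longrightarrow> p j \<in> {1..n} \<and> y (p j) \<noteq> 0"
    "\<And>j. j < m \<Longrightarrow> p j < p (Suc j) \<and> y (p j) * y (p (Suc j)) < 0"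
    using alt unfolding alternates_def by blast
  have "\<exists>k. k \<in> {1..n} \<and> k \<le> i + 1 \<and> i \<le> k + 1 \<and> x k * y i > 0 \<and> x k * y k > 0"
    if "i \<in> {1..n}" "y i \<noteq> 0" for i
    using sgn[OF that]
  proof
    assume "x i * y i > 0"
    then show ?thesis using that by (intro exI[of _ i]) auto
  qed auto
  then obtain f where f: "\<And>i. i \<in> {1..n} \<Longrightarrow> y i \<noteq> 0 \<Longrightarrow>
      f i \<in> {1..n} \<and> f i \<le> i + 1 \<and> i \<le> f i + 1 \<and> x (f i) * y i > 0 \<and> x (f i) * y (f i) > 0"
    by metis
  have opp: "x (f i) * x (f k) < 0 \<and> f i < f k"
    if i: "i \<in> {1..n}" "y i \<noteq> 0" and k: "k \<in> {1..n}" "y k \<noteq> 0" and ik: "i < k" "y i * y k < 0" for i k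
  proof -
    have neg: "x (f i) * x (f k) < 0"
      using f[OF i] f[OF k] ik(2) by (smt (verit) mult_less_0_iff zero_less_mult_iff)
    have "f i \<noteq> f k" using neg by (metis not_square_less_zero)
    moreover have "\<not> f k < f i"
    proof
      assume "f k < f i"
      then have "f i = k" "f k = i" using f[OF i] f[OF k] ik(1) by linarith+
      then show False using f[OF i] f[OF k] ik(2) by (smt (verit) mult_less_0_iff zero_less_mult_iff)
    qed
    ultimately show ?thesis using neg by simp
  qed
  have "f (p j) \<in> {1..n} \<and> x (f (p j)) \<noteq> 0" if "j \<le> m" for j
    using f[of "p j"] p(1)[OF that] by auto
  moreover have "f (p j) < f (p (Suc j)) \<and> x (f (p j)) * x (f (p (Suc j))) < 0" if "j < m" for j
    using opp[of "p j" "p (Suc j)"] p(1)[of j] p(1)[of "Suc j"] p(2)[OF that] that by auto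
  ultimately show ?thesis unfolding alternates_def by (intro exI[of _ "f \<circ> p"]) auto
qed

lemma sign_change_between:
  fixes c :: "nat \<Rightarrow> real"
  assumes "a < b" "c a * c b < 0"
  shows "\<exists>i. a \<le> i \<and> i < b \<and> (c i = 0 \<or> c i * c (i + 1) < 0)"
proof (rule ccontr)
  assume no: "\<not> ?thesis"
  have "c a * c k > 0" if "a \<le> k" "k \<le> b" for k
    using that
  proof (induction k rule: dec_induct)
    case base
    show ?case using assms(2) by (metis mult_zero_left not_real_square_gt_zero less_irrefl)
  next
    case (step k)
    then have "c a * c k > 0" "c k \<noteq> 0" "\<not> c k * c (k + 1) < 0" using no by auto
    moreover have "c (k + 1) \<noteq> 0"
    proof (cases "k + 1 = b")
      case True
      then show ?thesis using assms(2) by auto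
    next
      case False
      then show ?thesis using no step by (metis Suc_eq_plus1 le_SucI Suc_leI le_neq_implies_less)
    qed
    ultimately show ?case by (smt (verit) Suc_eq_plus1 mult_less_0_iff zero_less_mult_iff)
  qed
  from this[of b] assms show False by auto
qed

text \<open>Every interval from \<open>p j\<close> to \<open>p (Suc j)\<close> contains a counted
  position, and the half-open intervals are disjoint. The counted set is that of
  \<open>sigma_num\<close>, so this is the link from alternations to
  \<open>sigma_num\<close>.\<close>

lemma alternates_card:
  assumes "alternates n m c"
  shows "m \<le> card {i \<in> {1..<n}. c i = 0 \<or> c i * c (i + 1) < 0}"
proof -
  obtain p where p: "\<And>j. j \<le> m \<Longrightarrow> p j \<in> {1..n} \<and> c (p j) \<noteq> 0"
    "\<And>j. j < m \<Longrightarrow> p j < p (Suc j) \<and> c (p j) * c (p (Suc j)) < 0"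
    using assms unfolding alternates_def by blast
  have "\<exists>i. p j \<le> i \<and> i < p (Suc j) \<and> (c i = 0 \<or> c i * c (i + 1) < 0)" if "j < m" for j
    using sign_change_between p(2)[OF that] by blast
  then obtain q where q: "\<And>j. j < m \<Longrightarrow> p j \<le> q j \<and> q j < p (Suc j) \<and> (c (q j) = 0 \<or> c (q j) * c (q j + 1) < 0)"
    by metis
  have mono: "p i \<le> p j" if "i \<le> j" "j \<le> m" for i j
    using that
  proof (induction j rule: dec_induct)
    case (step j)
    then show ?case using p(2)[of j] by simp
  qed simp
  have lt: "q i < q j" if "i < j" "j < m" for i j
    using q[of i] q[of j] mono[of "Suc i" j] that by fastforce
  have "inj_on q {..<m}"
    by (intro linorder_inj_onI') (use lt in fastforce)+
  moreover have "q ` {..<m} \<subseteq> {i \<in> {1..<n}. c i = 0 \<or> c i * c (i + 1) < 0}"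
  proof
    fix i assume "i \<in> q ` {..<m}"
    then obtain j where j: "j < m" "i = q j" by auto
    have "1 \<le> p j" "p (Suc j) \<le> n" using p(1)[of j] p(1)[of "Suc j"] j by auto
    then show "i \<in> {i \<in> {1..<n}. c i = 0 \<or> c i * c (i + 1) < 0}" using q[OF j(1)] j by auto
  qed
  ultimately have "card {..<m} \<le> card {i \<in> {1..<n}. c i = 0 \<or> c i * c (i + 1) < 0}"
    by (intro card_inj_on_le[of q]) auto
  then show ?thesis by simp
qed

text \<open>The polynomial changes sign exactly where \<open>c\<close> does; splitting off the first sign change
  of \<open>c\<close> gives one linear factor.\<close>

lemma sign_polynomial:
  assumes "\<not> alternates n m c" "i0 \<in> {1..n}" "c i0 \<noteq> 0"
  shows "\<exists>p :: real poly. degree p < m \<and> (\<forall>i\<in>{1..n}. poly p (real i) * c i \<ge> 0) \<and>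
    (\<forall>i\<in>{1..n}. c i \<noteq> 0 \<longrightarrow> poly p (real i) \<noteq> 0)"
  using assms
proof (induction m arbitrary: c)
  case 0
  then show ?case using alternates_0 by blast
next
  case (Suc m)
  define a where "a = (LEAST i. i \<in> {1..n} \<and> c i \<noteq> 0)"
  have a: "a \<in> {1..n}" "c a \<noteq> 0"
    using LeastI[of "\<lambda>i. i \<in> {1..n} \<and> c i \<noteq> 0" i0] Suc.prems unfolding a_def by auto
  have a_min: "c i = 0" if "i \<in> {1..n}" "i < a" for i
    using not_less_Least[of i "\<lambda>i. i \<in> {1..n} \<and> c i \<noteq> 0"] that unfolding a_def by blast
  show ?case
  proof (cases "\<exists>i\<in>{1..n}. c a * c i < 0")
    case False
    have "sgn (c a) * c i \<ge> 0" if "i \<in> {1..n}" for i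
      using False that by (metis linorder_not_less mult_less_0_iff sgn_greater sgn_less)
    then show ?thesis using a by (intro exI[of _ "[:sgn (c a):]"]) (auto simp: sgn_0_0)
  next
    case True
    define b where "b = (LEAST i. i \<in> {1..n} \<and> c a * c i < 0)"
    have b: "b \<in> {1..n}" "c a * c b < 0"
      using LeastI_ex[of "\<lambda>i. i \<in> {1..n} \<and> c a * c i < 0"] True unfolding b_def by (metis, metis)
    have b_min: "c a * c i \<ge> 0" if "i \<in> {1..n}" "i < b" for i
      using not_less_Least[of i "\<lambda>i. i \<in> {1..n} \<and> c a * c i < 0"] that unfolding b_def by force
    have "a < b" using a_min b by (metis linorder_neqE_nat mult_zero_right less_irrefl not_square_less_zero)
    \<comment> \<open>Reversing all signs from the first change \<open>b\<close> on removes exactly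
      this change, which makes the induction hypothesis applicable.\<close>
    define d where "d = (\<lambda>i. if i < b then c i else - c i)"
    have "\<not> alternates n m d"
    proof
      assume "alternates n m d"
      then obtain p where p: "\<And>j. j \<le> m \<Longrightarrow> p j \<in> {1..n} \<and> d (p j) \<noteq> 0"
        "\<And>j. j < m \<Longrightarrow> p j < p (Suc j) \<and> d (p j) * d (p (Suc j)) < 0"
        unfolding alternates_def by blast
      have mono: "p 1 \<le> p j" if "1 \<le> j" "j \<le> m" for j
        using that
      proof (induction j rule: dec_induct)
        case (step j)
        then show ?case using p(2)[of j] by simp
      qed simp
      have low: "c a * c i > 0" if "i \<in> {1..n}" "i < b" "d i \<noteq> 0" for i
        using b_min[OF that(1,2)] that a by (auto simp: d_def less_le)
      have p0: "c (p 0) \<noteq> 0" "p 0 \<in> {1..n}" using p(1)[of 0] by (auto simp: d_def split: if_splits)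
      have big: "b \<le> p 1" if "m > 0"
      proof (rule ccontr)
        assume "\<not> b \<le> p 1"
        then have "p 0 < b" "p 1 < b" using p(2)[of 0] that by auto
        then have "c a * c (p 0) > 0" "c a * c (p 1) > 0"
          using low[of "p 0"] low[of "p 1"] p(1)[of 0] p(1)[of 1] that by auto
        moreover have "c (p 0) * c (p 1) < 0"
          using p(2)[of 0] that \<open>p 0 < b\<close> \<open>p 1 < b\<close> by (simp add: d_def)
        ultimately show False by (smt (verit) mult_less_0_iff zero_less_mult_iff)
      qed
      have ge: "b \<le> p j" if "1 \<le> j" "j \<le> m" for j using big mono[OF that] that by linarith
      \<comment> \<open>An alternation of \<open>d\<close> becomes one of \<open>c\<close> with one
        more index. If \<open>p 0 < b\<close>, then \<open>b\<close> is inserted between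
        \<open>p 0\<close> and \<open>p 1\<close>; otherwise \<open>a\<close> or \<open>b\<close>,
        whichever has the sign opposite to \<open>c (p 0)\<close>, is put in front.\<close>
      define e where "e = (if p 0 < b then p 0 else if c a * c (p 0) < 0 then a else b)"
      define q where "q = (\<lambda>j. if j = 0 then e else if j = 1 then (if p 0 < b then b else p 0) else p (j - 1))"
      have qn: "q j \<in> {1..n} \<and> c (q j) \<noteq> 0" if "j \<le> Suc m" for j
      proof -
        have "j - 1 \<le> m" using that by simp
        from p(1)[OF this] have "c (p (j - 1)) \<noteq> 0" "p (j - 1) \<in> {1..n}"
          by (auto simp: d_def split: if_splits)
        moreover have "c b \<noteq> 0" using b by auto
        ultimately show ?thesis using p0 a b by (auto simp: q_def e_def)
      qed
      moreover have "q j < q (Suc j) \<and> c (q j) * c (q (Suc j)) < 0" if "j < Suc m" for j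
      proof -
        consider "j = 0" | "j = 1" | "j \<ge> 2" by linarith
        then show ?thesis
        proof cases
          case 1
          show ?thesis
          proof (cases "p 0 < b")
            case True
            then have "c a * c (p 0) > 0" using low[of "p 0"] p(1)[of 0] by auto
            then have "c (p 0) * c b < 0" using b by (smt (verit) mult_less_0_iff zero_less_mult_iff)
            then show ?thesis using True 1 by (simp add: q_def e_def)
          next
            case F: False
            show ?thesis
            proof (cases "c a * c (p 0) < 0")
              case True
              then show ?thesis using F 1 \<open>a < b\<close> by (simp add: q_def e_def)
            next
              case False
              then have "c b * c (p 0) < 0" "p 0 \<noteq> b"
                using b a p0 by (smt (verit) mult_less_0_iff zero_less_mult_iff mult_eq_0_iff)+
              then show ?thesis using F False 1 by (simp add: q_def e_def)
            qed
          qed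
        next
          case 2
          then have m: "m > 0" using that by simp
          have c1: "d (p 0) * d (p 1) < 0" "p 0 < p 1" using p(2)[of 0] m by auto
          have d1: "d (p 1) = - c (p 1)" using big m by (simp add: d_def)
          show ?thesis
          proof (cases "p 0 < b")
            case True
            then have "c a * c (p 0) > 0" using low[of "p 0"] p(1)[of 0] by auto
            moreover have "c (p 0) * c (p 1) > 0" using c1(1) d1 True by (simp add: d_def)
            ultimately have "c b * c (p 1) < 0" using b by (smt (verit) mult_less_0_iff zero_less_mult_iff)
            moreover have "b < p 1" using big m calculation by (metis le_neq_implies_less not_square_less_zero)
            ultimately show ?thesis using True 2 by (simp add: q_def)
          next
            case False
            then show ?thesis using c1 d1 2 by (simp add: q_def d_def)
          qed
        next
          case 3
          then have "1 \<le> j - 1" "j - 1 \<le> m" using that by simp_all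
          have "d (p (j - 1)) * d (p j) < 0" "p (j - 1) < p j"
            using p(2)[of "j - 1"] 3 that by auto
          moreover have "d (p (j - 1)) = - c (p (j - 1))" "d (p j) = - c (p j)"
            using ge[OF \<open>1 \<le> j - 1\<close> \<open>j - 1 \<le> m\<close>] ge[of j] 3 that by (simp_all add: d_def not_less)
          ultimately show ?thesis using 3 by (simp add: q_def)
        qed
      qed
      ultimately have "alternates n (Suc m) c" unfolding alternates_def by blast
      then show False using Suc.prems by blast
    qed
    moreover have "d i0 \<noteq> 0" using Suc.prems by (simp add: d_def)
    ultimately obtain p :: "real poly" where p: "degree p < m"
      "\<And>i. i \<in> {1..n} \<Longrightarrow> poly p (real i) * d i \<ge> 0"
      "\<And>i. i \<in> {1..n} \<Longrightarrow> d i \<noteq> 0 \<Longrightarrow> poly p (real i) \<noteq> 0"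
      using Suc.IH[of d] Suc.prems by blast
    \<comment> \<open>The root \<open>b - 1/2\<close> lies strictly between the last index before
      the first change and \<open>b\<close>, so the factor undoes the sign reversal in
      \<open>d\<close> and vanishes at no index.\<close>
    define l :: "real poly" where "l = [:real b - 1/2, -1:]"
    have l: "poly l (real i) > 0" if "i < b" for i
    proof -
      have "real i + 1 \<le> real b" using that by linarith
      then show ?thesis by (simp add: l_def)
    qed
    have l': "poly l (real i) < 0" if "\<not> i < b" for i
      using that by (simp add: l_def)
    have "poly (p * l) (real i) * c i \<ge> 0" if "i \<in> {1..n}" for i
    proof (cases "i < b")
      case True
      have eq: "poly (p * l) (real i) * c i = poly l (real i) * (poly p (real i) * d i)"
        using True by (simp add: d_def)
      show ?thesis unfolding eq using l[OF True] p(2)[OF that] by (metis mult_nonneg_nonneg less_imp_le)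
    next
      case False
      have eq: "poly (p * l) (real i) * c i = - poly l (real i) * (poly p (real i) * d i)"
        using False by (simp add: d_def)
      show ?thesis unfolding eq using l'[OF False] p(2)[OF that] by (metis mult_nonneg_nonneg less_imp_le neg_0_le_iff_le)
    qed
    moreover have "poly (p * l) (real i) \<noteq> 0" if "i \<in> {1..n}" "c i \<noteq> 0" for i
      using p(3)[OF that(1)] that(2) l[of i] l'[of i] by (cases "i < b") (auto simp: d_def)
    moreover have "degree (p * l) < Suc m"
      using degree_mult_le[of p l] p(1) by (simp add: l_def)
    ultimately show ?thesis by blast
  qed
qed

text \<open>With too few alternations, \<open>sign_polynomial\<close> would give a polynomial of
  degree below \<open>m\<close> whose pairing with \<open>c\<close> has only nonnegative terms and a
  positive one at \<open>i0\<close>. But this pairing is a combination of the vanishing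
  moments.\<close>

lemma moments_zero_alternates:
  assumes "\<And>r. r < m \<Longrightarrow> (\<Sum>i = 1..n. real i ^ r * c i) = 0" and "i0 \<in> {1..n}" "c i0 \<noteq> 0"
  shows "alternates n m c"
proof (rule ccontr)
  assume "\<not> alternates n m c"
  from sign_polynomial[OF this assms(2,3)] obtain p :: "real poly" where p: "degree p < m"
    "\<And>i. i \<in> {1..n} \<Longrightarrow> poly p (real i) * c i \<ge> 0"
    "\<And>i. i \<in> {1..n} \<Longrightarrow> c i \<noteq> 0 \<Longrightarrow> poly p (real i) \<noteq> 0"
    by blast
  have "(\<Sum>i = 1..n. poly p (real i) * c i) = (\<Sum>i = 1..n. \<Sum>r\<le>degree p. coeff p r * (real i ^ r * c i))"
    by (simp add: poly_altdef sum_distrib_right mult.assoc)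
  also have "\<dots> = (\<Sum>r\<le>degree p. coeff p r * (\<Sum>i = 1..n. real i ^ r * c i))"
    by (subst sum.swap) (simp add: sum_distrib_left)
  also have "\<dots> = 0" using assms(1) p(1) by (intro sum.neutral) auto
  finally have "poly p (real i0) * c i0 = 0"
    using sum_nonneg_eq_0_iff[of "{1..n}" "\<lambda>i. poly p (real i) * c i"] p(2) assms(2) by auto
  then show False using p(3) assms(2,3) by auto
qed

section \<open>Coordinates, Lambda and the sign flip\<close>

lemma bij_ix: "bij_betw (ix :: nat \<Rightarrow> 'n::{finite,linorder}) {1..CARD('n)} UNIV"
proof -
  define xs where "xs = sorted_list_of_set (UNIV :: 'n set)"
  have "bij_betw ((!) xs) {..<CARD('n)} UNIV"
    by (rule bij_betw_nth) (auto simp: xs_def)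
  moreover have "bij_betw (\<lambda>i. i - 1) {1..CARD('n)} {..<CARD('n)}"
    by (rule bij_betw_byWitness[where f' = Suc]) auto
  ultimately have "bij_betw ((!) xs \<circ> (\<lambda>i. i - 1)) {1..CARD('n)} UNIV"
    by (rule bij_betw_trans[rotated])
  then show ?thesis by (simp add: ix_def[abs_def] xs_def comp_def)
qed

lemma ix_eq_iff: "i \<in> {1..CARD('n)} \<Longrightarrow> j \<in> {1..CARD('n)} \<Longrightarrow>
    (ix i :: 'n::{finite,linorder}) = ix j \<longleftrightarrow> i = j"
  using bij_ix[where 'n='n] unfolding bij_betw_def inj_on_def by blast

lemma ix_surj: "\<exists>i\<in>{1..CARD('n)}. (k :: 'n::{finite,linorder}) = ix i"
  using bij_ix[where 'n='n] unfolding bij_betw_def by blast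

lemma cmp_simps [simp]:
  "cmp (x + y) i = cmp x i + cmp y i" "cmp (x - y) i = cmp x i - cmp y i"
  "cmp (- x) i = - cmp x i" "cmp (a *\<^sub>R x) i = a * cmp x i" "cmp 0 i = 0"
  by (simp_all add: cmp_def)

lemma cmp_sum: "cmp (\<Sum>k\<in>A. f k) i = (\<Sum>k\<in>A. cmp (f k) i)"
  by (simp add: cmp_def)

lemma bounded_linear_cmp: "bounded_linear (\<lambda>x. cmp x i)"
  unfolding cmp_def by (rule bounded_linear_vec_nth)

lemma abs_cmp_le: "\<bar>cmp x i\<bar> \<le> norm x"
  unfolding cmp_def by (rule component_le_norm_cart)

lemma cmp_axis: "i \<in> {1..CARD('n)} \<Longrightarrow> j \<in> {1..CARD('n)} \<Longrightarrow>
    cmp (axis (ix j) a :: (real,'n::{finite,linorder}) vec) i = (if i = j then a else 0)"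
  by (auto simp: cmp_def axis_def ix_eq_iff)

lemma vec_eq_cmpI:
  fixes x y :: "(real,'n::{finite,linorder}) vec"
  assumes "\<And>i. i \<in> {1..CARD('n)} \<Longrightarrow> cmp x i = cmp y i"
  shows "x = y"
  unfolding vec_eq_iff using assms ix_surj[where 'n='n] by (metis cmp_def)

lemma nonzero_cmp:
  fixes x :: "(real,'n::{finite,linorder}) vec"
  assumes "x \<noteq> 0" shows "\<exists>i\<in>{1..CARD('n)}. cmp x i \<noteq> 0"
  using vec_eq_cmpI[of x 0] assms by (metis cmp_simps(5))

lemma vec_eq_sum_axis:
  fixes x :: "(real,'n::{finite,linorder}) vec"
  shows "x = (\<Sum>j = 1..CARD('n). cmp x j *\<^sub>R axis (ix j) 1)"
proof (rule vec_eq_cmpI)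
  fix i assume i: "i \<in> {1..CARD('n)}"
  have "cmp (\<Sum>j = 1..CARD('n). cmp x j *\<^sub>R axis (ix j) 1 :: (real,'n) vec) i
      = (\<Sum>j = 1..CARD('n). if i = j then cmp x j else 0)"
    unfolding cmp_sum by (intro sum.cong) (use i in \<open>auto simp: cmp_axis\<close>)
  also have "\<dots> = cmp x i" using i by (simp add: sum.delta)
  finally show "cmp x i = cmp (\<Sum>j = 1..CARD('n). cmp x j *\<^sub>R axis (ix j) 1 :: (real,'n) vec) i" by (rule sym)
qed

lemma alternates_scaleR:
  assumes "a \<noteq> 0" "alternates n m (cmp (a *\<^sub>R x))"
  shows "alternates n m (cmp x)"
  by (rule alternates_mult[OF assms(1)]) (use assms(2) in \<open>simp add: cmp_simps[abs_def] fun_eq_iff\<close>)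

text \<open>For a fixed index choice \<open>p\<close> the condition consists of finitely many strict
  inequalities; the set is the union over all \<open>p\<close>.\<close>

lemma open_alternates: "open {x :: (real,'n::{finite,linorder}) vec. alternates n m (cmp x)}"
proof -
  have eq: "{x :: (real,'n) vec. alternates n m (cmp x)} =
    (\<Union>p. (\<Inter>j\<in>{..m}. {x. p j \<in> {1..n} \<and> cmp x (p j) \<noteq> 0}) \<inter>
      (\<Inter>j\<in>{..<m}. {x. p j < p (Suc j) \<and> cmp x (p j) * cmp x (p (Suc j)) < 0}))"
    unfolding alternates_def by auto
  have c: "continuous_on UNIV (\<lambda>x :: (real,'n) vec. cmp x i)" for i
    by (simp add: bounded_linear_cmp linear_continuous_on)
  have "open {x :: (real,'n) vec. p j \<in> {1..n} \<and> cmp x (p j) \<noteq> 0}" for p j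
    by (intro open_Collect_conj open_Collect_const open_Collect_neq c continuous_intros)
  moreover have "open {x :: (real,'n) vec. p j < p (Suc j) \<and> cmp x (p j) * cmp x (p (Suc j)) < 0}" for p j
    by (intro open_Collect_conj open_Collect_const open_Collect_less c continuous_intros)
  ultimately show ?thesis
    unfolding eq by (intro open_UN ballI open_Int open_INT) auto
qed

lemma Lambda_setD:
  fixes x :: "(real,'n::{finite,linorder}) vec"
  assumes "x \<in> Lambda_set" "i \<in> {1..CARD('n)}" "cmp x i = 0"
  shows "2 \<le> i" "i + 1 \<le> CARD('n)" "cmp x (i - 1) * cmp x (i + 1) < 0"
proof -
  have "i \<noteq> 1" "i \<noteq> CARD('n)" using assms by (auto simp: Lambda_set_def)
  then show "2 \<le> i" "i + 1 \<le> CARD('n)" using assms(2) by auto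
  then show "cmp x (i - 1) * cmp x (i + 1) < 0" using assms by (auto simp: Lambda_set_def)
qed

text \<open>A zero coordinate of \<open>x\<close> has neighbours of opposite signs, so whatever sign
  a perturbation gives it is already present next to it, and \<open>alternates_transfer\<close>
  applies. Hence perturbing a point of \<open>Lambda_set\<close> creates no alternations.\<close>

lemma Lambda_set_nearby_alternates:
  fixes x :: "(real,'n::{finite,linorder}) vec"
  assumes x: "x \<in> Lambda_set"
  shows "\<exists>\<delta>>0. \<forall>u. norm (u - x) < \<delta> \<longrightarrow> alternates CARD('n) m (cmp u) \<longrightarrow> alternates CARD('n) m (cmp x)"
proof -
  \<comment> \<open>The smallest modulus of a nonzero coordinate: smaller perturbations keep all
    nonzero signs. The inserted 1 only guards against an empty minimum.\<close>
  define \<delta> where "\<delta> = Min (insert 1 ((\<lambda>i. \<bar>cmp x i\<bar>) ` {i \<in> {1..CARD('n)}. cmp x i \<noteq> 0}))"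
  have "\<delta> > 0" unfolding \<delta>_def by (subst Min_gr_iff) auto
  have \<delta>: "\<delta> \<le> \<bar>cmp x i\<bar>" if "i \<in> {1..CARD('n)}" "cmp x i \<noteq> 0" for i
    unfolding \<delta>_def using that by (intro Min_le) auto
  have "alternates CARD('n) m (cmp x)" if u: "norm (u - x) < \<delta>" "alternates CARD('n) m (cmp u)" for u
  proof (rule alternates_transfer[OF u(2)])
    fix i assume i: "i \<in> {1..CARD('n)}" "cmp u i \<noteq> 0"
    have keep: "cmp x j * cmp u j > 0" if "j \<in> {1..CARD('n)}" "cmp x j \<noteq> 0" for j
    proof -
      have "\<bar>cmp u j - cmp x j\<bar> < \<bar>cmp x j\<bar>"
        using abs_cmp_le[of "u - x" j] u(1) \<delta>[OF that] by simp
      then show ?thesis by (cases "cmp x j > 0") (auto simp: zero_less_mult_iff)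
    qed
    show "cmp x i * cmp u i > 0 \<or> (\<exists>j\<in>{1..CARD('n)}. (j = i + 1 \<or> i = j + 1) \<and>
        cmp x j * cmp u i > 0 \<and> cmp x j * cmp u j > 0)"
    proof (cases "cmp x i = 0")
      case True
      note L = Lambda_setD[OF x i(1) True]
      then have ne: "cmp x (i - 1) \<noteq> 0" "cmp x (i + 1) \<noteq> 0" by auto
      have r: "i - 1 \<in> {1..CARD('n)}" "i + 1 \<in> {1..CARD('n)}" "i = (i - 1) + 1" using L by auto
      have "cmp x (i - 1) * cmp u i > 0 \<or> cmp x (i + 1) * cmp u i > 0"
        using L(3) i(2) by (smt (verit) mult_less_0_iff zero_less_mult_iff)
      then show ?thesis using keep[OF r(1) ne(1)] keep[OF r(2) ne(2)] r by metis
    qed (use keep[OF i(1)] in auto)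
  qed
  then show ?thesis using \<open>\<delta> > 0\<close> by blast
qed

text \<open>The diagonal matrix with entries (-1)^j, packaged as a bounded linear map so that it can
  be composed with fundamental matrices.\<close>

definition flip :: "(real,'n::{finite,linorder}) vec \<Rightarrow>\<^sub>L (real,'n) vec" where
  "flip = Blinfun (\<lambda>x. \<Sum>j = 1..CARD('n). ((-1) ^ j * cmp x j) *\<^sub>R axis (ix j) 1)"

lemma flip_apply: "flip x = (\<Sum>j = 1..CARD('n). ((-1) ^ j * cmp x j) *\<^sub>R axis (ix j) 1)"
  for x :: "(real,'n::{finite,linorder}) vec"
  unfolding flip_def
  by (rule bounded_linear_Blinfun_apply[THEN fun_cong])
    (intro bounded_linear_sum bounded_linear_scaleR_const bounded_linear_const_mult bounded_linear_cmp)

lemma cmp_flip: "i \<in> {1..CARD('n)} \<Longrightarrow> cmp (flip x) i = (-1) ^ i * cmp x i"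
  for x :: "(real,'n::{finite,linorder}) vec"
proof -
  assume i: "i \<in> {1..CARD('n)}"
  have "cmp (flip x) i = (\<Sum>j = 1..CARD('n). if i = j then (-1) ^ j * cmp x j else 0)"
    unfolding flip_apply cmp_sum by (intro sum.cong) (use i in \<open>auto simp: cmp_axis\<close>)
  then show ?thesis using i by (simp add: sum.delta)
qed

lemma flip_flip [simp]: "flip (flip x) = x"
  by (rule vec_eq_cmpI) (simp add: cmp_flip flip: power_mult_distrib mult.assoc power_add)

lemma norm_flip [simp]: "norm (flip x) = norm x"
proof -
  have sq: "(norm x)\<^sup>2 = (\<Sum>i = 1..CARD('n). (cmp x i)\<^sup>2)" for x :: "(real,'n::{finite,linorder}) vec"
    using sum.reindex_bij_betw[OF bij_ix[where 'n='n], of "\<lambda>k. (x $ k)\<^sup>2"]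
    by (simp add: norm_eq_sqrt_inner inner_vec_def power2_eq_square cmp_def sum_nonneg)
  have "(norm (flip x))\<^sup>2 = (norm x)\<^sup>2" unfolding sq
    by (intro sum.cong) (simp_all add: cmp_flip power_mult_distrib flip: power_mult)
  then show ?thesis by (simp add: power2_eq_iff_nonneg)
qed

lemma norm_flip_le: "norm (flip o\<^sub>L L o\<^sub>L flip) \<le> norm L"
  by (rule norm_blinfun_bound) (simp_all, metis norm_blinfun norm_flip)

text \<open>An adjacent pair with nonzero product is a sign change of exactly one of
  \<open>x\<close> and \<open>flip x\<close>. A zero at i is counted by both at i and by neither at
  i - 1, since its neighbours do not vanish. The correction \<open>b i - b (Suc i)\<close>
  telescopes and vanishes at both ends because the outer coordinates of \<open>x\<close> are
  nonzero.\<close>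

lemma sigma_num_flip:
  fixes x :: "(real,'n::{finite,linorder}) vec"
  assumes x: "x \<in> Lambda_set"
  shows "sigma_num x + sigma_num (flip x) = CARD('n) - 1"
proof -
  define P where "P = (\<lambda>(x :: (real,'n) vec) i. cmp x i = 0 \<or> cmp x i * cmp x (i + 1) < 0)"
  define b where "b = (\<lambda>i. of_bool (cmp x i = 0) :: int)"
  have s: "int (sigma_num x) = (\<Sum>i\<in>{1..<CARD('n)}. of_bool (P x i))" for x :: "(real,'n) vec"
    by (simp add: sigma_num_def P_def Int_def of_bool_def sum.If_cases)
  have "of_bool (P x i) + of_bool (P (flip x) i) = 1 + (b i - b (Suc i))"
    if "i \<in> {1..<CARD('n)}" for i
  proof -
    have i: "i \<in> {1..CARD('n)}" "Suc i \<in> {1..CARD('n)}" using that by auto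
    have f: "cmp (flip x) i = (-1) ^ i * cmp x i" "cmp (flip x) (Suc i) = - ((-1) ^ i) * cmp x (Suc i)"
      using i by (simp_all add: cmp_flip)
    have f0: "cmp (flip x) i = 0 \<longleftrightarrow> cmp x i = 0" unfolding f by simp
    have "(-1) ^ i * (-1 :: real) ^ i = 1" by (simp flip: power_mult_distrib)
    then have "cmp (flip x) i * cmp (flip x) (Suc i) = - (cmp x i * cmp x (Suc i))"
      unfolding f by (simp add: algebra_simps)
    then have Pf: "P (flip x) i \<longleftrightarrow> cmp x i = 0 \<or> cmp x i * cmp x (Suc i) > 0"
      unfolding P_def f0 by simp
    show ?thesis
    proof (cases "cmp x i = 0")
      case True
      then have "cmp x (Suc i) \<noteq> 0" using Lambda_setD(3)[OF x i(1)] by auto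
      then show ?thesis using True Pf by (simp add: P_def b_def)
    next
      case F: False
      show ?thesis
      proof (cases "cmp x (Suc i) = 0")
        case True
        then show ?thesis using F Pf by (simp add: P_def b_def)
      next
        case False
        then have "cmp x i * cmp x (Suc i) \<noteq> 0" using F by simp
        then show ?thesis using F False Pf by (auto simp: P_def b_def)
      qed
    qed
  qed
  then have "int (sigma_num x) + int (sigma_num (flip x)) = (\<Sum>i\<in>{1..<CARD('n)}. 1 + (b i - b (Suc i)))"
    unfolding s sum.distrib[symmetric] by (rule sum.cong[OF refl])
  also have "\<dots> = int (CARD('n) - 1) + (b 1 - b CARD('n))"
    using sum_Suc_diff'[of 1 "CARD('n)" "\<lambda>i. - b i"] by (simp add: sum.distrib Suc_le_eq)
  also have "b 1 - b CARD('n) = 0" using x by (simp add: Lambda_set_def b_def)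
  finally show ?thesis by linarith
qed

section \<open>Linear differential equations\<close>

lemma continuous_on_if_has_vector_derivative:
  assumes "\<And>t. t \<in> S \<Longrightarrow> (f has_vector_derivative f' t) (at t)"
  shows "continuous_on S f"
  using assms has_vector_derivative_continuous by (intro continuous_at_imp_continuous_on) blast

lemma antiderivative_exists:
  fixes f :: "real \<Rightarrow> 'a::banach"
  assumes "continuous_on UNIV f"
  shows "\<exists>F. F 0 = 0 \<and> (\<forall>t. (F has_vector_derivative f t) (at t))"
proof -
  define F where "F = (\<lambda>t. if t \<ge> 0 then integral {0..t} f else - integral {t..0} f)"
  have c: "continuous_on S f" for S using assms continuous_on_subset by blast
  have "(F has_vector_derivative f t) (at t)" for t
  proof -
    \<comment> \<open>Near t, \<open>F\<close> differs by a constant from the integral with the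
      fixed lower limit -R, which handles both cases in the definition of \<open>F\<close> and the
      junction at 0 together.\<close>
    define R where "R = \<bar>t\<bar> + 1"
    have int: "f integrable_on {a..b}" for a b using c by (rule integrable_continuous_real)
    have eq: "integral {-R..u} f - integral {-R..0} f = F u" if "u \<in> {-R<..<R}" for u
    proof (cases "u \<ge> 0")
      case True
      then show ?thesis
        using Henstock_Kurzweil_Integration.integral_combine[of "-R" 0 u f] int by (simp add: F_def R_def algebra_simps)
    next
      case False
      then show ?thesis
        using Henstock_Kurzweil_Integration.integral_combine[of "-R" u 0 f] int that by (simp add: F_def algebra_simps)
    qed
    have "((\<lambda>u. integral {-R..u} f) has_vector_derivative f t) (at t within {-R..R})"
      by (rule integral_has_vector_derivative[OF c]) (simp add: R_def, arith)
    then have "((\<lambda>u. integral {-R..u} f) has_vector_derivative f t) (at t)"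
      by (subst (asm) at_within_interior) (auto simp: R_def)
    then have "((\<lambda>u. integral {-R..u} f - integral {-R..0} f) has_vector_derivative f t) (at t)"
      by (auto intro!: derivative_eq_intros)
    then show ?thesis
      by (rule has_vector_derivative_transform_within_open[where S = "{-R<..<R}"])
         (use eq in \<open>auto simp: R_def\<close>)
  qed
  moreover have "F 0 = 0" by (simp add: F_def)
  ultimately show ?thesis by blast
qed

text \<open>The induction step of the factorial estimate for the Picard terms. Passing to
  \<open>F (e * s)\<close> with \<open>e\<close> the sign of \<open>t\<close> reduces negative times
  to positive ones.\<close>

lemma antiderivative_bound:
  fixes f F :: "real \<Rightarrow> 'a::real_normed_vector"
  assumes F0: "F 0 = 0" and F: "\<And>t. (F has_vector_derivative f t) (at t)"
    and bd: "\<And>s. \<bar>s\<bar> \<le> \<bar>t\<bar> \<Longrightarrow> norm (f s) \<le> C * \<bar>s\<bar> ^ k / fact k"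
  shows "norm (F t) \<le> C * \<bar>t\<bar> ^ Suc k / fact (Suc k)"
proof (cases "t = 0")
  case False
  define e where "e = sgn t"
  have e: "t = e * \<bar>t\<bar>" "\<bar>e\<bar> = 1" using False by (auto simp: e_def sgn_mult_abs abs_sgn_eq)
  have D: "((\<lambda>s. F (e * s)) has_vector_derivative e *\<^sub>R f (e * s)) (at s)" for s
  proof -
    have "((\<lambda>s. e * s) has_real_derivative e) (at s)" by (auto intro!: derivative_eq_intros)
    then show ?thesis
      using vector_diff_chain_at[of "\<lambda>s. e * s" e s F "f (e * s)"] F[of "e * s"]
      by (simp add: o_def has_real_derivative_iff_has_vector_derivative)
  qed
  have "norm (F (e * \<bar>t\<bar>) - F (e * 0)) \<le> C * \<bar>t\<bar> ^ Suc k / fact (Suc k) - C * 0 ^ Suc k / fact (Suc k)"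
  proof (rule differentiable_bound_general[where f = "\<lambda>s. F (e * s)" and f' = "\<lambda>s. e *\<^sub>R f (e * s)"
        and \<phi> = "\<lambda>s. C * s ^ Suc k / fact (Suc k)" and \<phi>' = "\<lambda>s. C * s ^ k / fact k"])
    show "continuous_on {0..\<bar>t\<bar>} (\<lambda>s. F (e * s))"
      using D by (rule continuous_on_if_has_vector_derivative)
    fix s assume s: "0 < s" "s < \<bar>t\<bar>"
    have "((\<lambda>s. s ^ Suc k) has_real_derivative real (Suc k) * s ^ k) (at s)"
      using DERIV_pow[of "Suc k" s] by (simp only: diff_Suc_Suc diff_zero)
    from DERIV_cdivide[OF DERIV_cmult[OF this, of C], of "fact (Suc k)"]
    have "((\<lambda>s. C * s ^ Suc k / fact (Suc k)) has_real_derivative C * (real (Suc k) * s ^ k) / fact (Suc k)) (at s)" .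
    moreover have "C * (real (Suc k) * s ^ k) / fact (Suc k) = C * s ^ k / fact k"
      by (simp add: field_simps del: of_nat_Suc)
    ultimately show "((\<lambda>s. C * s ^ Suc k / fact (Suc k)) has_vector_derivative C * s ^ k / fact k) (at s)"
      by (simp only: has_real_derivative_iff_has_vector_derivative)
    show "norm (e *\<^sub>R f (e * s)) \<le> C * s ^ k / fact k"
      using bd[of "e * s"] s e(2) by (simp add: abs_mult)
  qed (use False D in \<open>auto intro!: continuous_intros\<close>)
  then show ?thesis using e F0 by simp
qed (simp add: F0)

text \<open>Existence by the Picard series.\<close>

lemma linear_ode_exists:
  fixes A :: "real \<Rightarrow> 'b::real_normed_vector" and x0 :: "'a::banach"
  assumes b: "bounded_bilinear bil" and A: "continuous_on UNIV A"
  shows "\<exists>x. x 0 = x0 \<and> (\<forall>t. (x has_vector_derivative bil (A t) (x t)) (at t))"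
proof -
  interpret bounded_bilinear bil by (rule b)
  define I where "I = (\<lambda>f :: real \<Rightarrow> 'a. SOME F. F 0 = 0 \<and> (\<forall>t. (F has_vector_derivative f t) (at t)))"
  have I: "I f 0 = 0" "\<And>t. (I f has_vector_derivative f t) (at t)" if "continuous_on UNIV f" for f
    using someI_ex[OF antiderivative_exists[OF that]] unfolding I_def by auto
  define X where "X = rec_nat (\<lambda>t. x0) (\<lambda>_ f. I (\<lambda>t. bil (A t) (f t)))"
  have X0: "X 0 = (\<lambda>t. x0)" and XS: "X (Suc k) = I (\<lambda>t. bil (A t) (X k t))" for k
    by (simp_all add: X_def)
  have cX: "continuous_on UNIV (X k)" for k
  proof (induction k)
    case (Suc k)
    then have "continuous_on UNIV (\<lambda>t. bil (A t) (X k t))" using A by (intro continuous_on)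
    from I(2)[OF this] show ?case
      unfolding XS by (rule continuous_on_if_has_vector_derivative)
  qed (simp add: X0)
  have cP: "continuous_on UNIV (\<lambda>t. bil (A t) (X k t))" for k using A cX by (intro continuous_on)
  define x where "x = (\<lambda>t. \<Sum>k. X k t)"
  \<comment> \<open>The derivative of term k + 1 is the equation applied to term k, so the partial
    sums of derivatives run one index ahead of the partial sums of the series; \<open>sX'\<close>
    records this.\<close>
  define X' where "X' = (\<lambda>k t. case k of 0 \<Rightarrow> 0 | Suc k \<Rightarrow> bil (A t) (X k t))"
  have dX: "(X k has_vector_derivative X' k t) (at t)" for k t
    using I(2)[OF cP] by (cases k) (auto simp: X0 XS X'_def)
  have sX': "(\<Sum>i<Suc m. X' i t) = bil (A t) (\<Sum>i<m. X i t)" for m t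
    unfolding sum.lessThan_Suc_shift by (simp add: X'_def sum_right)
  obtain c where c: "c > 0" "\<And>a y. norm (bil a y) \<le> norm a * norm y * c" using pos_bounded by blast
  have main: "(x has_vector_derivative bil (A t) (x t)) (at t) \<and> (\<lambda>k. X k t) sums x t" for t
  proof -
    define S where "S = ball (0::real) (\<bar>t\<bar> + 1)"
    have "compact (A ` cball 0 (\<bar>t\<bar> + 1))"
      using A by (intro compact_continuous_image) (auto intro: continuous_on_subset)
    then have "bounded (A ` cball 0 (\<bar>t\<bar> + 1))" by (rule compact_imp_bounded)
    then obtain M0 where M0: "\<And>s. s \<in> cball 0 (\<bar>t\<bar> + 1) \<Longrightarrow> norm (A s) \<le> M0"
      unfolding bounded_iff by blast
    define M where "M = max M0 0 * c"
    have M0': "M \<ge> 0" using c by (simp add: M_def)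
    have M: "norm (bil (A s) y) \<le> M * norm y" if "s \<in> S" for s y
    proof -
      have "norm (bil (A s) y) \<le> norm (A s) * norm y * c" by (rule c(2))
      also have "\<dots> \<le> max M0 0 * norm y * c"
        using M0[of s] that c(1) by (intro mult_right_mono) (auto simp: S_def)
      finally show ?thesis by (simp add: M_def mult_ac)
    qed
    have bX: "norm (X k s) \<le> (norm x0 * M ^ k) * \<bar>s\<bar> ^ k / fact k" if "s \<in> S" for k s
      using that
    proof (induction k arbitrary: s)
      case (Suc k)
      show ?case unfolding XS
      proof (rule antiderivative_bound[OF I[OF cP]])
        fix r :: real assume "\<bar>r\<bar> \<le> \<bar>s\<bar>"
        then have r: "r \<in> S" using Suc.prems by (auto simp: S_def)
        have "norm (bil (A r) (X k r)) \<le> M * norm (X k r)" by (rule M[OF r])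
        also have "\<dots> \<le> M * ((norm x0 * M ^ k) * \<bar>r\<bar> ^ k / fact k)"
          using Suc.IH[OF r] M0' by (intro mult_left_mono)
        finally show "norm (bil (A r) (X k r)) \<le> norm x0 * M ^ Suc k * \<bar>r\<bar> ^ k / fact k"
          by (simp add: mult_ac)
      qed
    qed (simp add: X0)
    have bX': "norm (X k s) \<le> norm x0 * ((M * (\<bar>t\<bar> + 1)) ^ k /\<^sub>R fact k)" if "s \<in> S" for k s
    proof -
      have "norm (X k s) \<le> norm x0 * ((M * \<bar>s\<bar>) ^ k / fact k)"
        using bX[OF that, of k] by (simp add: power_mult_distrib mult_ac)
      also have "\<dots> \<le> norm x0 * ((M * (\<bar>t\<bar> + 1)) ^ k / fact k)"
        using that M0' by (intro mult_left_mono divide_right_mono power_mono) (auto simp: S_def)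
      finally show ?thesis by (simp add: divide_inverse_commute)
    qed
    have sm: "summable (\<lambda>k. norm x0 * ((M * (\<bar>t\<bar> + 1)) ^ k /\<^sub>R fact k))"
      by (intro summable_mult summable_exp_generic)
    have ul: "uniform_limit S (\<lambda>n t. \<Sum>i<n. X i t) x sequentially"
      unfolding x_def by (rule Weierstrass_m_test[OF bX' sm])
    have sums: "(\<lambda>k. X k s) sums x s" if "s \<in> S" for s
      using summable_comparison_test'[OF sm, of 0 "\<lambda>k. X k s"] bX'[OF that] unfolding x_def
      by (simp add: summable_sums)
    have t: "t \<in> S" by (simp add: S_def)
    have "\<exists>g. \<forall>s\<in>S. (\<lambda>k. X k s) sums g s \<and> (g has_derivative (\<lambda>h. h *\<^sub>R bil (A s) (x s))) (at s within S)"
    proof (rule has_derivative_series[where f' = "\<lambda>k s h. h *\<^sub>R X' k s"])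
      show "convex S" by (simp add: S_def)
      show "(X k has_derivative (\<lambda>h. h *\<^sub>R X' k s)) (at s within S)" for k s
        using dX has_vector_derivative_at_within unfolding has_vector_derivative_def by blast
      fix e :: real assume e: "e > 0"
      have "eventually (\<lambda>n. \<forall>s\<in>S. dist (\<Sum>i<n. X i s) (x s) < e / (M + 1)) sequentially"
        using ul e M0' unfolding uniform_limit_iff by simp
      then have "eventually (\<lambda>n. \<forall>s\<in>S. \<forall>h. norm ((\<Sum>i<Suc n. h *\<^sub>R X' i s) - h *\<^sub>R bil (A s) (x s)) \<le> e * norm h) sequentially"
      proof (rule eventually_mono, intro ballI allI)
        fix m s and h :: real assume *: "\<forall>s\<in>S. dist (\<Sum>i<m. X i s) (x s) < e / (M + 1)" and s: "s \<in> S"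
        have eq: "(\<Sum>i<Suc m. h *\<^sub>R X' i s) - h *\<^sub>R bil (A s) (x s) = h *\<^sub>R bil (A s) ((\<Sum>i<m. X i s) - x s)"
          unfolding scaleR_sum_right[symmetric] sX' by (simp add: diff_right algebra_simps)
        have "norm (bil (A s) ((\<Sum>i<m. X i s) - x s)) \<le> M * (e / (M + 1))"
        proof (rule order_trans[OF M[OF s]])
          have "norm ((\<Sum>i<m. X i s) - x s) \<le> e / (M + 1)" using * s by (simp add: dist_norm less_imp_le)
          then show "M * norm ((\<Sum>i<m. X i s) - x s) \<le> M * (e / (M + 1))" using M0' by (rule mult_left_mono)
        qed
        moreover have "M * (e / (M + 1)) \<le> e" using M0' e by (simp add: field_simps)
        ultimately have "norm (bil (A s) ((\<Sum>i<m. X i s) - x s)) \<le> e" by linarith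
        with eq show "norm ((\<Sum>i<Suc m. h *\<^sub>R X' i s) - h *\<^sub>R bil (A s) (x s)) \<le> e * norm h"
          by (simp only: norm_scaleR real_norm_def) (metis abs_ge_zero mult.commute mult_left_mono)
      qed
      then show "eventually (\<lambda>n. \<forall>s\<in>S. \<forall>h. norm ((\<Sum>i<n. h *\<^sub>R X' i s) - h *\<^sub>R bil (A s) (x s)) \<le> e * norm h) sequentially"
        by (subst (asm) eventually_sequentially_Suc)
    qed (use t sums in auto)
    then obtain g where g: "\<And>s. s \<in> S \<Longrightarrow> (\<lambda>k. X k s) sums g s"
      "\<And>s. s \<in> S \<Longrightarrow> (g has_derivative (\<lambda>h. h *\<^sub>R bil (A s) (x s))) (at s within S)" by blast
    have gx: "g s = x s" if "s \<in> S" for s using g(1)[OF that] sums[OF that] by (rule sums_unique2)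
    have "(g has_vector_derivative bil (A t) (x t)) (at t)"
      using g(2)[OF t] at_within_open[OF t] by (simp add: has_vector_derivative_def S_def)
    then have "(x has_vector_derivative bil (A t) (x t)) (at t)"
      by (rule has_vector_derivative_transform_within_open[where S = S]) (use gx t in \<open>auto simp: S_def\<close>)
    then show ?thesis using sums[OF t] by blast
  qed
  have "X k 0 = (if k = 0 then x0 else 0)" for k
    using I(1)[OF cP] by (cases k) (auto simp: X0 XS)
  then have "(\<lambda>k. X k 0) sums x0" using sums_single[of 0 "\<lambda>_. x0"] by simp
  then have "x 0 = x0" using main sums_unique2 by blast
  then show ?thesis using main by blast
qed

section \<open>Fundamental matrices together with their inverses\<close>

text \<open>The inverse \<Psi> is carried along as the solution of the adjoint equation. The
  composition of \<Phi> at t with \<Psi> at s is then the evolution operator from s to t.\<close>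

definition fundamental_pair ::
  "(real \<Rightarrow> 'a::euclidean_space \<Rightarrow>\<^sub>L 'a) \<Rightarrow> (real \<Rightarrow> 'a \<Rightarrow>\<^sub>L 'a) \<Rightarrow> (real \<Rightarrow> 'a \<Rightarrow>\<^sub>L 'a) \<Rightarrow> bool" where
  "fundamental_pair A \<Phi> \<Psi> \<longleftrightarrow> \<Phi> 0 = id_blinfun \<and> \<Psi> 0 = id_blinfun \<and>
     (\<forall>t. (\<Phi> has_vector_derivative (A t o\<^sub>L \<Phi> t)) (at t)) \<and>
     (\<forall>t. (\<Psi> has_vector_derivative - (\<Psi> t o\<^sub>L A t)) (at t)) \<and>
     (\<forall>t. \<Phi> t o\<^sub>L \<Psi> t = id_blinfun \<and> \<Psi> t o\<^sub>L \<Phi> t = id_blinfun)"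

text \<open>The product of \<Psi> and \<Phi> has derivative zero, so it stays the identity; in
  finite dimension a left inverse is also a right inverse.\<close>

lemma fundamental_pair_if:
  fixes \<Phi> \<Psi> :: "real \<Rightarrow> 'a::euclidean_space \<Rightarrow>\<^sub>L 'a"
  assumes \<Phi>: "\<Phi> 0 = id_blinfun" "\<And>t. (\<Phi> has_vector_derivative (A t o\<^sub>L \<Phi> t)) (at t)"
    and \<Psi>: "\<Psi> 0 = id_blinfun" "\<And>t. (\<Psi> has_vector_derivative - (\<Psi> t o\<^sub>L A t)) (at t)"
  shows "fundamental_pair A \<Phi> \<Psi>"
proof -
  have "((\<lambda>t. \<Psi> t o\<^sub>L \<Phi> t) has_vector_derivative 0) (at t)" for t
  proof -
    have "(\<Psi> t o\<^sub>L (A t o\<^sub>L \<Phi> t)) + (- (\<Psi> t o\<^sub>L A t) o\<^sub>L \<Phi> t) = 0"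
      by (rule blinfun_eqI) (simp add: blinfun.bilinear_simps)
    then show ?thesis
      using bounded_bilinear.has_vector_derivative[OF bounded_bilinear_blinfun_compose \<Psi>(2)[of t] \<Phi>(2)[of t]]
      by simp
  qed
  then obtain C where C: "\<And>t. \<Psi> t o\<^sub>L \<Phi> t = C"
    using has_vector_derivative_zero_constant[of UNIV "\<lambda>t. \<Psi> t o\<^sub>L \<Phi> t"] by auto
  have "(id_blinfun :: 'a \<Rightarrow>\<^sub>L 'a) o\<^sub>L id_blinfun = id_blinfun" by (rule blinfun_eqI) simp
  then have 1: "\<Psi> t o\<^sub>L \<Phi> t = id_blinfun" for t
    using C[of t] C[of 0] \<Phi>(1) \<Psi>(1) by simp
  have "\<Phi> t o\<^sub>L \<Psi> t = id_blinfun" for t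
  proof -
    have "\<Psi> t (\<Phi> t v) = v" for v
      using arg_cong[OF 1[of t], of "\<lambda>L. blinfun_apply L v"] by simp
    then have "blinfun_apply (\<Psi> t) \<circ> blinfun_apply (\<Phi> t) = id" by (simp add: fun_eq_iff)
    then have "blinfun_apply (\<Phi> t) \<circ> blinfun_apply (\<Psi> t) = id"
      using linear_inverse_left[of "blinfun_apply (\<Psi> t)" "blinfun_apply (\<Phi> t)"]
      by (simp add: blinfun.bounded_linear_right bounded_linear.linear)
    then show ?thesis by (intro blinfun_eqI) (simp add: fun_eq_iff)
  qed
  with 1 show ?thesis using assms by (simp add: fundamental_pair_def)
qed

lemma fundamental_pair_exists:
  fixes A :: "real \<Rightarrow> 'a::euclidean_space \<Rightarrow>\<^sub>L 'a"
  assumes A: "continuous_on UNIV A"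
  shows "\<exists>\<Phi> \<Psi>. fundamental_pair A \<Phi> \<Psi>"
proof -
  obtain \<Phi> where \<Phi>: "\<Phi> 0 = id_blinfun" "\<And>t. (\<Phi> has_vector_derivative (A t o\<^sub>L \<Phi> t)) (at t)"
    using linear_ode_exists[OF bounded_bilinear_blinfun_compose A, of id_blinfun] by blast
  have "continuous_on UNIV (\<lambda>t. - A t)" using A by (intro continuous_intros)
  \<comment> \<open>Here the unknown multiplies from the left; the abstract bilinear product in
    \<open>linear_ode_exists\<close> covers this orientation as well as the previous one.\<close>
  from linear_ode_exists[OF bounded_bilinear.flip[OF bounded_bilinear_blinfun_compose] this, of id_blinfun]
  obtain \<Psi> where \<Psi>: "\<Psi> 0 = id_blinfun" "\<And>t. (\<Psi> has_vector_derivative (\<Psi> t o\<^sub>L - A t)) (at t)"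
    by blast
  have "(\<Psi> t o\<^sub>L - A t) = - (\<Psi> t o\<^sub>L A t)" for t
    by (rule blinfun_eqI) (simp add: blinfun.bilinear_simps)
  then show ?thesis using fundamental_pair_if[of \<Phi> A \<Psi>] \<Phi> \<Psi> by auto
qed

lemma fundamental_pair_cancel:
  assumes "fundamental_pair A \<Phi> \<Psi>"
  shows "\<Phi> t (\<Psi> t v) = v" "\<Psi> t (\<Phi> t v) = v"
proof -
  have "\<Phi> t o\<^sub>L \<Psi> t = id_blinfun" "\<Psi> t o\<^sub>L \<Phi> t = id_blinfun"
    using assms unfolding fundamental_pair_def by blast+
  from this[THEN arg_cong[of _ _ "\<lambda>L. blinfun_apply L v"]]
  show "\<Phi> t (\<Psi> t v) = v" "\<Psi> t (\<Phi> t v) = v" by simp_all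
qed

lemma fundamental_pair_solution:
  assumes "fundamental_pair A \<Phi> \<Psi>"
  shows "((\<lambda>t. \<Phi> t v) has_vector_derivative A t (\<Phi> t v)) (at t)"
proof -
  have "(\<Phi> has_vector_derivative (A t o\<^sub>L \<Phi> t)) (at t)" using assms by (auto simp: fundamental_pair_def)
  from bounded_linear.has_vector_derivative[OF blinfun.bounded_linear_left this, of v]
  show ?thesis by simp
qed

text \<open>Variation of constants: \<Psi> applied to \<open>w\<close> has derivative zero.
  Derivatives within a convex \<open>I\<close> are allowed because the solutions on the manifolds
  live on half-lines only.\<close>

lemma fundamental_pair_unique:
  assumes F: "fundamental_pair A \<Phi> \<Psi>" and I: "convex I"
    and w: "\<And>t. t \<in> I \<Longrightarrow> (w has_vector_derivative A t (w t)) (at t within I)"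
    and st: "s \<in> I" "t \<in> I"
  shows "w t = \<Phi> t (\<Psi> s (w s))"
proof -
  have "((\<lambda>t. \<Psi> t (w t)) has_vector_derivative 0) (at t within I)" if "t \<in> I" for t
  proof -
    have "(\<Psi> has_vector_derivative - (\<Psi> t o\<^sub>L A t)) (at t within I)"
      using F has_vector_derivative_at_within unfolding fundamental_pair_def by blast
    from bounded_bilinear.has_vector_derivative[OF bounded_bilinear_blinfun_apply this w[OF that]]
    show ?thesis by (simp add: blinfun.minus_left)
  qed
  then obtain C where "\<And>t. t \<in> I \<Longrightarrow> \<Psi> t (w t) = C"
    using has_vector_derivative_zero_constant[OF I, of "\<lambda>t. \<Psi> t (w t)"] by blast
  then have "\<Psi> t (w t) = \<Psi> s (w s)" using st by simp
  then show ?thesis using fundamental_pair_cancel(1)[OF F] by metis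
qed

section \<open>Tridiagonal systems and sign changes\<close>

definition jacobi :: "((real,'n::{finite,linorder}) vec \<Rightarrow>\<^sub>L (real,'n) vec) \<Rightarrow> bool" where
  "jacobi L \<longleftrightarrow> (\<forall>i\<in>{1..CARD('n)}. \<forall>j\<in>{1..CARD('n)}.
     ((j = i + 1 \<or> i = j + 1) \<longrightarrow> cmp (L (axis (ix j) 1)) i > 0) \<and>
     ((i + 1 < j \<or> j + 1 < i) \<longrightarrow> cmp (L (axis (ix j) 1)) i = 0))"

lemma jacobiD:
  fixes L :: "(real,'n::{finite,linorder}) vec \<Rightarrow>\<^sub>L (real,'n) vec"
  assumes "jacobi L" "i \<in> {1..CARD('n)}" "j \<in> {1..CARD('n)}"
  shows "j = i + 1 \<or> i = j + 1 \<Longrightarrow> cmp (L (axis (ix j) 1)) i > 0"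
    and "i + 1 < j \<or> j + 1 < i \<Longrightarrow> cmp (L (axis (ix j) 1)) i = 0"
  using assms unfolding jacobi_def by blast+

lemma cmp_blinfun:
  fixes L :: "(real,'n::{finite,linorder}) vec \<Rightarrow>\<^sub>L (real,'n) vec"
  shows "cmp (L x) i = (\<Sum>j = 1..CARD('n). cmp (L (axis (ix j) 1)) i * cmp x j)"
proof -
  have "L x = L (\<Sum>j = 1..CARD('n). cmp x j *\<^sub>R axis (ix j) 1)" using vec_eq_sum_axis[of x] by simp
  also have "\<dots> = (\<Sum>j = 1..CARD('n). cmp x j *\<^sub>R L (axis (ix j) 1))"
    by (simp add: blinfun.sum_right blinfun.scaleR_right)
  finally show ?thesis by (simp add: cmp_sum mult.commute)
qed

lemma jacobi_cmp:
  fixes L :: "(real,'n::{finite,linorder}) vec \<Rightarrow>\<^sub>L (real,'n) vec"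
  assumes L: "jacobi L" and i: "i \<in> {1..CARD('n)}"
  obtains d l r where "\<bar>d\<bar> \<le> norm L" "l > 0" "r > 0"
    "\<And>x. cmp (L x) i = d * cmp x i + (if 1 < i then l * cmp x (i - 1) else 0)
        + (if i < CARD('n) then r * cmp x (i + 1) else 0)"
proof -
  define e where "e = (\<lambda>j. cmp (L (axis (ix j) 1)) i)"
  \<comment> \<open>At the first and the last index the coefficient of the missing neighbour gets
    the dummy value 1, so that both coefficients are positive without case distinction.\<close>
  define l where "l = (if 1 < i then e (i - 1) else 1)"
  define r where "r = (if i < CARD('n) then e (i + 1) else 1)"
  have "\<bar>e i\<bar> \<le> norm L"
    using abs_cmp_le[of "L (axis (ix i) 1)" i] norm_blinfun[of L "axis (ix i) 1"]
    by (simp add: e_def)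
  moreover have "l > 0" "r > 0"
  proof -
    have "e (i - 1) > 0" if "1 < i" using jacobiD(1)[OF L i, of "i - 1"] i that unfolding e_def by fastforce
    moreover have "e (i + 1) > 0" if "i < CARD('n)" using jacobiD(1)[OF L i, of "i + 1"] i that unfolding e_def by fastforce
    ultimately show "l > 0" "r > 0" by (auto simp: l_def r_def)
  qed
  moreover have "cmp (L x) i = e i * cmp x i + (if 1 < i then l * cmp x (i - 1) else 0)
        + (if i < CARD('n) then r * cmp x (i + 1) else 0)" for x
  proof -
    define S where "S = (if 1 < i then {i - 1} else {}) \<union> (if i < CARD('n) then {i + 1} else {}) \<union> {i}"
    have "cmp (L x) i = (\<Sum>j = 1..CARD('n). e j * cmp x j)" unfolding e_def by (rule cmp_blinfun)
    also have "\<dots> = (\<Sum>j\<in>S. e j * cmp x j)"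
    proof (rule sum.mono_neutral_right)
      show "S \<subseteq> {1..CARD('n)}" using i by (auto simp: S_def)
      show "\<forall>j\<in>{1..CARD('n)} - S. e j * cmp x j = 0"
      proof
        fix j assume j: "j \<in> {1..CARD('n)} - S"
        then have "j \<noteq> i" "j \<noteq> i + 1" "i \<noteq> j + 1" by (auto simp: S_def split: if_splits)
        then have "i + 1 < j \<or> j + 1 < i" by linarith
        then show "e j * cmp x j = 0" using jacobiD(2)[OF L i, of j] j by (simp add: e_def)
      qed
    qed simp
    also have "\<dots> = e i * cmp x i + (if 1 < i then l * cmp x (i - 1) else 0)
        + (if i < CARD('n) then r * cmp x (i + 1) else 0)"
      using i by (auto simp: S_def l_def r_def)
    finally show ?thesis .
  qed
  ultimately show ?thesis using that by blast
qed

section \<open>Discrete steps that create no sign changes\<close>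

text \<open>Since \<open>h * norm L < 1\<close>, the factor 1 + h d of the old coordinate is
  positive, so the new coordinate i is a combination with nonnegative coefficients of the old
  coordinates i - 1, i and i + 1. If it is nonzero, one of these shares its sign (otherwise its
  square would be at most 0), and \<open>alternates_transfer\<close> applies.\<close>

lemma alternates_coordinate_step:
  fixes L :: "(real,'n::{finite,linorder}) vec \<Rightarrow>\<^sub>L (real,'n) vec"
  assumes L: "jacobi L" and i: "i \<in> {1..CARD('n)}" and h: "h \<ge> 0" "h * norm L < 1"
    and alt: "alternates CARD('n) m (cmp (x + (h * cmp (L x) i) *\<^sub>R axis (ix i) 1))"
  shows "alternates CARD('n) m (cmp x)"
proof (rule alternates_transfer[OF alt])
  define y where "y = x + (h * cmp (L x) i) *\<^sub>R axis (ix i) 1"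
  have y: "cmp y k = (if k = i then cmp x i + h * cmp (L x) i else cmp x k)" if "k \<in> {1..CARD('n)}" for k
    using that i by (simp add: y_def cmp_axis)
  fix k assume k: "k \<in> {1..CARD('n)}" "cmp (x + (h * cmp (L x) i) *\<^sub>R axis (ix i) 1) k \<noteq> 0"
  then have yk: "cmp y k \<noteq> 0" by (simp add: y_def)
  have "cmp x k * cmp y k > 0 \<or> (\<exists>j\<in>{1..CARD('n)}. (j = k + 1 \<or> k = j + 1) \<and>
      cmp x j * cmp y k > 0 \<and> cmp x j * cmp y j > 0)"
  proof (rule ccontr)
    assume no: "\<not> ?thesis"
    have "k = i"
    proof (rule ccontr)
      assume "k \<noteq> i"
      then have "cmp x k * cmp y k > 0" using y[OF k(1)] yk by (simp add: zero_less_mult_iff) linarith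
      then show False using no by blast
    qed
    obtain d l r where dlr: "\<bar>d\<bar> \<le> norm L" "l > 0" "r > 0"
      "\<And>x. cmp (L x) i = d * cmp x i + (if 1 < i then l * cmp x (i - 1) else 0)
        + (if i < CARD('n) then r * cmp x (i + 1) else 0)"
      using jacobi_cmp[OF L i] by blast
    have nb: "cmp x j * cmp y i \<le> 0" if "j \<in> {1..CARD('n)}" "j = i + 1 \<or> i = j + 1" for j
    proof (rule ccontr)
      assume *: "\<not> cmp x j * cmp y i \<le> 0"
      then have "cmp x j \<noteq> 0" by auto
      then have "cmp x j * cmp y j > 0" using y[OF that(1)] that(2) by (auto simp: zero_less_mult_iff)
      moreover have "cmp x j * cmp y i > 0" using * by simp
      ultimately show False using no that \<open>k = i\<close> by blast
    qed
    have "1 + h * d > 0"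
    proof -
      have "h * \<bar>d\<bar> \<le> h * norm L" using dlr(1) h(1) by (rule mult_left_mono)
      moreover have "- (h * d) \<le> h * \<bar>d\<bar>" using h(1) by (metis abs_ge_minus_self abs_mult abs_of_nonneg)
      ultimately show ?thesis using h(2) by linarith
    qed
    moreover have "cmp x i * cmp y i \<le> 0" using no \<open>k = i\<close> by (meson not_less)
    ultimately have 1: "(1 + h * d) * (cmp x i * cmp y i) \<le> 0" by (metis less_imp_le mult_nonneg_nonpos)
    have 2: "(if 1 < i then h * l * (cmp x (i - 1) * cmp y i) else 0) \<le> 0"
    proof -
      have "i - 1 \<in> {1..CARD('n)}" if "1 < i" using i that by auto
      then show ?thesis using nb[of "i - 1"] h(1) dlr(2) mult_nonneg_nonpos[of "h * l" "cmp x (i - 1) * cmp y i"]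
        by (cases "1 < i") auto
    qed
    have 3: "(if i < CARD('n) then h * r * (cmp x (i + 1) * cmp y i) else 0) \<le> 0"
      using nb[of "i + 1"] i h(1) dlr(3) mult_nonneg_nonpos[of "h * r" "cmp x (i + 1) * cmp y i"]
      by (cases "i < CARD('n)") auto
    have "cmp y i * cmp y i = (cmp x i + h * cmp (L x) i) * cmp y i" using y[OF i] by simp
    also have "\<dots> = (1 + h * d) * (cmp x i * cmp y i) + (if 1 < i then h * l * (cmp x (i - 1) * cmp y i) else 0)
       + (if i < CARD('n) then h * r * (cmp x (i + 1) * cmp y i) else 0)"
      unfolding dlr(4) by (simp add: algebra_simps)
    finally have "cmp y i * cmp y i \<le> 0" using 1 2 3 by linarith
    then show False using yk \<open>k = i\<close> by (metis less_le_not_le not_real_square_gt_zero)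
  qed
  then show "cmp x k * cmp (x + (h * cmp (L x) i) *\<^sub>R axis (ix i) 1) k > 0 \<or>
     (\<exists>j\<in>{1..CARD('n)}. (j = k + 1 \<or> k = j + 1) \<and>
       cmp x j * cmp (x + (h * cmp (L x) i) *\<^sub>R axis (ix i) 1) k > 0 \<and>
       cmp x j * cmp (x + (h * cmp (L x) i) *\<^sub>R axis (ix i) 1) j > 0)"
    unfolding y_def .
qed

text \<open>A Gauss--Seidel variant of the Euler step: updating one coordinate at a time makes it
  evident that sign changes are not created.\<close>

primrec sweep :: "((real,'n::{finite,linorder}) vec \<Rightarrow>\<^sub>L (real,'n) vec) \<Rightarrow> real \<Rightarrow> nat \<Rightarrow> (real,'n) vec \<Rightarrow> (real,'n) vec" where
  "sweep L h 0 x = x"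
| "sweep L h (Suc k) x = sweep L h k x + (h * cmp (L (sweep L h k x)) (Suc k)) *\<^sub>R axis (ix (Suc k)) 1"

lemma alternates_sweep:
  fixes L :: "(real,'n::{finite,linorder}) vec \<Rightarrow>\<^sub>L (real,'n) vec"
  assumes "jacobi L" "h \<ge> 0" "h * norm L < 1" "k \<le> CARD('n)" "alternates CARD('n) m (cmp (sweep L h k x))"
  shows "alternates CARD('n) m (cmp x)"
  using assms(4,5)
proof (induction k)
  case (Suc k)
  have "alternates CARD('n) m (cmp (sweep L h k x))"
    by (rule alternates_coordinate_step[OF assms(1) _ assms(2,3), of "Suc k"])
      (use Suc.prems in \<open>simp_all only: sweep.simps atLeastAtMost_iff\<close>, simp_all)
  then show ?case using Suc by simp
qed simp

lemma sweep_0: "sweep L 0 k x = x"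
  by (induction k) auto

text \<open>Using already updated coordinates changes the result only at second order in h, so at h
  = 0 a full sweep has the derivative \<open>L x\<close> of the Euler step.\<close>

lemma sweep_has_vector_derivative:
  "((\<lambda>h. sweep L h k x) has_vector_derivative (\<Sum>i = 1..k. cmp (L x) i *\<^sub>R axis (ix i) 1)) (at 0)"
proof (induction k)
  case (Suc k)
  have "bounded_linear (\<lambda>v. cmp (L v) (Suc k))"
    using bounded_linear_compose[OF bounded_linear_cmp blinfun.bounded_linear_right] .
  from bounded_linear.has_vector_derivative[OF this Suc] obtain c where
    c: "((\<lambda>h. cmp (L (sweep L h k x)) (Suc k)) has_real_derivative c) (at 0)"
    unfolding has_real_derivative_iff_has_vector_derivative by blast
  have "((\<lambda>h. h * cmp (L (sweep L h k x)) (Suc k)) has_real_derivative cmp (L x) (Suc k)) (at 0)"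
    using DERIV_mult[OF DERIV_ident c] by (simp add: sweep_0)
  from has_vector_derivative_add[OF Suc has_vector_derivative_scaleR[OF this has_vector_derivative_const]]
  show ?case by simp
qed simp

section \<open>Monotonicity of alternations in time\<close>

text \<open>A barrier argument: \<open>d\<close> cannot cross an exponential that starts at an
  arbitrarily small \<epsilon>. At the infimum of the times with a crossing, the one-sided bound
  keeps \<open>d\<close> below the barrier a little longer, a contradiction.\<close>

lemma dini_gronwall:
  fixes d :: "real \<Rightarrow> real"
  assumes cont: "continuous_on {0..T} d" and d0: "d 0 \<le> 0" and L: "L \<ge> 0" and T: "T \<ge> 0"
    and dini: "\<And>t \<epsilon>. 0 \<le> t \<Longrightarrow> t < T \<Longrightarrow> \<epsilon> > 0 \<Longrightarrow>
      \<exists>\<delta>>0. \<forall>h. 0 < h \<and> h < \<delta> \<longrightarrow> d (t + h) \<le> d t + h * (L * d t + \<epsilon>)"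
  shows "d T \<le> 0"
proof -
  have le: "d T \<le> \<epsilon> * exp ((L + 1) * T)" if \<epsilon>: "\<epsilon> > 0" for \<epsilon>
  proof (rule ccontr)
    \<comment> \<open>The rate \<open>L + 1\<close> rather than \<open>L\<close> absorbs the error
      term, since \<epsilon> is at most \<open>u s\<close>.\<close>
    define u where "u = (\<lambda>t. \<epsilon> * exp ((L + 1) * t))"
    assume "\<not> ?thesis"
    then have bad: "d T > u T" by (simp add: u_def)
    define B where "B = {t \<in> {0..T}. d t > u t}"
    define s where "s = Inf B"
    have B: "T \<in> B" "bdd_below B" using bad T by (auto simp: B_def bdd_below_def)
    have s0: "0 \<le> s" unfolding s_def by (rule cInf_greatest) (use B in \<open>auto simp: B_def\<close>)
    have sT: "s \<le> T" unfolding s_def by (rule cInf_lower) (use B in auto)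
    have below: "d r \<le> u r" if "0 \<le> r" "r < s" for r
      using cInf_lower[OF _ B(2), of r] that sT unfolding s_def[symmetric] by (force simp: B_def)
    have ds: "d s \<le> u s"
    proof (cases "s = 0")
      case True
      then show ?thesis using d0 \<epsilon> by (simp add: u_def)
    next
      case False
      show ?thesis
      proof (rule ccontr)
        assume "\<not> d s \<le> u s"
        moreover have "continuous_on {0..T} (\<lambda>r. d r - u r)" unfolding u_def using cont by (intro continuous_intros)
        ultimately obtain \<eta> where \<eta>: "\<eta> > 0" "\<And>r. r \<in> {0..T} \<Longrightarrow> dist r s < \<eta> \<Longrightarrow> dist (d r - u r) (d s - u s) < d s - u s"
          using s0 sT unfolding continuous_on_iff by (metis atLeastAtMost_iff diff_gt_0_iff_gt not_le)
        define r where "r = max 0 (s - \<eta> / 2)"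
        have r: "0 \<le> r" "r < s" "dist r s < \<eta>" using \<eta>(1) s0 False by (auto simp: r_def dist_real_def)
        have "d r - u r > 0" using \<eta>(2)[of r] r sT by (auto simp: dist_real_def)
        then show False using below[of r] r by simp
      qed
    qed
    have "s \<noteq> T" using ds bad by auto
    then have "s < T" using sT by simp
    from dini[OF s0 this \<epsilon>] obtain \<delta> where \<delta>: "\<delta> > 0"
      "\<And>h. 0 < h \<Longrightarrow> h < \<delta> \<Longrightarrow> d (s + h) \<le> d s + h * (L * d s + \<epsilon>)" by blast
    have good: "d (s + h) \<le> u (s + h)" if h: "0 < h" "h < \<delta>" for h
    proof -
      have us: "u s \<ge> \<epsilon>" using \<epsilon> s0 L by (simp add: u_def)
      have "d (s + h) \<le> d s + h * (L * d s + \<epsilon>)" using \<delta>(2) h by blast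
      also have "\<dots> \<le> u s + h * (L * u s + u s)"
        using ds us L h by (intro add_mono mult_left_mono) auto
      also have "\<dots> = u s * (1 + (L + 1) * h)" by (simp add: algebra_simps)
      also have "\<dots> \<le> u s * exp ((L + 1) * h)"
        using us \<epsilon> by (intro mult_left_mono exp_ge_add_one_self) auto
      also have "\<dots> = u (s + h)" by (simp add: u_def algebra_simps exp_add)
      finally show ?thesis .
    qed
    have "s + \<delta> \<le> Inf B"
    proof (rule cInf_greatest)
      fix t assume t: "t \<in> B"
      then have "s \<le> t" unfolding s_def using B(2) by (intro cInf_lower) auto
      moreover have "t \<noteq> s" using t ds by (auto simp: B_def)
      ultimately show "s + \<delta> \<le> t" using good[of "t - s"] t by (force simp: B_def)
    qed (use B in auto)
    then show False using \<delta>(1) by (simp add: s_def)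
  qed
  show ?thesis
  proof (rule ccontr)
    assume "\<not> d T \<le> 0"
    then have "d T / (2 * exp ((L + 1) * T)) > 0" by simp
    from le[OF this] show False using \<open>\<not> d T \<le> 0\<close> by (simp add: field_simps)
  qed
qed

text \<open>Invariance of the closed set \<open>S\<close> of vectors with fewer alternations, in the
  manner of Nagumo: from the point of \<open>S\<close> nearest to the solution, sweeps stay in
  \<open>S\<close> and follow the vector field to first order. So the distance of the solution to
  \<open>S\<close> satisfies the hypotheses of \<open>dini_gronwall\<close>.\<close>

lemma alternates_antimono:
  fixes A :: "real \<Rightarrow> (real,'n::{finite,linorder}) vec \<Rightarrow>\<^sub>L (real,'n) vec"
  assumes w: "\<And>t. s \<le> t \<Longrightarrow> t \<le> T \<Longrightarrow> (w has_vector_derivative A t (w t)) (at t)"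
    and J: "\<And>t. s \<le> t \<Longrightarrow> t \<le> T \<Longrightarrow> jacobi (A t)"
    and A: "continuous_on {s..T} A" and sT: "s \<le> T"
    and alt: "alternates CARD('n) m (cmp (w T))"
  shows "alternates CARD('n) m (cmp (w s))"
proof (rule ccontr)
  define S where "S = {x :: (real,'n) vec. \<not> alternates CARD('n) m (cmp x)}"
  assume "\<not> ?thesis"
  then have wS: "w s \<in> S" by (simp add: S_def)
  have cS: "closed S" using open_alternates[of "CARD('n)" m]
    unfolding S_def closed_def by (simp add: Compl_eq)
  obtain M where M: "M > 0" "\<And>t. t \<in> {s..T} \<Longrightarrow> norm (A t) \<le> M"
    using compact_imp_bounded[OF compact_continuous_image[OF A compact_Icc]] unfolding bounded_pos by blast
  define d where "d = (\<lambda>t. infdist (w (s + t)) S)"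
  have cw: "continuous_on {s..T} w"
    by (rule continuous_on_if_has_vector_derivative[where f' = "\<lambda>t. A t (w t)"]) (use w in auto)
  have "d (T - s) \<le> 0"
  proof (rule dini_gronwall[where L = M and d = d and T = "T - s"])
    have "continuous_on {0..T - s} (\<lambda>t. w (s + t))"
      by (rule continuous_on_compose2[OF cw]) (auto intro!: continuous_intros)
    then show "continuous_on {0..T - s} d" unfolding d_def by (rule continuous_on_infdist)
    show "d 0 \<le> 0" using wS by (simp add: d_def)
    fix t \<epsilon> :: real assume t: "0 \<le> t" "t < T - s" and \<epsilon>: "\<epsilon> > 0"
    have t': "s \<le> s + t" "s + t \<le> T" using t by auto
    \<comment> \<open>The comparison sweep starts at a nearest point of \<open>S\<close>, which
      exists because \<open>S\<close> is closed and nonempty.\<close>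
    obtain p where p: "p \<in> S" "infdist (w (s + t)) S = dist (w (s + t)) p"
      using infdist_attains_inf[OF cS] wS by blast
    define G where "G = (\<lambda>h. sweep (A (s + t)) h CARD('n) p)"
    have G: "G h \<in> S" if "0 \<le> h" "h < 1 / (M + 1)" for h
    proof -
      have "h * norm (A (s + t)) \<le> h * (M + 1)" using M(2)[of "s + t"] t' that by (intro mult_left_mono) auto
      also have "\<dots> < 1" using that M(1) by (simp add: field_simps)
      finally show ?thesis
        using alternates_sweep[OF J[OF t'] that(1), of "CARD('n)" m p] p(1) by (auto simp: S_def G_def)
    qed
    define r where "r = (\<lambda>h. w (s + t + h) - G h)"
    have "(G has_vector_derivative A (s + t) p) (at 0)"
      using sweep_has_vector_derivative[of "A (s + t)" "CARD('n)" p] vec_eq_sum_axis[of "A (s + t) p"]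
      unfolding G_def by simp
    moreover have "((\<lambda>h. w (s + t + h)) has_vector_derivative A (s + t) (w (s + t))) (at 0)"
    proof -
      have "((\<lambda>h. s + t + h) has_vector_derivative 1) (at 0)"
        using has_vector_derivative_add[OF has_vector_derivative_const has_vector_derivative_id] by simp
      then show ?thesis
        using vector_diff_chain_at[of "\<lambda>h. s + t + h" 1 0 w] w[OF t'] by (simp add: o_def)
    qed
    ultimately have "(r has_vector_derivative A (s + t) (w (s + t)) - A (s + t) p) (at 0)"
      unfolding r_def by (intro has_vector_derivative_diff)
    \<comment> \<open>By linearity the two velocities, at the solution and at \<open>p\<close>,
      differ by the matrix applied to the distance vector \<open>r 0\<close>; this yields the growth
      rate \<open>M\<close>.\<close>
    then have "(r has_vector_derivative A (s + t) (r 0)) (at 0)"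
      by (simp add: r_def G_def sweep_0 blinfun.diff_right)
    then obtain \<delta> where \<delta>: "\<delta> > 0" "\<And>h. norm h < \<delta> \<Longrightarrow> norm (r h - r 0 - h *\<^sub>R A (s + t) (r 0)) \<le> \<epsilon> * norm h"
      using \<epsilon> unfolding has_vector_derivative_def has_derivative_at_alt by (metis diff_zero)
    have "d (t + h) \<le> d t + h * (M * d t + \<epsilon>)" if h: "0 < h" "h < min \<delta> (1 / (M + 1))" for h
    proof -
      have dt: "norm (r 0) = d t" using p by (simp add: r_def G_def sweep_0 d_def dist_norm)
      have "d (t + h) \<le> norm (r h)"
        unfolding d_def r_def using infdist_le[OF G[of h], of "w (s + (t + h))"] h
        by (simp add: dist_norm add.assoc)
      also have "r h = (r h - r 0 - h *\<^sub>R A (s + t) (r 0)) + (r 0 + h *\<^sub>R A (s + t) (r 0))" by simp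
      also have "norm \<dots> \<le> norm (r h - r 0 - h *\<^sub>R A (s + t) (r 0)) + (norm (r 0) + norm (h *\<^sub>R A (s + t) (r 0)))"
        by (intro order_trans[OF norm_triangle_ineq] add_left_mono norm_triangle_ineq)
      also have "\<dots> \<le> \<epsilon> * h + (d t + h * (M * d t))"
      proof (intro add_mono)
        show "norm (r h - r 0 - h *\<^sub>R A (s + t) (r 0)) \<le> \<epsilon> * h" using \<delta>(2)[of h] h by simp
        have "norm (A (s + t) (r 0)) \<le> M * d t"
          using norm_blinfun[of "A (s + t)" "r 0"] M(2)[of "s + t"] t' dt
          by (metis atLeastAtMost_iff mult_right_mono norm_ge_zero order_trans)
        then show "norm (h *\<^sub>R A (s + t) (r 0)) \<le> h * (M * d t)" using h by (simp add: mult_left_mono)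
      qed (use dt in auto)
      finally show ?thesis by (simp add: algebra_simps)
    qed
    then show "\<exists>\<delta>>0. \<forall>h. 0 < h \<and> h < \<delta> \<longrightarrow> d (t + h) \<le> d t + h * (M * d t + \<epsilon>)"
      using \<delta>(1) M(1) by (intro exI[of _ "min \<delta> (1 / (M + 1))"]) auto
  qed (use M sT in auto)
  then have "infdist (w T) S = 0" using infdist_nonneg[of "w T" S] by (simp add: d_def)
  then have "w T \<in> S" using in_closed_iff_infdist_zero[OF cS] wS by blast
  then show False using alt by (simp add: S_def)
qed

section \<open>Times at which a solution lies in \<open>Lambda_set\<close>\<close>

text \<open>At a zero coordinate, row i of the matrix reduces to a positive combination of the two
  neighbours, which must vanish. So the neighbours have opposite signs or are both zero, and two
  adjacent zeros spread along the three-term recurrence in both directions to all of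
  \<open>x\<close>. A zero at an end has only one neighbour and spreads in the same way.\<close>

lemma Lambda_setI_jacobi:
  fixes L :: "(real,'n::{finite,linorder}) vec \<Rightarrow>\<^sub>L (real,'n) vec"
  assumes L: "jacobi L" and x: "x \<noteq> 0"
    and z: "\<And>i. i \<in> {1..CARD('n)} \<Longrightarrow> cmp x i = 0 \<Longrightarrow> cmp (L x) i = 0"
  shows "x \<in> Lambda_set"
proof -
  have eq: "\<exists>l r. l > 0 \<and> r > 0 \<and> (if 1 < i then l * cmp x (i - 1) else 0) + (if i < CARD('n) then r * cmp x (i + 1) else 0) = 0"
    if i: "i \<in> {1..CARD('n)}" "cmp x i = 0" for i
  proof -
    obtain d l r where lr: "\<bar>d\<bar> \<le> norm L" "l > 0" "r > 0" "\<And>x. cmp (L x) i = d * cmp x i + (if 1 < i then l * cmp x (i - 1) else 0)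
        + (if i < CARD('n) then r * cmp x (i + 1) else 0)"
      using jacobi_cmp[OF L i(1)] by blast
    have "cmp (L x) i = 0" "d * cmp x i = 0" using z[OF i] i(2) by auto
    with lr(4)[of x] have "(if 1 < i then l * cmp x (i - 1) else 0) + (if i < CARD('n) then r * cmp x (i + 1) else 0) = 0"
      by linarith
    with lr(2,3) show ?thesis by blast
  qed
  \<comment> \<open>The guard \<open>1 < j\<close> lets the first index play the role of a pair of
    zeros, in accordance with the missing term in the first row.\<close>
  have up: "cmp x j = 0 \<and> (1 < j \<longrightarrow> cmp x (j - 1) = 0)"
    if "i \<in> {1..CARD('n)}" "cmp x i = 0" "1 < i \<longrightarrow> cmp x (i - 1) = 0" "i \<le> j" "j \<le> CARD('n)" for i j
    using that(4,5)
  proof (induction j rule: dec_induct)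
    case (step j)
    then have j: "j \<in> {1..CARD('n)}" "cmp x j = 0" "1 < j \<longrightarrow> cmp x (j - 1) = 0" "j < CARD('n)"
      using that(1) by auto
    then show ?case using eq[OF j(1,2)] by (auto split: if_splits)
  qed (use that in auto)
  have down: "cmp x j = 0 \<and> (j < CARD('n) \<longrightarrow> cmp x (j + 1) = 0)"
    if "i \<in> {1..CARD('n)}" "cmp x i = 0" "i < CARD('n) \<longrightarrow> cmp x (i + 1) = 0" "j \<le> i" "1 \<le> j" for i j
    using that(4,5)
  proof (induction j rule: inc_induct)
    case (step j)
    then have j: "Suc j \<in> {1..CARD('n)}" "cmp x (Suc j) = 0" "Suc j < CARD('n) \<longrightarrow> cmp x (Suc j + 1) = 0"
      using that(1) by auto
    then show ?case using eq[OF j(1,2)] step.prems by (auto split: if_splits)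
  qed (use that in auto)
  have ne: "\<not> (\<forall>j\<in>{1..CARD('n)}. cmp x j = 0)" using nonzero_cmp[OF x] by blast
  have n: "1 \<in> {1..CARD('n)}" "CARD('n) \<in> {1..CARD('n)}" by (auto simp: Suc_le_eq)
  have "cmp x 1 \<noteq> 0"
  proof
    assume "cmp x 1 = 0"
    then show False using up[OF n(1)] ne by auto
  qed
  moreover have "cmp x CARD('n) \<noteq> 0"
  proof
    assume "cmp x CARD('n) = 0"
    then show False using down[OF n(2)] ne by auto
  qed
  moreover have "cmp x (i - 1) * cmp x (i + 1) < 0"
    if i: "2 \<le> i" "i \<le> CARD('n) - 1" "cmp x i = 0" for i
  proof -
    have r: "i \<in> {1..CARD('n)}" "1 < i" "i < CARD('n)" using i by auto
    obtain l r where lr: "l > 0" "r > 0" "l * cmp x (i - 1) + r * cmp x (i + 1) = 0"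
      using eq[OF r(1) i(3)] r by auto
    have "cmp x (i - 1) \<noteq> 0"
    proof
      assume 0: "cmp x (i - 1) = 0"
      then have 1: "cmp x (i + 1) = 0" using lr by simp
      have "cmp x j = 0" if "j \<in> {1..CARD('n)}" for j
        using up[OF r(1) i(3), of j] down[OF r(1) i(3), of j] 0 1 that by (cases "i \<le> j") auto
      then show False using ne by blast
    qed
    moreover have "cmp x (i + 1) = - (l / r) * cmp x (i - 1)" using lr by (simp add: field_simps)
    then have "cmp x (i - 1) * cmp x (i + 1) = - ((l / r) * (cmp x (i - 1))\<^sup>2)" by (simp add: power2_eq_square)
    ultimately show ?thesis using lr by simp
  qed
  ultimately show ?thesis by (auto simp: Lambda_set_def)
qed

text \<open>An interval is shrunk coordinate by coordinate until each coordinate is either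
  identically zero or nowhere zero on it. At its midpoint every vanishing coordinate also has
  vanishing derivative, as \<open>Lambda_setI_jacobi\<close> requires.\<close>

lemma Lambda_set_time_exists:
  fixes A :: "real \<Rightarrow> (real,'n::{finite,linorder}) vec \<Rightarrow>\<^sub>L (real,'n) vec"
  assumes w: "\<And>t. (w has_vector_derivative A t (w t)) (at t)"
    and J: "\<And>t. t > a \<Longrightarrow> jacobi (A t)" and nz: "\<And>t. w t \<noteq> 0"
  shows "\<exists>t>a. w t \<in> Lambda_set"
proof -
  have cw: "continuous_on UNIV (\<lambda>t. cmp (w t) i)" for i
  proof -
    have "continuous_on UNIV w"
      using w by (rule continuous_on_if_has_vector_derivative)
    then show ?thesis
      using bounded_linear.continuous_on[OF bounded_linear_cmp] by blast
  qed
  have "\<exists>c d. a \<le> c \<and> c < d \<and> (\<forall>i\<in>{1..k}. (\<forall>t\<in>{c<..<d}. cmp (w t) i = 0) \<or> (\<forall>t\<in>{c<..<d}. cmp (w t) i \<noteq> 0))" for k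
  proof (induction k)
    case 0
    then show ?case by (intro exI[of _ a] exI[of _ "a + 1"]) auto
  next
    case (Suc k)
    then obtain c d where cd: "a \<le> c" "c < d"
      "\<And>i. i \<in> {1..k} \<Longrightarrow> (\<forall>t\<in>{c<..<d}. cmp (w t) i = 0) \<or> (\<forall>t\<in>{c<..<d}. cmp (w t) i \<noteq> 0)" by blast
    show ?case
    proof (cases "\<forall>t\<in>{c<..<d}. cmp (w t) (Suc k) = 0")
      case True
      have "(\<forall>t\<in>{c<..<d}. cmp (w t) i = 0) \<or> (\<forall>t\<in>{c<..<d}. cmp (w t) i \<noteq> 0)" if "i \<in> {1..Suc k}" for i
        using cd(3)[of i] True that by (cases "i = Suc k") auto
      then show ?thesis using cd by blast
    next
      case False
      then obtain t0 where t0: "t0 \<in> {c<..<d}" "cmp (w t0) (Suc k) \<noteq> 0" by blast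
      have "open ({c<..<d} \<inter> {t. cmp (w t) (Suc k) \<noteq> 0})"
        by (intro open_Int open_greaterThanLessThan open_Collect_neq[OF cw continuous_on_const])
      then obtain e where e: "e > 0" "ball t0 e \<subseteq> {c<..<d} \<inter> {t. cmp (w t) (Suc k) \<noteq> 0}"
        using t0 openE[of _ t0] by blast
      have sub: "{t0 - e<..<t0 + e} \<subseteq> {c<..<d} \<inter> {t. cmp (w t) (Suc k) \<noteq> 0}"
        using e(2) by (auto simp: ball_eq_greaterThanLessThan)
      have "a \<le> t0 - e"
      proof (rule ccontr)
        assume "\<not> a \<le> t0 - e"
        then have "(t0 - e + a) / 2 \<in> {t0 - e<..<t0 + e}" "(t0 - e + a) / 2 < a" using t0 e cd by auto
        then have "(t0 - e + a) / 2 \<in> {c<..<d}" using sub by blast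
        then show False using \<open>(t0 - e + a) / 2 < a\<close> cd(1) by simp
      qed
      moreover have "(\<forall>t\<in>{t0 - e<..<t0 + e}. cmp (w t) i = 0) \<or> (\<forall>t\<in>{t0 - e<..<t0 + e}. cmp (w t) i \<noteq> 0)"
        if "i \<in> {1..Suc k}" for i
      proof (cases "i = Suc k")
        case False
        then have "i \<in> {1..k}" using that by auto
        from cd(3)[OF this] show ?thesis using sub by blast
      qed (use sub in blast)
      moreover have "t0 - e < t0 + e" using e by simp
      ultimately show ?thesis by blast
    qed
  qed
  then obtain c d where cd: "a \<le> c" "c < d"
    "\<And>i. i \<in> {1..CARD('n)} \<Longrightarrow> (\<forall>t\<in>{c<..<d}. cmp (w t) i = 0) \<or> (\<forall>t\<in>{c<..<d}. cmp (w t) i \<noteq> 0)" by blast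
  define t where "t = (c + d) / 2"
  have t: "t \<in> {c<..<d}" "t > a" using cd by (auto simp: t_def)
  have "w t \<in> Lambda_set"
  proof (rule Lambda_setI_jacobi[OF J[OF t(2)] nz])
    fix i assume i: "i \<in> {1..CARD('n)}" "cmp (w t) i = 0"
    then have z: "\<forall>s\<in>{c<..<d}. cmp (w s) i = 0" using cd(3) t by blast
    have "((\<lambda>s. cmp (w s) i) has_vector_derivative cmp (A t (w t)) i) (at t)"
      by (rule bounded_linear.has_vector_derivative[OF bounded_linear_cmp w])
    moreover have "((\<lambda>s. cmp (w s) i) has_vector_derivative 0) (at t)"
      by (rule has_vector_derivative_transform_within_open[where S = "{c<..<d}" and f = "\<lambda>_. 0"]) (use z t in auto)
    ultimately show "cmp (A t (w t)) i = 0" by (rule vector_derivative_unique_at)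
  qed
  then show ?thesis using t by blast
qed

section \<open>Exponential dichotomies and sign changes\<close>

text \<open>Variation of constants, evaluated at a time where \<open>norm (w t)\<close> is maximal on \<open>{T..j}\<close>.\<close>

lemma dichotomy_lower_bound:
  fixes A B \<Phi> \<Psi> :: "real \<Rightarrow> 'a::euclidean_space \<Rightarrow>\<^sub>L 'a"
  assumes FB: "fundamental_pair B \<Phi> \<Psi>" and K: "K > 0" "\<alpha> > 0"
    and st: "\<And>s t. 0 \<le> s \<Longrightarrow> s \<le> t \<Longrightarrow> norm (\<Phi> t o\<^sub>L (id_blinfun - S) o\<^sub>L \<Psi> s) \<le> K * exp (- \<alpha> * (t - s))"
    and un: "\<And>s t. 0 \<le> t \<Longrightarrow> t \<le> s \<Longrightarrow> norm (\<Phi> t o\<^sub>L S o\<^sub>L \<Psi> s) \<le> K * exp (- \<alpha> * (s - t))"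
    and AB: "\<And>t. t \<ge> T \<Longrightarrow> norm (A t - B t) \<le> \<eta>" and \<eta>: "\<eta> \<ge> 0" "4 * K * \<eta> \<le> \<alpha>" and T: "T \<ge> 0"
    and w: "\<And>t. (w has_vector_derivative A t (w t)) (at t)"
    and init: "(id_blinfun - S) (\<Psi> T (w T)) = 0" and Tj: "T \<le> j"
  shows "norm (w T) \<le> 2 * K * norm (w j)"
proof -
  have cw: "continuous_on UNIV w" using w by (rule continuous_on_if_has_vector_derivative)
  have "continuous_on {T..j} (\<lambda>t. norm (w t))"
    using cw continuous_on_subset by (intro continuous_intros) blast
  then obtain t where t: "t \<in> {T..j}" "\<And>s. s \<in> {T..j} \<Longrightarrow> norm (w s) \<le> norm (w t)"
    using continuous_attains_sup[of "{T..j}" "\<lambda>t. norm (w t)"] Tj by fastforce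
  define m where "m = norm (w t)"
  define v where "v = (\<lambda>s. \<Psi> s (w s))"
  \<comment> \<open>The integral over a half-line of K exp(-\<alpha> r) times the bound \<eta> m of
    the perturbation, hence a bound for each of the two perturbation terms.\<close>
  define c where "c = K * \<eta> * m / \<alpha>"
  have c0: "c \<ge> 0" using K \<eta> by (simp add: c_def m_def)
  have dv: "(v has_vector_derivative \<Psi> s ((A s - B s) (w s))) (at s)" for s
  proof -
    have "(\<Psi> has_vector_derivative - (\<Psi> s o\<^sub>L B s)) (at s)" using FB by (simp add: fundamental_pair_def)
    from bounded_bilinear.has_vector_derivative[OF bounded_bilinear_blinfun_apply this w]
    show ?thesis by (simp add: v_def blinfun.bilinear_simps)
  qed
  have pert: "norm ((\<Phi> t o\<^sub>L P o\<^sub>L \<Psi> s) ((A s - B s) (w s))) \<le> K * exp (- \<alpha> * r) * (\<eta> * m)"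
    if "norm (\<Phi> t o\<^sub>L P o\<^sub>L \<Psi> s) \<le> K * exp (- \<alpha> * r)" "s \<in> {T..j}" for P s r
  proof -
    have "norm ((A s - B s) (w s)) \<le> \<eta> * m"
      using that(2) t(2)[OF that(2)] AB[of s] \<eta>(1) unfolding m_def
      by (intro order_trans[OF norm_blinfun] mult_mono) auto
    then have "norm (\<Phi> t o\<^sub>L P o\<^sub>L \<Psi> s) * norm ((A s - B s) (w s)) \<le> K * exp (- \<alpha> * r) * (\<eta> * m)"
      using that(1) K by (intro mult_mono) auto
    then show ?thesis by (rule order_trans[OF norm_blinfun])
  qed
  have dE: "((\<lambda>s. \<Phi> t (P (v s))) has_vector_derivative (\<Phi> t o\<^sub>L P o\<^sub>L \<Psi> s) ((A s - B s) (w s))) (at s)"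
    for P :: "'a \<Rightarrow>\<^sub>L 'a" and s
    using bounded_linear.has_vector_derivative[OF bounded_linear_compose[OF blinfun.bounded_linear_right blinfun.bounded_linear_right] dv, of "\<Phi> t" P s]
    by simp
  have stable: "norm (\<Phi> t ((id_blinfun - S) (v t))) \<le> c"
  proof (cases "T < t")
    case True
    \<comment> \<open>A mean value inequality replaces the integral: the majorant has as its
      derivative exactly the pointwise bound supplied by \<open>pert\<close>.\<close>
    have "norm (\<Phi> t ((id_blinfun - S) (v t)) - \<Phi> t ((id_blinfun - S) (v T))) \<le>
        c * exp (- \<alpha> * (t - t)) - c * exp (- \<alpha> * (t - T))"
    proof (rule differentiable_bound_general[where \<phi> = "\<lambda>s. c * exp (- \<alpha> * (t - s))"
          and \<phi>' = "\<lambda>s. K * exp (- \<alpha> * (t - s)) * (\<eta> * m)"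
          and f = "\<lambda>s. \<Phi> t ((id_blinfun - S) (v s))", OF True])
      show "continuous_on {T..t} (\<lambda>s. \<Phi> t ((id_blinfun - S) (v s)))"
        using dE by (rule continuous_on_if_has_vector_derivative)
      show "((\<lambda>s. \<Phi> t ((id_blinfun - S) (v s))) has_vector_derivative
          (\<Phi> t o\<^sub>L (id_blinfun - S) o\<^sub>L \<Psi> s) ((A s - B s) (w s))) (at s)" for s by (rule dE)
      show "((\<lambda>s. c * exp (- \<alpha> * (t - s))) has_vector_derivative K * exp (- \<alpha> * (t - s)) * (\<eta> * m)) (at s)" for s
        unfolding has_real_derivative_iff_has_vector_derivative[symmetric]
        using K by (auto intro!: derivative_eq_intros simp: c_def)
      show "norm ((\<Phi> t o\<^sub>L (id_blinfun - S) o\<^sub>L \<Psi> s) ((A s - B s) (w s))) \<le> K * exp (- \<alpha> * (t - s)) * (\<eta> * m)"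
        if "T < s" "s < t" for s
        by (rule pert[OF st]) (use that T t in auto)
    qed (auto intro!: continuous_intros)
    moreover have "\<Phi> t ((id_blinfun - S) (v T)) = 0" using init by (simp add: v_def)
    moreover have "c * exp (- \<alpha> * (t - T)) \<ge> 0" using c0 by simp
    ultimately show ?thesis by simp
  next
    case False
    then have "t = T" using t by simp
    then show ?thesis using init c0 by (simp add: v_def)
  qed
  have unstable: "norm (\<Phi> t (S (v t))) \<le> K * norm (w j) + c"
  proof -
    have j: "norm (\<Phi> t (S (v j))) \<le> K * norm (w j)"
    proof -
      have "norm ((\<Phi> t o\<^sub>L S o\<^sub>L \<Psi> j) (w j)) \<le> K * exp (- \<alpha> * (j - t)) * norm (w j)"
        using un[of t j] t T by (intro order_trans[OF norm_blinfun] mult_right_mono) auto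
      also have "\<dots> \<le> K * 1 * norm (w j)"
        using K t by (intro mult_right_mono mult_left_mono) auto
      finally show ?thesis by (simp add: v_def)
    qed
    have "norm (\<Phi> t (S (v j)) - \<Phi> t (S (v t))) \<le> c"
    proof (cases "t < j")
      case True
      have "norm (\<Phi> t (S (v j)) - \<Phi> t (S (v t))) \<le> - c * exp (- \<alpha> * (j - t)) - - c * exp (- \<alpha> * (t - t))"
      proof (rule differentiable_bound_general[where \<phi> = "\<lambda>s. - c * exp (- \<alpha> * (s - t))"
            and \<phi>' = "\<lambda>s. K * exp (- \<alpha> * (s - t)) * (\<eta> * m)"
            and f = "\<lambda>s. \<Phi> t (S (v s))", OF True])
        show "continuous_on {t..j} (\<lambda>s. \<Phi> t (S (v s)))"
          using dE by (rule continuous_on_if_has_vector_derivative)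
        show "((\<lambda>s. \<Phi> t (S (v s))) has_vector_derivative (\<Phi> t o\<^sub>L S o\<^sub>L \<Psi> s) ((A s - B s) (w s))) (at s)" for s
          by (rule dE)
        show "((\<lambda>s. - c * exp (- \<alpha> * (s - t))) has_vector_derivative K * exp (- \<alpha> * (s - t)) * (\<eta> * m)) (at s)" for s
          unfolding has_real_derivative_iff_has_vector_derivative[symmetric]
          using K by (auto intro!: derivative_eq_intros simp: c_def)
        show "norm ((\<Phi> t o\<^sub>L S o\<^sub>L \<Psi> s) ((A s - B s) (w s))) \<le> K * exp (- \<alpha> * (s - t)) * (\<eta> * m)"
          if "t < s" "s < j" for s
          by (rule pert[OF un]) (use that T t in auto)
      qed (auto intro!: continuous_intros)
      moreover have "c * exp (- \<alpha> * (j - t)) \<ge> 0" using c0 by simp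
      ultimately show ?thesis by simp
    next
      case False
      then show ?thesis using t c0 by simp
    qed
    then show ?thesis using j norm_triangle_sub[of "\<Phi> t (S (v t))" "\<Phi> t (S (v j))"]
      by (simp add: norm_minus_commute)
  qed
  have "w t = \<Phi> t ((id_blinfun - S) (v t)) + \<Phi> t (S (v t))"
    using fundamental_pair_cancel(1)[OF FB, of t "w t"] by (simp add: v_def blinfun.bilinear_simps)
  then have "m \<le> c + (K * norm (w j) + c)"
    unfolding m_def using stable unstable by (metis add_mono norm_triangle_ineq order_trans)
  \<comment> \<open>The two perturbation terms together take at most half of \<open>m\<close>;
    moving this half to the left produces the factor 2 in the conclusion.\<close>
  moreover have "4 * c \<le> m"
  proof -
    have "4 * c = (4 * K * \<eta>) * m / \<alpha>" by (simp add: c_def)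
    also have "\<dots> \<le> \<alpha> * m / \<alpha>"
      using \<eta> K by (intro divide_right_mono mult_right_mono) (auto simp: m_def)
    finally show ?thesis using K by simp
  qed
  ultimately have "m \<le> 2 * K * norm (w j)" by linarith
  then show ?thesis using t(2)[of T] Tj by (simp add: m_def)
qed

section \<open>Linear conditions that force alternations\<close>

text \<open>Each linear condition lowers the dimension by at most one.\<close>

lemma common_zero_exists:
  fixes V :: "'a::euclidean_space set" and l :: "nat \<Rightarrow> 'a \<Rightarrow> real"
  assumes "subspace V" "m < dim V" "\<And>r. linear (l r)"
  shows "\<exists>x\<in>V. x \<noteq> 0 \<and> (\<forall>r<m. l r x = 0)"
  using assms(1,2)
proof (induction m arbitrary: V)
  case 0
  then have "\<not> V \<subseteq> {0}" using dim_eq_0 by (metis less_irrefl)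
  then show ?case by auto
next
  case (Suc m)
  define V' where "V' = {x \<in> V. l m x = 0}"
  have sub: "subspace V'"
    using Suc.prems(1) assms(3)[of m] unfolding V'_def
    by (auto simp: subspace_def linear_add linear_scale linear_0)
  have "dim V \<le> Suc (dim V')"
  proof (cases "\<exists>e\<in>V. l m e \<noteq> 0")
    case True
    then obtain e where e: "e \<in> V" "l m e \<noteq> 0" by blast
    have "V \<subseteq> span (insert e V')"
    proof
      fix x assume x: "x \<in> V"
      have "x - (l m x / l m e) *\<^sub>R e \<in> V'"
        unfolding V'_def using x e Suc.prems(1) assms(3)[of m]
        by (auto simp: subspace_diff subspace_scale linear_diff linear_scale)
      then show "x \<in> span (insert e V')" by (metis span_base span_breakdown_eq)
    qed
    then have "dim V \<le> dim (insert e V')" by (metis dim_span dim_subset)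
    then show ?thesis by (simp add: dim_insert split: if_splits)
  next
    case False
    then have "V' = V" by (auto simp: V'_def)
    then show ?thesis by simp
  qed
  then have "m < dim V'" using Suc.prems(2) by simp
  from Suc.IH[OF sub this] show ?case by (auto simp: V'_def less_Suc_eq)
qed

definition moment :: "nat \<Rightarrow> (real,'n::{finite,linorder}) vec \<Rightarrow> real" where
  "moment r x = (\<Sum>i = 1..CARD('n). real i ^ r * cmp x i)"

lemma linear_moment: "linear (moment r)"
  by (rule linearI) (simp_all add: moment_def algebra_simps sum.distrib sum_distrib_left)

lemma moment_scaleR: "moment r (a *\<^sub>R x) = a * moment r x"
  by (simp add: moment_def sum_distrib_left mult_ac)

lemma alternates_if_moments_zero:
  fixes x :: "(real,'n::{finite,linorder}) vec"
  assumes "x \<noteq> 0" "\<And>r. r < m \<Longrightarrow> moment r x = 0"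
  shows "alternates CARD('n) m (cmp x)"
  using moments_zero_alternates[where m = m and n = "CARD('n)" and c = "cmp x"] nonzero_cmp[OF assms(1)] assms(2)
  by (auto simp: moment_def)

text \<open>The unit vectors with vanishing moments form a compact set inside the open set of
  alternating vectors, so they share one radius; scaling turns it into a margin relative to
  \<open>norm x\<close>.\<close>

lemma alternates_near_moments_zero:
  "\<exists>\<delta>>0. \<forall>x y :: (real,'n::{finite,linorder}) vec. x \<noteq> 0 \<and> (\<forall>r<m. moment r x = 0) \<and> norm (y - x) \<le> \<delta> * norm x
     \<longrightarrow> alternates CARD('n) m (cmp y)"
proof -
  define C where "C = sphere (0 :: (real,'n) vec) 1 \<inter> (\<Inter>r\<in>{..<m}. {x. moment r x = 0})"
  have "closed {x :: (real,'n) vec. moment r x = 0}" for r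
    by (intro closed_Collect_eq continuous_on_const linear_continuous_on linear_conv_bounded_linear[THEN iffD1] linear_moment)
  then have "compact C" unfolding C_def by (intro compact_Int_closed closed_INT) auto
  moreover have "C \<subseteq> {x. alternates CARD('n) m (cmp x)}"
  proof
    fix x assume "x \<in> C"
    then have "x \<noteq> 0" "\<And>r. r < m \<Longrightarrow> moment r x = 0" by (auto simp: C_def)
    then show "x \<in> {x. alternates CARD('n) m (cmp x)}" using alternates_if_moments_zero by blast
  qed
  ultimately obtain e where e: "e > 0" "(\<Union>x\<in>C. ball x e) \<subseteq> {x. alternates CARD('n) m (cmp x)}"
    using compact_subset_open_imp_ball_epsilon_subset[OF _ open_alternates] by metis
  have "alternates CARD('n) m (cmp y)"
    if x: "x \<noteq> 0" "\<forall>r<m. moment r x = 0" "norm (y - x) \<le> e / 2 * norm x" for x y :: "(real,'n) vec"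
  proof -
    have n: "norm x > 0" using x by simp
    have "(1 / norm x) *\<^sub>R x \<in> C" using x n by (auto simp: C_def moment_scaleR)
    moreover have "dist ((1 / norm x) *\<^sub>R x) ((1 / norm x) *\<^sub>R y) < e"
    proof -
      have "dist ((1 / norm x) *\<^sub>R x) ((1 / norm x) *\<^sub>R y) = norm (y - x) / norm x"
        unfolding dist_norm scaleR_diff_right[symmetric] by (simp add: norm_minus_commute)
      also have "\<dots> \<le> e / 2" using x(3) n by (simp add: field_simps)
      finally show ?thesis using e by simp
    qed
    ultimately have "(1 / norm x) *\<^sub>R y \<in> {x. alternates CARD('n) m (cmp x)}" using e(2) by fastforce
    moreover have "1 / norm x \<noteq> 0" using n by simp
    ultimately show ?thesis using alternates_scaleR by blast
  qed
  then show ?thesis using e(1) by (intro exI[of _ "e / 2"]) auto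
qed

section \<open>Sign changes of decaying solutions\<close>

text \<open>\<open>A\<close> drives the difference of two solutions and \<open>B\<close> is the
  linearization with its dichotomy, where \<open>S\<close> is the unstable projection at time 0. The
  pair is kept abstract so that the lemma applies to the original system and to the reversed
  one.\<close>

lemma alternates_if_decaying:
  fixes A B :: "real \<Rightarrow> (real,'n::{finite,linorder}) vec \<Rightarrow>\<^sub>L (real,'n) vec"
  assumes A: "continuous_on UNIV A" and J: "\<And>t. t \<ge> 0 \<Longrightarrow> jacobi (A t)"
    and FA: "fundamental_pair A \<Phi>A \<Psi>A"
    and FB: "fundamental_pair B \<Phi> \<Psi>" and K: "K > 0" "\<alpha> > 0"
    and st: "\<And>s t. 0 \<le> s \<Longrightarrow> s \<le> t \<Longrightarrow> norm (\<Phi> t o\<^sub>L (id_blinfun - S) o\<^sub>L \<Psi> s) \<le> K * exp (- \<alpha> * (t - s))"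
    and un: "\<And>s t. 0 \<le> t \<Longrightarrow> t \<le> s \<Longrightarrow> norm (\<Phi> t o\<^sub>L S o\<^sub>L \<Psi> s) \<le> K * exp (- \<alpha> * (s - t))"
    and S: "S o\<^sub>L S = S"
    and AB: "((\<lambda>t. A t - B t) \<longlongrightarrow> 0) at_top"
    and z0: "z0 \<noteq> 0" and z: "((\<lambda>t. \<Phi>A t z0) \<longlongrightarrow> 0) at_top"
  shows "alternates CARD('n) (dim (range (blinfun_apply S))) (cmp z0)"
proof (rule ccontr)
  define N where "N = dim (range (blinfun_apply S))"
  assume "\<not> ?thesis"
  then have not0: "\<not> alternates CARD('n) N (cmp z0)" by (simp add: N_def)
  define zt where "zt = (\<lambda>t. \<Phi>A t z0)"
  have zt0: "zt 0 = z0" using FA by (simp add: zt_def fundamental_pair_def)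
  have inj: "\<Phi>A t v \<noteq> 0" if "v \<noteq> 0" for t v
    using fundamental_pair_cancel(2)[OF FA, of t v] that by (metis blinfun.zero_right)
  have zt_nz: "zt t \<noteq> 0" for t using inj[OF z0] by (simp add: zt_def)
  have sol: "((\<lambda>t. \<Phi>A t v) has_vector_derivative A t (\<Phi>A t v)) (at t)" for v t
    by (rule fundamental_pair_solution[OF FA])
  \<comment> \<open>The largest perturbation that \<open>dichotomy_lower_bound\<close>
    tolerates.\<close>
  define \<eta> where "\<eta> = \<alpha> / (4 * K)"
  have \<eta>: "\<eta> > 0" "4 * K * \<eta> \<le> \<alpha>" using K by (simp_all add: \<eta>_def)
  obtain T0 where T0: "\<And>t. t \<ge> T0 \<Longrightarrow> norm (A t - B t) \<le> \<eta>"
    using tendstoD[OF AB \<eta>(1)] unfolding eventually_at_top_linorder by (metis dist_0_norm dist_commute less_imp_le)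
  \<comment> \<open>The time \<open>T\<close> has to serve two purposes: \<open>A\<close> stays
    close to \<open>B\<close> from then on, and \<open>zt T\<close> lies in
    \<open>Lambda_set\<close>.\<close>
  have "\<exists>t>max T0 0. zt t \<in> Lambda_set"
    by (rule Lambda_set_time_exists[of zt A]) (use sol zt_nz J in \<open>auto simp: zt_def\<close>)
  then obtain T where T: "T \<ge> T0" "T \<ge> 0" "zt T \<in> Lambda_set" by (metis less_imp_le max_less_iff_conj)
  define X where "X = (\<lambda>j. \<Phi>A j o\<^sub>L \<Psi>A T)"
  have XT: "X T v = v" for v unfolding X_def using fundamental_pair_cancel(1)[OF FA] by simp
  have Xz: "X j (zt T) = zt j" for j unfolding X_def zt_def using fundamental_pair_cancel(2)[OF FA] by simp
  have Xsol: "((\<lambda>t. X t v) has_vector_derivative A t (X t v)) (at t)" for v t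
    using sol[of "\<Psi>A T v"] by (simp add: X_def)
  have X_nz: "X j v \<noteq> 0" if "v \<noteq> 0" for j v
    unfolding X_def using inj[of "\<Psi>A T v" j] fundamental_pair_cancel(1)[OF FA, of T v] that
    by (metis blinfun.zero_right blinfun_apply_blinfun_compose)
  have contA: "continuous_on R A" for R using A continuous_on_subset by blast
  have mono: "alternates CARD('n) N (cmp v)" if "alternates CARD('n) N (cmp (X j v))" "j \<ge> T" for j v
    using alternates_antimono[of T j "\<lambda>t. X t v" A N] Xsol J T(2) contA that XT by simp
  have notT: "\<not> alternates CARD('n) N (cmp (zt T))"
    using alternates_antimono[of 0 T zt A N] sol J T(2) contA not0 zt0 by (auto simp: zt_def)
  have notz: "\<not> alternates CARD('n) N (cmp (zt j))" if "j \<ge> T" for j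
    using mono[of j "zt T"] notT that by (auto simp: Xz)

  \<comment> \<open>The image of the range of \<open>S\<close> under the evolution of
    \<open>B\<close> up to \<open>T\<close>. Solutions of \<open>A\<close> starting in it obey the
    lower bound \<open>low\<close>, although \<open>A\<close> need not preserve these
    subspaces.\<close>
  define U where "U = {u. (id_blinfun - S) (\<Psi> T u) = 0}"
  have subU: "subspace U"
    by (auto simp: U_def subspace_def blinfun.bilinear_simps algebra_simps scaleR_right_diff_distrib[symmetric])
  have low: "norm u \<le> 2 * K * norm (X j u)" if "u \<in> U" "j \<ge> T" for u j
  proof -
    have "norm (X T u) \<le> 2 * K * norm (X j u)"
    proof (rule dichotomy_lower_bound[where w = "\<lambda>t. X t u" and A = A and \<eta> = \<eta>, OF FB K st un])
      show "(id_blinfun - S) (\<Psi> T (X T u)) = 0" using that(1) by (simp add: U_def XT)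
      show "norm (A t - B t) \<le> \<eta>" if "t \<ge> T" for t using T0 T(1) that by simp
    qed (use \<eta> T Xsol that in auto)
    then show ?thesis by (simp add: XT)
  qed
  have small: "\<exists>j\<ge>T. norm (zt j) < e" if "e > 0" for e
  proof -
    have "eventually (\<lambda>j. norm (zt j) < e) at_top"
      using tendstoD[OF z that] by (simp add: zt_def)
    then obtain j0 where "\<And>j. j \<ge> j0 \<Longrightarrow> norm (zt j) < e" unfolding eventually_at_top_linorder by blast
    then show ?thesis by (meson max.cobounded1 max.cobounded2)
  qed
  have "zt T \<notin> U"
  proof
    assume U: "zt T \<in> U"
    have "norm (zt T) / (2 * K) > 0" using zt_nz K by simp
    from small[OF this] obtain j where "j \<ge> T" "norm (zt j) < norm (zt T) / (2 * K)" by blast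
    then show False using low[OF U] K by (auto simp: Xz field_simps not_less[symmetric])
  qed
  moreover have "dim U = N"
  proof -
    have "blinfun_apply (\<Phi> T) ` range (blinfun_apply S) = U"
    proof (intro equalityI subsetI)
      fix u assume "u \<in> blinfun_apply (\<Phi> T) ` range (blinfun_apply S)"
      then obtain v where v: "u = \<Phi> T (S v)" by blast
      have "S (S v) = S v" using arg_cong[OF S, of "\<lambda>L. blinfun_apply L v"] by simp
      then show "u \<in> U" using v fundamental_pair_cancel(2)[OF FB, of T "S v"] by (simp add: U_def blinfun.bilinear_simps)
    next
      fix u assume "u \<in> U"
      then have "S (\<Psi> T u) = \<Psi> T u" by (simp add: U_def blinfun.bilinear_simps)
      then have "u = \<Phi> T (S (\<Psi> T u))" using fundamental_pair_cancel(1)[OF FB, of T u] by simp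
      then show "u \<in> blinfun_apply (\<Phi> T) ` range (blinfun_apply S)" by blast
    qed
    moreover have "inj_on (blinfun_apply (\<Phi> T)) (span (range (blinfun_apply S)))"
      using fundamental_pair_cancel(2)[OF FB, of T] by (metis inj_onI)
    ultimately show ?thesis
      unfolding N_def using dim_image_eq[of "blinfun_apply (\<Phi> T)" "range (blinfun_apply S)"]
      by (simp add: blinfun.bounded_linear_right bounded_linear.linear)
  qed
  ultimately have dimV: "dim (span (insert (zt T) U)) = Suc N"
    using subU by (metis Suc_eq_plus1 dim_insert dim_span span_eq_iff)

  obtain \<delta>0 where \<delta>0: "\<delta>0 > 0" "\<And>u. norm (u - zt T) < \<delta>0 \<Longrightarrow> \<not> alternates CARD('n) N (cmp u)"
    using Lambda_set_nearby_alternates[OF T(3), of N] notT by blast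
  \<comment> \<open>After division by b, a unit vector perturbs \<open>zt T\<close> by at most
    \<delta>0 / 2, which is too little to create \<open>N\<close> alternations.\<close>
  define b0 where "b0 = 2 / \<delta>0"
  have b0: "b0 > 0" using \<delta>0(1) by (simp add: b0_def)
  have far: "\<not> alternates CARD('n) N (cmp (u + b *\<^sub>R zt T))" if "norm u = 1" "\<bar>b\<bar> \<ge> b0" for u b
  proof -
    have b: "b \<noteq> 0" using that b0 by auto
    have "norm ((1 / b) *\<^sub>R (u + b *\<^sub>R zt T) - zt T) = 1 / \<bar>b\<bar>"
      using b that(1) by (simp add: scaleR_add_right)
    also have "\<dots> \<le> 1 / b0" using that(2) b0 by (intro divide_left_mono) auto
    also have "\<dots> < \<delta>0" using \<delta>0(1) by (simp add: b0_def)
    finally have *: "\<not> alternates CARD('n) N (cmp ((1 / b) *\<^sub>R (u + b *\<^sub>R zt T)))" using \<delta>0(2) by blast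
    show ?thesis
    proof
      assume "alternates CARD('n) N (cmp (u + b *\<^sub>R zt T))"
      then have "alternates CARD('n) N (cmp (b *\<^sub>R ((1 / b) *\<^sub>R (u + b *\<^sub>R zt T))))" using b by simp
      then show False using alternates_scaleR[OF b] * by blast
    qed
  qed
  obtain \<delta> where \<delta>: "\<delta> > 0" "\<And>x y :: (real,'n) vec. x \<noteq> 0 \<Longrightarrow> (\<forall>r<N. moment r x = 0) \<Longrightarrow>
      norm (y - x) \<le> \<delta> * norm x \<Longrightarrow> alternates CARD('n) N (cmp y)"
    using alternates_near_moments_zero[where 'n='n, of N] by blast

  \<comment> \<open>The bracket bounds \<open>norm (X j u)\<close> in units of
    \<open>norm (zt j)\<close>, and \<open>2 * K\<close> is the factor from \<open>low\<close>. The
    value does not depend on j, which makes the decay of \<open>zt\<close> contradictory.\<close>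
  define C where "C = 2 * K * (2 * b0 / \<delta> + b0)"
  have C: "C > 0" using K b0 \<delta> by (simp add: C_def add_pos_pos)
  have key: "1 \<le> C * norm (zt j)" if j: "j \<ge> T" for j
  proof -
    have "\<exists>x\<in>span (insert (zt T) U). x \<noteq> 0 \<and> (\<forall>r<N. moment r (X j x) = 0)"
    proof (rule common_zero_exists)
      show "linear (\<lambda>x. moment r (X j x))" for r
        using linear_compose[OF _ linear_moment, of "blinfun_apply (X j)" r]
        by (simp add: o_def blinfun.bounded_linear_right bounded_linear.linear)
    qed (use dimV in auto)
    then obtain x where x: "x \<in> span (insert (zt T) U)" "x \<noteq> 0" "\<forall>r<N. moment r (X j x) = 0" by blast
    then obtain a' where "x - a' *\<^sub>R zt T \<in> U" using subU by (metis span_breakdown_eq span_eq_iff)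
    define u' where "u' = x - a' *\<^sub>R zt T"
    have u': "u' \<in> U" "x = u' + a' *\<^sub>R zt T" using \<open>x - a' *\<^sub>R zt T \<in> U\<close> by (simp_all add: u'_def)
    have altx: "alternates CARD('n) N (cmp (X j x))" using alternates_if_moments_zero[OF X_nz[OF x(2)]] x(3) by blast
    have "u' \<noteq> 0"
    proof
      assume "u' = 0"
      then have "X j x = a' *\<^sub>R zt j" "a' \<noteq> 0" using u'(2) x(2) by (auto simp: blinfun.scaleR_right Xz)
      then show False using altx alternates_scaleR notz[OF j] by metis
    qed
    define c where "c = 1 / norm u'"
    define u where "u = c *\<^sub>R u'"
    define a where "a = c * a'"
    define y where "y = u + a *\<^sub>R zt T"
    have c: "c > 0" using \<open>u' \<noteq> 0\<close> by (simp add: c_def)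
    have u: "norm u = 1" "u \<in> U" using \<open>u' \<noteq> 0\<close> u'(1) subU by (auto simp: u_def c_def subspace_scale)
    have y: "y = c *\<^sub>R x" by (simp add: y_def u'(2) u_def a_def scaleR_add_right)
    have mom: "\<forall>r<N. moment r (X j y) = 0"
      using x(3) by (simp add: y blinfun.scaleR_right moment_scaleR)
    have ynz: "X j y \<noteq> 0" using X_nz x(2) c y by simp
    have alty: "alternates CARD('n) N (cmp (X j y))" using alternates_if_moments_zero[OF ynz] mom by blast
    \<comment> \<open>The vector \<open>X j y\<close> has \<open>N\<close> alternations, hence so
      has \<open>y\<close> itself at time \<open>T\<close>; \<open>far\<close> forbids this for
      large coefficients.\<close>
    have a: "\<bar>a\<bar> < b0"
      using far[OF u(1), of a] mono[OF alty j] by (force simp: y_def)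
    \<comment> \<open>Raising the coefficient of \<open>zt T\<close> from \<open>a\<close> to
      \<open>b0\<close> loses the alternations, so the change must exceed the margin \<delta> around
      \<open>X j y\<close>. The change is a multiple of \<open>zt j\<close>, so \<open>X j y\<close>
      is at most of the order of \<open>zt j\<close>.\<close>
    have "\<not> alternates CARD('n) N (cmp (X j (u + b0 *\<^sub>R zt T)))"
      using far[OF u(1), of b0] mono[of j "u + b0 *\<^sub>R zt T"] j b0 by auto
    then have "\<not> norm (X j (u + b0 *\<^sub>R zt T) - X j y) \<le> \<delta> * norm (X j y)" using \<delta>(2)[OF ynz mom] by blast
    moreover have "X j (u + b0 *\<^sub>R zt T) - X j y = (b0 - a) *\<^sub>R zt j"
      by (simp add: y_def blinfun.bilinear_simps Xz scaleR_diff_left)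
    ultimately have "\<delta> * norm (X j y) < \<bar>b0 - a\<bar> * norm (zt j)" by simp
    also have "\<dots> \<le> 2 * b0 * norm (zt j)" using a by (intro mult_right_mono) auto
    finally have 1: "norm (X j y) \<le> 2 * b0 / \<delta> * norm (zt j)" using \<delta>(1) by (simp add: field_simps)
    have "X j u = X j y - a *\<^sub>R zt j" by (simp add: y_def blinfun.bilinear_simps Xz)
    then have "norm (X j u) \<le> norm (X j y) + \<bar>a\<bar> * norm (zt j)"
      by (metis norm_scaleR norm_triangle_ineq4 real_norm_def)
    also have "\<dots> \<le> 2 * b0 / \<delta> * norm (zt j) + b0 * norm (zt j)"
      using 1 a by (intro add_mono mult_right_mono) auto
    finally have "norm (X j u) \<le> (2 * b0 / \<delta> + b0) * norm (zt j)" by (simp add: algebra_simps)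
    then have "2 * K * norm (X j u) \<le> 2 * K * ((2 * b0 / \<delta> + b0) * norm (zt j))"
      using K by (intro mult_left_mono) auto
    then show ?thesis using low[OF u(2) j] u(1) by (simp add: C_def mult.assoc)
  qed
  have "1 / C > 0" using C by simp
  from small[OF this] obtain j where "j \<ge> T" "norm (zt j) < 1 / C" by blast
  then show False using key[of j] C by (simp add: field_simps)
qed

section \<open>The hull and averaged derivatives\<close>

text \<open>Unlike the strict inequalities of \<open>jacobi\<close>, these conditions are closed and
  convex, so they pass to limits in the hull and to averages.\<close>

definition jacobi_ge :: "real \<Rightarrow> ((real,'n::{finite,linorder}) vec \<Rightarrow>\<^sub>L (real,'n) vec) \<Rightarrow> bool" where
  "jacobi_ge e L \<longleftrightarrow> (\<forall>i\<in>{1..CARD('n)}. \<forall>j\<in>{1..CARD('n)}.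
     ((j = i + 1 \<or> i = j + 1) \<longrightarrow> cmp (L (axis (ix j) 1)) i \<ge> e) \<and>
     ((i + 1 < j \<or> j + 1 < i) \<longrightarrow> cmp (L (axis (ix j) 1)) i = 0))"

lemma jacobi_if_ge: "jacobi_ge e L \<Longrightarrow> e > 0 \<Longrightarrow> jacobi L"
  unfolding jacobi_ge_def jacobi_def by (meson less_le_trans)

lemma bounded_linear_entry: "bounded_linear (\<lambda>L. cmp (blinfun_apply L v) i)"
  using bounded_linear_compose[OF bounded_linear_cmp blinfun.bounded_linear_left] .

text \<open>The properties of the original field that every element of the hull inherits; all later
  arguments about the dynamics refer to these. Uniform continuity is demanded for all times at once
  because limits in time are taken.\<close>

definition coop_field :: "real \<Rightarrow> (real \<Rightarrow> (real,'n::{finite,linorder}) vec \<Rightarrow> (real,'n) vec) \<Rightarrow>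
    (real \<Rightarrow> (real,'n) vec \<Rightarrow> (real,'n) vec \<Rightarrow>\<^sub>L (real,'n) vec) \<Rightarrow> bool" where
  "coop_field e g Dg \<longleftrightarrow> (\<forall>t x. (g t has_derivative blinfun_apply (Dg t x)) (at x)) \<and>
     (\<forall>R. uniformly_continuous_on (UNIV \<times> cball 0 R) (\<lambda>(t, x). Dg t x)) \<and>
     (\<forall>t x. jacobi_ge e (Dg t x))"

lemma jacobi_ge_derivative:
  fixes f :: "real \<Rightarrow> (real,'n::{finite,linorder}) vec \<Rightarrow> (real,'n) vec"
  assumes tri: "tridiagonal f" and coop: "coop_bound f e"
    and Df: "\<And>t x. (f t has_derivative blinfun_apply (Df t x)) (at x)"
  shows "jacobi_ge e (Df t x)"
proof -
  have pd: "pd f i j t x = cmp (Df t x (axis (ix j) 1)) i" for i j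
    unfolding pd_def using frechet_derivative_at[OF Df[of t x]] by simp
  have near: "cmp (Df t x (axis (ix j) 1)) i \<ge> e"
    if "i \<in> {1..CARD('n)}" "j \<in> {1..CARD('n)}" "j = i + 1 \<or> i = j + 1" for i j
  proof -
    have "pd f i j t x \<ge> e"
      using that(3)
    proof
      assume "j = i + 1"
      moreover from this have "i \<in> {1..<CARD('n)}" using that by auto
      ultimately show ?thesis using coop unfolding coop_bound_def by blast
    next
      assume "i = j + 1"
      moreover from this have "j \<in> {1..<CARD('n)}" using that by auto
      ultimately show ?thesis using coop unfolding coop_bound_def by blast
    qed
    then show ?thesis by (simp add: pd)
  qed
  have far: "cmp (Df t x (axis (ix j) 1)) i = 0"
    if ij: "i \<in> {1..CARD('n)}" "j \<in> {1..CARD('n)}" "i + 1 < j \<or> j + 1 < i" for i j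
  proof -
    define a where "a = (axis (ix j) 1 :: (real,'n) vec)"
    have "(f t has_derivative blinfun_apply (Df t x)) (at (x + 0 *\<^sub>R a))" using Df by simp
    moreover have "((\<lambda>h. x + h *\<^sub>R a) has_derivative (\<lambda>h. h *\<^sub>R a)) (at 0)"
      by (auto intro!: derivative_eq_intros)
    ultimately have "((\<lambda>h. f t (x + h *\<^sub>R a)) has_derivative (\<lambda>h. Df t x (h *\<^sub>R a))) (at 0)"
      using diff_chain_at[of "\<lambda>h. x + h *\<^sub>R a" "\<lambda>h. h *\<^sub>R a" 0 "f t" "blinfun_apply (Df t x)"] by (simp add: o_def)
    then have "((\<lambda>h. f t (x + h *\<^sub>R a)) has_vector_derivative Df t x a) (at 0)"
      by (simp add: has_vector_derivative_def blinfun.scaleR_right)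
    from bounded_linear.has_vector_derivative[OF bounded_linear_cmp this]
    have "((\<lambda>h. cmp (f t (x + h *\<^sub>R a)) i) has_vector_derivative cmp (Df t x a) i) (at 0)" .
    moreover have "cmp (f t (x + h *\<^sub>R a)) i = cmp (f t x) i" for h
    proof -
      have "\<forall>k\<in>{1..CARD('n)}. i \<le> k + 1 \<and> k \<le> i + 1 \<longrightarrow> cmp (x + h *\<^sub>R a) k = cmp x k"
        using ij by (auto simp: a_def cmp_axis)
      then show ?thesis using tri ij(1) unfolding tridiagonal_def by blast
    qed
    then have "((\<lambda>h. cmp (f t (x + h *\<^sub>R a)) i) has_vector_derivative 0) (at 0)" by simp
    ultimately show ?thesis unfolding a_def by (rule vector_derivative_unique_at)
  qed
  show ?thesis unfolding jacobi_ge_def using near far by blast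
qed

lemma admissibleD:
  assumes "admissible h" "compact K"
  shows "bounded ((\<lambda>(t, x). h t x) ` (UNIV \<times> K))" "uniformly_continuous_on (UNIV \<times> K) (\<lambda>(t, x). h t x)"
  using assms(1)[unfolded admissible_def, rule_format, OF assms(2)] by (rule conjunct1, rule conjunct2)

text \<open>Convergence in the hull concerns values only. Boundedness of \<open>Df\<close> gives a
  convergent subsequence of derivatives at \<open>x\<close>. Its uniform continuity makes the
  linearization error independent of the time shift, so the error bound passes to the limit and
  identifies the derivative of \<open>g\<close>.\<close>

lemma hull_derivative_limit:
  fixes f g :: "real \<Rightarrow> (real,'n::{finite,linorder}) vec \<Rightarrow> (real,'n) vec"
  assumes Df: "\<And>t x. (f t has_derivative blinfun_apply (Df t x)) (at x)" and adm: "admissible Df"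
    and conv: "\<And>t x. (\<lambda>k. f (t + \<tau> k) x) \<longlonglongrightarrow> g t x"
  shows "\<exists>r D. strict_mono (r :: nat \<Rightarrow> nat) \<and> (\<lambda>k. Df (t + \<tau> (r k)) x) \<longlonglongrightarrow> D \<and>
    (g t has_derivative blinfun_apply D) (at x)"
proof -
  have "bounded ((\<lambda>(t, x). Df t x) ` (UNIV \<times> {x}))" by (rule admissibleD[OF adm]) simp
  then have "bounded (range (\<lambda>k. Df (t + \<tau> k) x))" by (rule bounded_subset) auto
  from bounded_imp_convergent_subsequence[OF this] obtain D r where
    r: "strict_mono (r :: nat \<Rightarrow> nat)" "(\<lambda>k. Df (t + \<tau> (r k)) x) \<longlonglongrightarrow> D"
    by (auto simp: o_def)
  have "(g t has_derivative blinfun_apply D) (at x)"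
    unfolding has_derivative_at_alt
  proof (intro conjI allI impI)
    fix e :: real assume e: "e > 0"
    have "uniformly_continuous_on (UNIV \<times> cball x 1) (\<lambda>(t, x). Df t x)"
      by (rule admissibleD[OF adm]) simp
    then obtain d where d: "d > 0" "\<And>s y s' y'. y \<in> cball x 1 \<Longrightarrow> y' \<in> cball x 1 \<Longrightarrow>
        dist (s', y') (s, y) < d \<Longrightarrow> dist (Df s' y') (Df s y) < e"
      using e unfolding uniformly_continuous_on_def by (fastforce simp del: dist_Pair_Pair)
    have "norm (g t y - g t x - D (y - x)) \<le> e * norm (y - x)" if y: "norm (y - x) < min d 1" for y
    proof (rule tendsto_upperbound)
      show "(\<lambda>k. norm (f (t + \<tau> (r k)) y - f (t + \<tau> (r k)) x - Df (t + \<tau> (r k)) x (y - x)))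
          \<longlonglongrightarrow> norm (g t y - g t x - D (y - x))"
        using LIMSEQ_subseq_LIMSEQ[OF conv[of t x] r(1)] LIMSEQ_subseq_LIMSEQ[OF conv[of t y] r(1)] r(2)
        by (intro tendsto_intros) (auto simp: o_def)
      have "norm (f s y - f s x - Df s x (y - x)) \<le> norm (y - x) * e" for s
      proof (rule differentiable_bound_linearization[where S = "ball x (min d 1)" and f = "f s"
          and f' = "\<lambda>u. blinfun_apply (Df s u)" and ?x0.0 = x and a = x and b = y and B = e])
        show "x + u *\<^sub>R (y - x) \<in> ball x (min d 1)" if "u \<in> {0..1}" for u
        proof -
          have "norm (u *\<^sub>R (y - x)) \<le> 1 * norm (y - x)"
            unfolding norm_scaleR using that by (intro mult_right_mono) auto
          then have "norm (u *\<^sub>R (y - x)) < min d 1" using y by simp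
          then show ?thesis by (simp only: mem_ball dist_norm) (simp add: norm_minus_commute)
        qed
        show "(f s has_derivative blinfun_apply (Df s u)) (at u within ball x (min d 1))" for u
          using Df by (rule has_derivative_at_withinI)
        show "onorm (blinfun_apply (Df s u) - blinfun_apply (Df s x)) \<le> e" if "u \<in> ball x (min d 1)" for u
        proof -
          have "dist (Df s u) (Df s x) < e"
            using d(2)[of x u s s] that by (auto simp: dist_Pair_Pair dist_commute)
          then show ?thesis
            by (simp add: dist_norm norm_blinfun.rep_eq minus_blinfun.rep_eq fun_diff_def)
        qed
        show "x \<in> ball x (min d 1)" using d(1) by simp
      qed
      then show "eventually (\<lambda>k. norm (f (t + \<tau> (r k)) y - f (t + \<tau> (r k)) x - Df (t + \<tau> (r k)) x (y - x)) \<le> e * norm (y - x)) sequentially"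
        by (simp add: mult.commute)
    qed simp
    then show "\<exists>d>0. \<forall>y. norm (y - x) < d \<longrightarrow> norm (g t y - g t x - D (y - x)) \<le> e * norm (y - x)"
      using d(1) by (intro exI[of _ "min d 1"]) auto
  qed (rule blinfun.bounded_linear_right)
  then show ?thesis using r by blast
qed

lemma hull_coop_field:
  fixes f g :: "real \<Rightarrow> (real,'n::{finite,linorder}) vec \<Rightarrow> (real,'n) vec"
  assumes f: "C1_admissible f" "tridiagonal f" "coop_bound f e" and g: "g \<in> hull_H f"
  shows "\<exists>Dg. coop_field e g Dg"
proof -
  obtain Df where Df: "\<And>t x. (f t has_derivative blinfun_apply (Df t x)) (at x)" and adm: "admissible Df"
    using f(1) unfolding C1_admissible_def by blast
  obtain \<tau> :: "nat \<Rightarrow> real" where \<tau>: "\<And>K. compact K \<Longrightarrow>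
      uniform_limit K (\<lambda>k (t, x). f (t + \<tau> k) x) (\<lambda>(t, x). g t x) sequentially"
    using g unfolding hull_H_def by blast
  have conv: "(\<lambda>k. f (t + \<tau> k) x) \<longlonglongrightarrow> g t x" for t x
    using tendsto_uniform_limitI[OF \<tau>[of "{(t, x)}"], of "(t, x)"] by simp
  have lim: "\<exists>r' D. strict_mono (r' :: nat \<Rightarrow> nat) \<and> (\<lambda>k. Df (t + \<tau> (r (r' k))) x) \<longlonglongrightarrow> D \<and>
      (g t has_derivative blinfun_apply D) (at x)" if "strict_mono (r :: nat \<Rightarrow> nat)" for r t x
    using hull_derivative_limit[OF Df adm, of "\<lambda>k. \<tau> (r k)" g t x] LIMSEQ_subseq_LIMSEQ[OF conv that]
    by (simp add: o_def)
  have "\<exists>D. (g t has_derivative blinfun_apply D) (at x)" for t x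
    using lim[OF strict_mono_id] by blast
  then obtain Dg where Dg: "\<And>t x. (g t has_derivative blinfun_apply (Dg t x)) (at x)" by metis
  have uniq: "D = Dg t x" if "(g t has_derivative blinfun_apply D) (at x)" for D t x
    using has_derivative_unique[OF that Dg] by (rule blinfun_apply_inject[THEN iffD1])
  \<comment> \<open>The subsequence depends on the point. A common one for two points is enough to
    carry over a modulus of continuity, because shifting both times equally does not change their
    distance.\<close>
  have lim2: "\<exists>r. (\<lambda>k. Df (t + \<tau> (r k)) x) \<longlonglongrightarrow> Dg t x \<and> (\<lambda>k. Df (s + \<tau> (r k)) y) \<longlonglongrightarrow> Dg s y" for t s x y
  proof -
    obtain r1 D1 where D1: "strict_mono (r1 :: nat \<Rightarrow> nat)" "(\<lambda>k. Df (t + \<tau> (id (r1 k))) x) \<longlonglongrightarrow> D1"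
      "(g t has_derivative blinfun_apply D1) (at x)"
      using lim[OF strict_mono_id, of t x] by blast
    have r1: "strict_mono r1" "(\<lambda>k. Df (t + \<tau> (r1 k)) x) \<longlonglongrightarrow> Dg t x"
      using D1(1,2) uniq[OF D1(3)] by simp_all
    obtain r2 D2 where D2: "strict_mono (r2 :: nat \<Rightarrow> nat)" "(\<lambda>k. Df (s + \<tau> (r1 (r2 k))) y) \<longlonglongrightarrow> D2"
      "(g s has_derivative blinfun_apply D2) (at y)"
      using lim[OF r1(1), of s y] by blast
    have r2: "strict_mono r2" "(\<lambda>k. Df (s + \<tau> (r1 (r2 k))) y) \<longlonglongrightarrow> Dg s y"
      using D2(1,2) uniq[OF D2(3)] by simp_all
    show ?thesis using LIMSEQ_subseq_LIMSEQ[OF r1(2) r2(1)] r2(2)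
      by (intro exI[of _ "\<lambda>k. r1 (r2 k)"]) (simp add: o_def)
  qed
  have "uniformly_continuous_on (UNIV \<times> cball 0 R) (\<lambda>(t, x). Dg t x)" for R
    unfolding uniformly_continuous_on_def
  proof (intro allI impI)
    fix \<epsilon> :: real assume \<epsilon>: "\<epsilon> > 0"
    have "uniformly_continuous_on (UNIV \<times> cball 0 R) (\<lambda>(t, x). Df t x)"
      by (rule admissibleD[OF adm]) simp
    then obtain d where d: "d > 0" "\<And>p p'. p \<in> UNIV \<times> cball 0 R \<Longrightarrow> p' \<in> UNIV \<times> cball 0 R \<Longrightarrow> dist p' p < d \<Longrightarrow>
        dist (case p' of (t, x) \<Rightarrow> Df t x) (case p of (t, x) \<Rightarrow> Df t x) < \<epsilon> / 2"
      using \<epsilon> unfolding uniformly_continuous_on_def by (metis half_gt_zero)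
    have "dist (Dg t x) (Dg s y) < \<epsilon>"
      if "x \<in> cball 0 R" "y \<in> cball 0 R" "dist (t, x) (s, y) < d" for t s x y
    proof -
      obtain r where r: "(\<lambda>k. Df (t + \<tau> (r k)) x) \<longlonglongrightarrow> Dg t x" "(\<lambda>k. Df (s + \<tau> (r k)) y) \<longlonglongrightarrow> Dg s y"
        using lim2 by blast
      have "dist (Dg t x) (Dg s y) \<le> \<epsilon> / 2"
      proof (rule tendsto_upperbound[OF tendsto_dist[OF r]])
        have "dist (Df (t + c) x) (Df (s + c) y) < \<epsilon> / 2" for c
          using d(2)[of "(s + c, y)" "(t + c, x)"] that by (auto simp: dist_Pair_Pair dist_real_def)
        then show "eventually (\<lambda>k. dist (Df (t + \<tau> (r k)) x) (Df (s + \<tau> (r k)) y) \<le> \<epsilon> / 2) sequentially"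
          by (simp add: less_imp_le)
      qed simp
      then show ?thesis using \<epsilon> by simp
    qed
    then show "\<exists>d>0. \<forall>p\<in>UNIV \<times> cball 0 R. \<forall>p'\<in>UNIV \<times> cball 0 R. dist p' p < d \<longrightarrow>
        dist (case p' of (t, x) \<Rightarrow> Dg t x) (case p of (t, x) \<Rightarrow> Dg t x) < \<epsilon>"
      using d(1) by (intro exI[of _ d]) auto
  qed
  moreover have "jacobi_ge e (Dg t x)" for t x
  proof -
    obtain r where r: "(\<lambda>k. Df (t + \<tau> (r k)) x) \<longlonglongrightarrow> Dg t x" using lim2 by blast
    have ent: "(\<lambda>k. cmp (Df (t + \<tau> (r k)) x v) i) \<longlonglongrightarrow> cmp (Dg t x v) i" for v i
      by (rule bounded_linear.tendsto[OF bounded_linear_entry r])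
    have J: "jacobi_ge e (Df s x)" for s by (rule jacobi_ge_derivative[OF f(2,3) Df])
    show ?thesis unfolding jacobi_ge_def
    proof (intro ballI conjI impI)
      fix i j assume ij: "i \<in> {1..CARD('n)}" "j \<in> {1..CARD('n)}"
      show "e \<le> cmp (Dg t x (axis (ix j) 1)) i" if "j = i + 1 \<or> i = j + 1"
      proof -
        have "e \<le> cmp (Df s x (axis (ix j) 1)) i" for s using J ij that unfolding jacobi_ge_def by blast
        then show ?thesis by (intro tendsto_lowerbound[OF ent] always_eventually) auto
      qed
      show "cmp (Dg t x (axis (ix j) 1)) i = 0" if "i + 1 < j \<or> j + 1 < i"
      proof -
        have "cmp (Df s x (axis (ix j) 1)) i = 0" for s using J ij that unfolding jacobi_ge_def by blast
        then show ?thesis using ent[of "axis (ix j) 1" i] by (simp add: LIMSEQ_const_iff)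
      qed
    qed
  qed
  ultimately show ?thesis using Dg unfolding coop_field_def by blast
qed

section \<open>Exact linear equations for differences of solutions\<close>

definition avg_derivative :: "(real \<Rightarrow> (real,'n::{finite,linorder}) vec \<Rightarrow> (real,'n) vec \<Rightarrow>\<^sub>L (real,'n) vec) \<Rightarrow>
    (real \<Rightarrow> (real,'n) vec) \<Rightarrow> (real \<Rightarrow> (real,'n) vec) \<Rightarrow> real \<Rightarrow> (real,'n) vec \<Rightarrow>\<^sub>L (real,'n) vec" where
  "avg_derivative Dg x \<zeta> t = integral {0..1} (\<lambda>s. Dg t (x t + s *\<^sub>R \<zeta> t))"

lemma coop_field_continuous_on:
  fixes g :: "real \<Rightarrow> (real,'n::{finite,linorder}) vec \<Rightarrow> (real,'n) vec"
  assumes "coop_field e g Dg"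
  shows "continuous_on UNIV (\<lambda>(t, x). Dg t x)"
proof (rule continuous_at_imp_continuous_on, rule ballI)
  fix p :: "real \<times> (real,'n) vec"
  define R where "R = norm (snd p) + 1"
  have "continuous_on (UNIV \<times> cball 0 R) (\<lambda>(t, x). Dg t x)"
    using assms uniformly_continuous_imp_continuous unfolding coop_field_def by blast
  then have "continuous_on (UNIV \<times> ball 0 R) (\<lambda>(t, x). Dg t x)"
    by (rule continuous_on_subset) auto
  moreover have "open (UNIV \<times> ball (0 :: (real,'n) vec) R :: (real \<times> (real,'n) vec) set)" by (intro open_Times) auto
  moreover have "p \<in> UNIV \<times> ball 0 R" by (cases p) (simp add: R_def)
  ultimately show "isCont (\<lambda>(t, x). Dg t x) p" using continuous_on_eq_continuous_at by blast
qed

text \<open>The sign pattern survives integration since it consists of linear inequalities and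
  equations in the entries; the last claim is the fundamental theorem of calculus along the segment
  from \<open>x t\<close> to \<open>x t + \<zeta> t\<close>.\<close>

lemma avg_derivative:
  fixes g :: "real \<Rightarrow> (real,'n::{finite,linorder}) vec \<Rightarrow> (real,'n) vec"
  assumes F: "coop_field e g Dg" and x: "continuous_on UNIV x" and \<zeta>: "continuous_on UNIV \<zeta>"
  shows "continuous_on UNIV (avg_derivative Dg x \<zeta>)"
    and "jacobi_ge e (avg_derivative Dg x \<zeta> t)"
    and "g t (x t + \<zeta> t) - g t (x t) = avg_derivative Dg x \<zeta> t (\<zeta> t)"
proof -
  have cc: "continuous_on UNIV (\<lambda>(t, s). Dg t (x t + s *\<^sub>R \<zeta> t))"
  proof -
    have "continuous_on UNIV (\<lambda>p :: real \<times> real. (fst p, x (fst p) + snd p *\<^sub>R \<zeta> (fst p)))"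
      by (intro continuous_intros continuous_on_compose2[OF x] continuous_on_compose2[OF \<zeta>]) auto
    from continuous_on_compose2[OF coop_field_continuous_on[OF F] this] show ?thesis
      by (simp add: case_prod_beta)
  qed
  have "continuous_on (UNIV \<times> cbox 0 1) (\<lambda>(t, s). Dg t (x t + s *\<^sub>R \<zeta> t))"
    using cc continuous_on_subset by blast
  from integral_continuous_on_param[OF this] show "continuous_on UNIV (avg_derivative Dg x \<zeta>)"
    by (simp add: avg_derivative_def[abs_def])
  have cs: "continuous_on S (\<lambda>s. Dg t (x t + s *\<^sub>R \<zeta> t))" for S
  proof -
    have "continuous_on S (\<lambda>s. (t, s))" by (intro continuous_intros)
    from continuous_on_compose2[OF cc this] show ?thesis by simp
  qed
  then have int: "(\<lambda>s. Dg t (x t + s *\<^sub>R \<zeta> t)) integrable_on {0..1}" by (rule integrable_continuous_real)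
  have ent: "((\<lambda>s. cmp (Dg t (x t + s *\<^sub>R \<zeta> t) v) i) has_integral cmp (avg_derivative Dg x \<zeta> t v) i) {0..1}" for v i
    using has_integral_linear[OF integrable_integral[OF int] bounded_linear_entry, of v i]
    by (simp add: avg_derivative_def o_def)
  show "jacobi_ge e (avg_derivative Dg x \<zeta> t)" unfolding jacobi_ge_def
  proof (intro ballI conjI impI)
    fix i j assume ij: "i \<in> {1..CARD('n)}" "j \<in> {1..CARD('n)}"
    have J: "jacobi_ge e (Dg t y)" for y using F by (simp add: coop_field_def)
    show "e \<le> cmp (avg_derivative Dg x \<zeta> t (axis (ix j) 1)) i" if "j = i + 1 \<or> i = j + 1"
    proof -
      have "((\<lambda>s. e) has_integral e) {0..1::real}" using has_integral_const_real[of e 0 1] by simp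
      moreover have "e \<le> cmp (Dg t y (axis (ix j) 1)) i" for y using J ij that unfolding jacobi_ge_def by blast
      ultimately show ?thesis using has_integral_le[OF _ ent] by blast
    qed
    show "cmp (avg_derivative Dg x \<zeta> t (axis (ix j) 1)) i = 0" if "i + 1 < j \<or> j + 1 < i"
    proof -
      have "cmp (Dg t y (axis (ix j) 1)) i = 0" for y using J ij that unfolding jacobi_ge_def by blast
      then show ?thesis using ent[of "axis (ix j) 1" i] has_integral_unique by fastforce
    qed
  qed
  have "((\<lambda>s. g t (x t + s *\<^sub>R \<zeta> t)) has_vector_derivative Dg t (x t + s *\<^sub>R \<zeta> t) (\<zeta> t)) (at s within {0..1})" for s
  proof -
    have "(g t has_derivative blinfun_apply (Dg t (x t + s *\<^sub>R \<zeta> t))) (at (x t + s *\<^sub>R \<zeta> t))"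
      using F by (simp add: coop_field_def)
    moreover have "((\<lambda>s. x t + s *\<^sub>R \<zeta> t) has_derivative (\<lambda>h. h *\<^sub>R \<zeta> t)) (at s)"
      by (auto intro!: derivative_eq_intros)
    ultimately have "((\<lambda>s. g t (x t + s *\<^sub>R \<zeta> t)) has_derivative (\<lambda>h. Dg t (x t + s *\<^sub>R \<zeta> t) (h *\<^sub>R \<zeta> t))) (at s)"
      using diff_chain_at[of "\<lambda>s. x t + s *\<^sub>R \<zeta> t" "\<lambda>h. h *\<^sub>R \<zeta> t" s "g t"] by (simp add: o_def)
    then show ?thesis
      by (simp add: has_vector_derivative_def blinfun.scaleR_right has_derivative_at_withinI)
  qed
  then have 1: "((\<lambda>s. Dg t (x t + s *\<^sub>R \<zeta> t) (\<zeta> t)) has_integral (g t (x t + 1 *\<^sub>R \<zeta> t) - g t (x t + 0 *\<^sub>R \<zeta> t))) {0..1}"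
    by (intro fundamental_theorem_of_calculus[where f = "\<lambda>s. g t (x t + s *\<^sub>R \<zeta> t)"]) auto
  have 2: "((\<lambda>s. Dg t (x t + s *\<^sub>R \<zeta> t) (\<zeta> t)) has_integral avg_derivative Dg x \<zeta> t (\<zeta> t)) {0..1}"
    using has_integral_linear[OF integrable_integral[OF int] blinfun.bounded_linear_left, of "\<zeta> t"]
    by (simp add: avg_derivative_def o_def)
  show "g t (x t + \<zeta> t) - g t (x t) = avg_derivative Dg x \<zeta> t (\<zeta> t)"
    using has_integral_unique[OF 1 2] by simp
qed

text \<open>A bounded base orbit keeps all segments with short \<zeta> in one ball, where the
  modulus of continuity of \<open>Dg\<close> is the same for all times.\<close>

lemma avg_derivative_tendsto:
  fixes g :: "real \<Rightarrow> (real,'n::{finite,linorder}) vec \<Rightarrow> (real,'n) vec"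
  assumes F: "coop_field e g Dg" and xR: "\<And>t. norm (x t) \<le> R" and \<zeta>: "(\<zeta> \<longlongrightarrow> 0) \<F>"
  shows "((\<lambda>t. avg_derivative Dg x \<zeta> t - Dg t (x t)) \<longlongrightarrow> 0) \<F>"
proof (rule tendstoI)
  fix \<epsilon> :: real assume \<epsilon>: "\<epsilon> > 0"
  have "uniformly_continuous_on (UNIV \<times> cball 0 (R + 1)) (\<lambda>(t, x). Dg t x)"
    using F by (simp add: coop_field_def)
  then obtain d where d: "d > 0" "\<And>p p'. p \<in> UNIV \<times> cball 0 (R + 1) \<Longrightarrow> p' \<in> UNIV \<times> cball 0 (R + 1) \<Longrightarrow> dist p' p < d \<Longrightarrow>
      dist (case p' of (t, x) \<Rightarrow> Dg t x) (case p of (t, x) \<Rightarrow> Dg t x) < \<epsilon> / 2"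
    using \<epsilon> unfolding uniformly_continuous_on_def by (metis half_gt_zero)
  have "eventually (\<lambda>t. dist (\<zeta> t) 0 < min d 1) \<F>" using tendstoD[OF \<zeta>, of "min d 1"] d(1) by simp
  then show "eventually (\<lambda>t. dist (avg_derivative Dg x \<zeta> t - Dg t (x t)) 0 < \<epsilon>) \<F>"
  proof (rule eventually_mono)
    fix t assume t: "dist (\<zeta> t) 0 < min d 1"
    have cs: "continuous_on {0..1} (\<lambda>s. Dg t (x t + s *\<^sub>R \<zeta> t))"
    proof -
      have "continuous_on {0..1} (\<lambda>s. (t, x t + s *\<^sub>R \<zeta> t))" by (intro continuous_intros)
      from continuous_on_compose2[OF coop_field_continuous_on[OF F] this] show ?thesis by simp
    qed
    have near: "norm (Dg t (x t + s *\<^sub>R \<zeta> t) - Dg t (x t)) \<le> \<epsilon> / 2" if "s \<in> {0..1}" for s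
    proof -
      have "norm (s *\<^sub>R \<zeta> t) \<le> 1 * norm (\<zeta> t)" unfolding norm_scaleR using that by (intro mult_right_mono) auto
      then have s: "norm (s *\<^sub>R \<zeta> t) < d" "norm (s *\<^sub>R \<zeta> t) \<le> 1" using t by (auto simp: min_def split: if_splits)
      have m1: "x t + s *\<^sub>R \<zeta> t \<in> cball 0 (R + 1)" unfolding mem_cball_0 using norm_triangle_ineq[of "x t" "s *\<^sub>R \<zeta> t"] s xR[of t] by linarith
      have m2: "x t \<in> cball 0 (R + 1)" unfolding mem_cball_0 using xR[of t] by linarith
      have "dist (t, x t + s *\<^sub>R \<zeta> t) (t, x t) < d" using s by (simp add: dist_Pair_Pair dist_norm)
      moreover have "(t, x t) \<in> UNIV \<times> cball 0 (R + 1)" by (intro SigmaI UNIV_I m2)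
      moreover have "(t, x t + s *\<^sub>R \<zeta> t) \<in> UNIV \<times> cball 0 (R + 1)" by (intro SigmaI UNIV_I m1)
      ultimately have "dist (case (t, x t + s *\<^sub>R \<zeta> t) of (t, x) \<Rightarrow> Dg t x) (case (t, x t) of (t, x) \<Rightarrow> Dg t x) < \<epsilon> / 2"
        using d(2) by blast
      then have "dist (Dg t (x t + s *\<^sub>R \<zeta> t)) (Dg t (x t)) < \<epsilon> / 2" by simp
      then show ?thesis by (simp add: dist_norm)
    qed
    have "avg_derivative Dg x \<zeta> t - Dg t (x t) = integral {0..1} (\<lambda>s. Dg t (x t + s *\<^sub>R \<zeta> t) - Dg t (x t))"
      unfolding avg_derivative_def using cs
      by (subst Henstock_Kurzweil_Integration.integral_diff) (auto intro: integrable_continuous_real)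
    moreover have "norm (integral {0..1} (\<lambda>s. Dg t (x t + s *\<^sub>R \<zeta> t) - Dg t (x t))) \<le> \<epsilon> / 2 * (1 - 0)"
      by (rule integral_bound) (use cs near in \<open>auto intro!: continuous_intros\<close>)
    ultimately show "dist (avg_derivative Dg x \<zeta> t - Dg t (x t)) 0 < \<epsilon>" using \<epsilon> by (simp add: dist_norm)
  qed
qed

section \<open>The skew-product flow and its linearization\<close>

lemma is_sol_continuous_on: "is_sol g x0 I \<phi> \<Longrightarrow> continuous_on I \<phi>"
  unfolding is_sol_def
  by (meson continuous_on_eq_continuous_within has_vector_derivative_continuous)

text \<open>\<zeta> has to agree with the difference on \<open>I\<close> only. Thus the linear
  equation lives on the whole line even if \<phi> exists only on a half-line.\<close>

lemma difference_of_solutions: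
  fixes g :: "real \<Rightarrow> (real,'n::{finite,linorder}) vec \<Rightarrow> (real,'n) vec"
  assumes F: "coop_field e g Dg" and x: "is_sol g x0 UNIV x" and \<phi>: "is_sol g (x0 + z) I \<phi>"
    and \<zeta>: "continuous_on UNIV \<zeta>" "\<And>t. t \<in> I \<Longrightarrow> \<zeta> t = \<phi> t - x t"
    and FA: "fundamental_pair (avg_derivative Dg x \<zeta>) \<Phi> \<Psi>" and t: "t \<in> I"
  shows "\<phi> t - x t = \<Phi> t z"
proof -
  have I: "convex I" "0 \<in> I" using \<phi> by (auto simp: is_sol_def is_interval_convex)
  have cx: "continuous_on UNIV x" using x by (rule is_sol_continuous_on)
  have "\<phi> t - x t = \<Phi> t (\<Psi> 0 (\<phi> 0 - x 0))"
  proof (rule fundamental_pair_unique[OF FA I(1) _ I(2) t])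
    fix t assume t: "t \<in> I"
    have "(\<phi> has_vector_derivative g t (\<phi> t)) (at t within I)" using \<phi> t by (simp add: is_sol_def)
    moreover have "(x has_vector_derivative g t (x t)) (at t within I)"
      using x by (auto simp: is_sol_def intro: has_vector_derivative_at_within)
    ultimately have "((\<lambda>t. \<phi> t - x t) has_vector_derivative g t (\<phi> t) - g t (x t)) (at t within I)"
      by (rule has_vector_derivative_diff)
    moreover have "g t (\<phi> t) - g t (x t) = avg_derivative Dg x \<zeta> t (\<phi> t - x t)"
      using avg_derivative(3)[OF F cx \<zeta>(1), of t] \<zeta>(2)[OF t] by simp
    ultimately show "((\<lambda>t. \<phi> t - x t) has_vector_derivative avg_derivative Dg x \<zeta> t (\<phi> t - x t)) (at t within I)"
      by simp
  qed
  moreover have "\<phi> 0 - x 0 = z" using \<phi> x by (simp add: is_sol_def)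
  ultimately show ?thesis using FA by (simp add: fundamental_pair_def)
qed

text \<open>The difference of two solutions with equal initial values solves a linear equation with
  initial value zero.\<close>

lemma is_sol_unique:
  fixes g :: "real \<Rightarrow> (real,'n::{finite,linorder}) vec \<Rightarrow> (real,'n) vec"
  assumes F: "coop_field e g Dg" and x: "is_sol g x0 UNIV x" and \<phi>: "is_sol g x0 UNIV \<phi>"
  shows "\<phi> = x"
proof
  fix t
  define \<zeta> where "\<zeta> = (\<lambda>t. \<phi> t - x t)"
  have c: "continuous_on UNIV x" "continuous_on UNIV \<zeta>"
    unfolding \<zeta>_def using is_sol_continuous_on[OF x] is_sol_continuous_on[OF \<phi>] by (auto intro: continuous_intros)
  obtain \<Phi> \<Psi> where FA: "fundamental_pair (avg_derivative Dg x \<zeta>) \<Phi> \<Psi>"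
    using fundamental_pair_exists[OF avg_derivative(1)[OF F c]] by blast
  have "\<phi> t - x t = \<Phi> t 0"
    by (rule difference_of_solutions[OF F x _ c(2) _ FA]) (use \<phi> in \<open>auto simp: \<zeta>_def\<close>)
  then show "\<phi> t = x t" by (simp add: blinfun.zero_right)
qed

text \<open>\<open>traj\<close> and \<open>fund\<close> are arbitrary choices of solutions.
  Invariance provides the global trajectories, and the field condition makes them unique and their
  linearizations continuous, so that both choices have the expected properties on
  \<open>Y\<close>.\<close>

locale coop_invariant_set =
  fixes Y :: "((real,'n::{finite,linorder}) vec \<times> (real \<Rightarrow> (real,'n) vec \<Rightarrow> (real,'n) vec)) set" and e :: real
  assumes inv: "invariant_set Y"
    and field: "y \<in> Y \<Longrightarrow> \<exists>Dg. coop_field e (snd y) Dg"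
begin

lemma skew_in: "y \<in> Y \<Longrightarrow> skew s y \<in> Y"
  using inv unfolding invariant_set_def by blast

lemma is_sol_traj: "y \<in> Y \<Longrightarrow> is_sol (snd y) (fst y) UNIV (traj (snd y) (fst y))"
  unfolding traj_def using inv unfolding invariant_set_def by (metis someI_ex)

lemma traj_skew:
  assumes y: "y \<in> Y"
  shows "traj (snd (skew s y)) (fst (skew s y)) t = traj (snd y) (fst y) (t + s)"
proof -
  define x where "x = traj (snd y) (fst y)"
  have x: "(x has_vector_derivative snd y t (x t)) (at t)" for t
    using is_sol_traj[OF y] by (simp add: is_sol_def x_def)
  have "((\<lambda>t. x (t + s)) has_vector_derivative shift (snd y) s t (x (t + s))) (at t)" for t
  proof -
    have "((\<lambda>t. t + s) has_vector_derivative 1) (at t)"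
      using has_vector_derivative_add[OF has_vector_derivative_id has_vector_derivative_const] by simp
    from vector_diff_chain_at[OF this, of x "snd y (t + s) (x (t + s))"] x[of "t + s"]
    show ?thesis by (simp add: o_def shift_def)
  qed
  then have "is_sol (snd (skew s y)) (fst (skew s y)) UNIV (\<lambda>t. x (t + s))"
    by (simp add: is_sol_def skew_def x_def)
  moreover obtain Dg where "coop_field e (snd (skew s y)) Dg" using field[OF skew_in[OF y]] by blast
  ultimately have "(\<lambda>t. x (t + s)) = traj (snd (skew s y)) (fst (skew s y))"
    using is_sol_unique is_sol_traj[OF skew_in[OF y]] by blast
  then show ?thesis unfolding x_def by metis
qed

lemma Blin_eq:
  assumes "coop_field e (snd y) Dg"
  shows "Blin y t = Dg t (traj (snd y) (fst y) t)"
proof -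
  have "(snd y t has_derivative blinfun_apply (Dg t (traj (snd y) (fst y) t))) (at (traj (snd y) (fst y) t))"
    using assms by (simp add: coop_field_def)
  from frechet_derivative_at[OF this, symmetric] show ?thesis
    by (simp add: Blin_def blinfun_apply_inverse)
qed

lemma Blin_skew:
  assumes "y \<in> Y"
  shows "Blin (skew s y) t = Blin y (t + s)"
  unfolding Blin_def traj_skew[OF assms] by (simp add: skew_def shift_def)

lemma continuous_on_Blin:
  assumes y: "y \<in> Y"
  shows "continuous_on UNIV (Blin y)"
proof -
  obtain Dg where F: "coop_field e (snd y) Dg" using field[OF y] by blast
  have "continuous_on UNIV (\<lambda>t. (t, traj (snd y) (fst y) t))"
    using is_sol_continuous_on[OF is_sol_traj[OF y]] by (intro continuous_intros)
  from continuous_on_compose2[OF coop_field_continuous_on[OF F] this]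
  show ?thesis by (simp add: Blin_eq[OF F, abs_def])
qed

lemma fundamental_pair_fund:
  assumes y: "y \<in> Y"
  shows "\<exists>\<Psi>. fundamental_pair (Blin y) (fund y) \<Psi>"
proof -
  obtain \<Phi> \<Psi> where P: "fundamental_pair (Blin y) \<Phi> \<Psi>"
    using fundamental_pair_exists[OF continuous_on_Blin[OF y]] by blast
  have "fund y 0 = id_blinfun \<and> (\<forall>t. (fund y has_vector_derivative (Blin y t o\<^sub>L fund y t)) (at t))"
    unfolding fund_def by (rule someI[of _ \<Phi>]) (use P in \<open>simp add: fundamental_pair_def\<close>)
  then have "fundamental_pair (Blin y) (fund y) \<Psi>"
    using P by (intro fundamental_pair_if) (auto simp: fundamental_pair_def)
  then show ?thesis by blast
qed

text \<open>As functions of t both sides solve the linearized equation along \<open>y\<close>,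
  because \<open>Blin\<close> at \<open>skew s y\<close> is a time translate of
  \<open>Blin y\<close>; they agree at t = s.\<close>

lemma fund_cocycle:
  assumes y: "y \<in> Y"
  shows "fund (skew s y) (t - s) (fund y s v) = fund y t v"
proof -
  obtain \<Psi> where P: "fundamental_pair (Blin y) (fund y) \<Psi>" using fundamental_pair_fund[OF y] by blast
  obtain \<Psi>' where P': "fundamental_pair (Blin (skew s y)) (fund (skew s y)) \<Psi>'"
    using fundamental_pair_fund[OF skew_in[OF y]] by blast
  define w where "w = (\<lambda>t. fund (skew s y) (t - s) (fund y s v))"
  have "(w has_vector_derivative Blin y t (w t)) (at t)" for t
  proof -
    have "((\<lambda>t. t - s) has_vector_derivative 1) (at t)"
      using has_vector_derivative_diff[OF has_vector_derivative_id has_vector_derivative_const] by simp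
    from vector_diff_chain_at[OF this fundamental_pair_solution[OF P', of "fund y s v" "t - s"]]
    show ?thesis by (simp add: o_def w_def Blin_skew[OF y])
  qed
  then have "w t = fund y t (\<Psi> s (w s))"
    by (intro fundamental_pair_unique[OF P, of UNIV]) auto
  moreover have "w s = fund y s v" using P' by (simp add: w_def fundamental_pair_def)
  ultimately show ?thesis using fundamental_pair_cancel(2)[OF P] by (simp add: w_def)
qed

text \<open>The dichotomy is given from time 0 but at every point of \<open>Y\<close>. Invariance of
  the projection and the cocycle property move the base point to \<open>skew s y\<close>, which
  turns evolution from s to t into evolution from 0 to t - s.\<close>

lemma dichotomy_two_times:
  assumes y: "y \<in> Y" and D: "exp_dichotomy Y Q K \<alpha>" and P: "fundamental_pair (Blin y) (fund y) \<Psi>"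
  shows "s \<le> t \<Longrightarrow> norm (fund y t o\<^sub>L (id_blinfun - Q y) o\<^sub>L \<Psi> s) \<le> K * exp (- \<alpha> * (t - s))"
    and "t \<le> s \<Longrightarrow> norm (fund y t o\<^sub>L Q y o\<^sub>L \<Psi> s) \<le> K * exp (\<alpha> * (t - s))"
proof -
  have "fund y s o\<^sub>L Q y = Q (skew s y) o\<^sub>L fund y s" using D y unfolding exp_dichotomy_def by blast
  then have inv_Q: "fund y s (Q y v) = Q (skew s y) (fund y s v)" for v
    by (metis blinfun_apply_blinfun_compose)
  have D': "(\<forall>t\<ge>0. norm (fund (skew s y) t o\<^sub>L (id_blinfun - Q (skew s y))) \<le> K * exp (- \<alpha> * t)) \<and>
      (\<forall>t\<le>0. norm (fund (skew s y) t o\<^sub>L Q (skew s y)) \<le> K * exp (\<alpha> * t))"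
    using D skew_in[OF y] unfolding exp_dichotomy_def by blast
  have c: "fund y s (\<Psi> s v) = v" for v using fundamental_pair_cancel(1)[OF P] .
  have 1: "fund y t o\<^sub>L (id_blinfun - Q y) o\<^sub>L \<Psi> s = fund (skew s y) (t - s) o\<^sub>L (id_blinfun - Q (skew s y))"
    by (rule blinfun_eqI) (simp add: fund_cocycle[OF y, of s t, symmetric] blinfun.bilinear_simps inv_Q c)
  have 2: "fund y t o\<^sub>L Q y o\<^sub>L \<Psi> s = fund (skew s y) (t - s) o\<^sub>L Q (skew s y)"
    by (rule blinfun_eqI) (simp add: fund_cocycle[OF y, of s t, symmetric] blinfun.bilinear_simps inv_Q c)
  show "s \<le> t \<Longrightarrow> norm (fund y t o\<^sub>L (id_blinfun - Q y) o\<^sub>L \<Psi> s) \<le> K * exp (- \<alpha> * (t - s))"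
    unfolding 1 using D' by simp
  show "t \<le> s \<Longrightarrow> norm (fund y t o\<^sub>L Q y o\<^sub>L \<Psi> s) \<le> K * exp (\<alpha> * (t - s))"
    unfolding 2 using D' by simp
qed

end

text \<open>Reversing time and flipping every other sign preserves the class of tridiagonal systems with
  positive off-diagonal entries, and exchanges stable and unstable directions.\<close>

lemma fundamental_pair_reverse:
  fixes A :: "real \<Rightarrow> (real,'n::{finite,linorder}) vec \<Rightarrow>\<^sub>L (real,'n) vec"
  assumes P: "fundamental_pair A \<Phi> \<Psi>"
  shows "fundamental_pair (\<lambda>t. - (flip o\<^sub>L A (- t) o\<^sub>L flip)) (\<lambda>t. flip o\<^sub>L \<Phi> (- t) o\<^sub>L flip) (\<lambda>t. flip o\<^sub>L \<Psi> (- t) o\<^sub>L flip)"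
proof (rule fundamental_pair_if)
  have bl: "bounded_linear (\<lambda>L :: (real,'n) vec \<Rightarrow>\<^sub>L (real,'n) vec. flip o\<^sub>L L o\<^sub>L flip)"
    using bounded_linear_compose[OF bounded_bilinear.bounded_linear_left[OF bounded_bilinear_blinfun_compose]
      bounded_bilinear.bounded_linear_right[OF bounded_bilinear_blinfun_compose]] .
  have rev: "((\<lambda>t. flip o\<^sub>L X (- t) o\<^sub>L flip) has_vector_derivative (flip o\<^sub>L (- X') o\<^sub>L flip)) (at t)"
    if "(X has_vector_derivative X') (at (- t))" 
    for X and X' :: "(real,'n) vec \<Rightarrow>\<^sub>L (real,'n) vec" and t :: real
  proof -
    have "((\<lambda>t. - t) has_vector_derivative - 1) (at t)"
      using has_vector_derivative_minus[OF has_vector_derivative_id] by simp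
    from vector_diff_chain_at[OF this that] have "((\<lambda>t. X (- t)) has_vector_derivative - X') (at t)"
      by (simp add: o_def)
    from bounded_linear.has_vector_derivative[OF bl this] show ?thesis .
  qed
  fix t
  have "(\<Phi> has_vector_derivative (A (- t) o\<^sub>L \<Phi> (- t))) (at (- t))" using P by (simp add: fundamental_pair_def)
  from rev[OF this] show "((\<lambda>t. flip o\<^sub>L \<Phi> (- t) o\<^sub>L flip) has_vector_derivative
      (- (flip o\<^sub>L A (- t) o\<^sub>L flip) o\<^sub>L (flip o\<^sub>L \<Phi> (- t) o\<^sub>L flip))) (at t)"
    by (rule back_subst[of "\<lambda>D. (_ has_vector_derivative D) _"]) (rule blinfun_eqI, simp add: blinfun.bilinear_simps)
  have "(\<Psi> has_vector_derivative - (\<Psi> (- t) o\<^sub>L A (- t))) (at (- t))" using P by (simp add: fundamental_pair_def)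
  from rev[OF this] show "((\<lambda>t. flip o\<^sub>L \<Psi> (- t) o\<^sub>L flip) has_vector_derivative
      - ((flip o\<^sub>L \<Psi> (- t) o\<^sub>L flip) o\<^sub>L - (flip o\<^sub>L A (- t) o\<^sub>L flip))) (at t)"
    by (rule back_subst[of "\<lambda>D. (_ has_vector_derivative D) _"]) (rule blinfun_eqI, simp add: blinfun.bilinear_simps)
next
  have "(flip o\<^sub>L id_blinfun o\<^sub>L flip :: (real,'n) vec \<Rightarrow>\<^sub>L (real,'n) vec) = id_blinfun" by (rule blinfun_eqI) simp
  then show "flip o\<^sub>L \<Phi> (- 0) o\<^sub>L flip = id_blinfun" "flip o\<^sub>L \<Psi> (- 0) o\<^sub>L flip = id_blinfun"
    using P by (simp_all add: fundamental_pair_def)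
qed

text \<open>Conjugation multiplies entry (i, j) by (-1)^(i + j) and time reversal by -1; for
  neighbouring indices the two signs cancel.\<close>

lemma jacobi_reverse:
  fixes L :: "(real,'n::{finite,linorder}) vec \<Rightarrow>\<^sub>L (real,'n) vec"
  assumes L: "jacobi L"
  shows "jacobi (- (flip o\<^sub>L L o\<^sub>L flip))"
proof -
  have ent: "cmp ((- (flip o\<^sub>L L o\<^sub>L flip)) (axis (ix j) 1)) i = - ((-1) ^ (i + j)) * cmp (L (axis (ix j) 1)) i"
    if "i \<in> {1..CARD('n)}" "j \<in> {1..CARD('n)}" for i j
  proof -
    have "flip (axis (ix j) 1 :: (real,'n) vec) = (-1) ^ j *\<^sub>R axis (ix j) 1"
      by (rule vec_eq_cmpI) (use that in \<open>simp add: cmp_flip cmp_axis\<close>)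
    then show ?thesis using that by (simp add: blinfun.bilinear_simps cmp_flip power_add)
  qed
  show ?thesis unfolding jacobi_def
  proof (intro ballI conjI impI)
    fix i j assume ij: "i \<in> {1..CARD('n)}" "j \<in> {1..CARD('n)}"
    show "cmp ((- (flip o\<^sub>L L o\<^sub>L flip)) (axis (ix j) 1)) i > 0" if "j = i + 1 \<or> i = j + 1"
    proof -
      have "odd (i + j)" using that by auto
      then show ?thesis unfolding ent[OF ij] using jacobiD(1)[OF L ij that] by simp
    qed
    show "cmp ((- (flip o\<^sub>L L o\<^sub>L flip)) (axis (ix j) 1)) i = 0" if "i + 1 < j \<or> j + 1 < i"
      unfolding ent[OF ij] using jacobiD(2)[OF L ij that] by simp
  qed
qed

text \<open>Every v is \<open>Q v\<close> plus the remainder \<open>v - Q v\<close>, so the two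
  ranges sum to the whole space, and \<open>flip\<close> preserves dimensions.\<close>

lemma dim_complementary_range:
  fixes Q :: "(real,'n::{finite,linorder}) vec \<Rightarrow>\<^sub>L (real,'n) vec"
  shows "CARD('n) \<le> dim (range (blinfun_apply Q)) + dim (range (blinfun_apply (flip o\<^sub>L (id_blinfun - Q) o\<^sub>L flip)))"
proof -
  let ?S = "flip o\<^sub>L (id_blinfun - Q) o\<^sub>L flip"
  have lin: "linear (blinfun_apply L)" for L :: "(real,'n) vec \<Rightarrow>\<^sub>L (real,'n) vec"
    by (simp add: blinfun.bounded_linear_right bounded_linear.linear)
  have sub: "subspace (range (blinfun_apply L))" for L :: "(real,'n) vec \<Rightarrow>\<^sub>L (real,'n) vec"
    using linear_subspace_image[OF lin subspace_UNIV] .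
  have "UNIV \<subseteq> {a + b |a b. a \<in> range (blinfun_apply Q) \<and> b \<in> range (blinfun_apply (id_blinfun - Q))}"
  proof
    fix v
    have "v = Q v + (id_blinfun - Q) v" by (simp add: blinfun.bilinear_simps)
    then show "v \<in> {a + b |a b. a \<in> range (blinfun_apply Q) \<and> b \<in> range (blinfun_apply (id_blinfun - Q))}" by blast
  qed
  then have "{a + b |a b. a \<in> range (blinfun_apply Q) \<and> b \<in> range (blinfun_apply (id_blinfun - Q))} = UNIV" by blast
  then have "CARD('n) \<le> dim (range (blinfun_apply Q)) + dim (range (blinfun_apply (id_blinfun - Q)))"
    using dim_sums_Int[OF sub[of Q] sub[of "id_blinfun - Q"]] by simp
  moreover have "range (blinfun_apply (id_blinfun - Q)) = blinfun_apply flip ` range (blinfun_apply ?S)"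
  proof (intro equalityI subsetI)
    fix u assume "u \<in> range (blinfun_apply (id_blinfun - Q))"
    then obtain v where "u = (id_blinfun - Q) v" by blast
    then have "u = flip (?S (flip v))" by simp
    then show "u \<in> blinfun_apply flip ` range (blinfun_apply ?S)" by blast
  next
    fix u assume "u \<in> blinfun_apply flip ` range (blinfun_apply ?S)"
    then obtain v where "u = flip (?S v)" by blast
    then have "u = (id_blinfun - Q) (flip v)" by simp
    then show "u \<in> range (blinfun_apply (id_blinfun - Q))" by blast
  qed
  then have "dim (range (blinfun_apply (id_blinfun - Q))) \<le> dim (range (blinfun_apply ?S))"
    using dim_image_le[OF lin[of flip], of "range (blinfun_apply ?S)"] by simp
  ultimately show ?thesis by linarith
qed

section \<open>Application to the stable and unstable manifolds\<close>

theorem theorem4p9: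
  fixes f :: "real \<Rightarrow> real^'n::{finite,linorder} \<Rightarrow> (real^'n::{finite,linorder})"
    and \<epsilon>0 :: real
    and Y :: "((real^'n::{finite,linorder}) \<times> (real \<Rightarrow> (real^'n::{finite,linorder}) \<Rightarrow> (real^'n::{finite,linorder}))) set"
    and Q :: "(real^'n::{finite,linorder}) \<times> (real \<Rightarrow> (real^'n::{finite,linorder}) \<Rightarrow> (real^'n::{finite,linorder})) \<Rightarrow> ((real^'n::{finite,linorder}) \<Rightarrow>\<^sub>L (real^'n::{finite,linorder}))"
    and K \<alpha> :: real
    and Ws Wu :: "(real^'n::{finite,linorder}) \<times> (real \<Rightarrow> (real^'n::{finite,linorder}) \<Rightarrow> (real^'n::{finite,linorder})) \<Rightarrow> (real^'n::{finite,linorder}) set"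
    and x0 :: "(real^'n::{finite,linorder})" and g :: "real \<Rightarrow> (real^'n::{finite,linorder}) \<Rightarrow> (real^'n::{finite,linorder})"
  assumes "C1_admissible f" and "tridiagonal f" and "\<epsilon>0 > 0" and "coop_bound f \<epsilon>0"
    and "Y \<subseteq> UNIV \<times> hull_H f"
    and "compactin state_top Y" and "connectedin state_top Y"
    and "invariant_set Y"
    and "exp_dichotomy Y Q K \<alpha>" and "\<forall>y\<in>Y. Vu Q y \<noteq> {0}"
    and "stable_family Y Q \<alpha> Ws" and "unstable_family Y Q \<alpha> Wu"
    and "(x0, g) \<in> Y"
  shows "(\<forall>xs \<in> (\<lambda>z. x0 + z) ` Ws (x0, g). xs \<noteq> x0 \<and> xs - x0 \<in> Lambda_set \<longrightarrow>
            sigma_num (xs - x0) \<ge> dim (Vu Q (x0, g))) \<and>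
         (\<forall>xu \<in> (\<lambda>z. x0 + z) ` Wu (x0, g). xu \<noteq> x0 \<and> xu - x0 \<in> Lambda_set \<longrightarrow>
            sigma_num (xu - x0) \<le> dim (Vu Q (x0, g)) - 1)"
proof -
  define y where "y = (x0, g)"
  have y: "y \<in> Y" "fst y = x0" "snd y = g" using assms(13) by (auto simp: y_def)
  interpret coop_invariant_set Y \<epsilon>0
  proof
    show "invariant_set Y" by fact
    fix y assume "y \<in> Y"
    then have "snd y \<in> hull_H f" using assms(5) by auto
    then show "\<exists>Dg. coop_field \<epsilon>0 (snd y) Dg" by (rule hull_coop_field[OF assms(1,2,4)])
  qed
  define x where "x = traj g x0"
  have x: "is_sol g x0 UNIV x" using is_sol_traj[OF y(1)] by (simp add: y x_def)
  have cx: "continuous_on UNIV x" by (rule is_sol_continuous_on[OF x])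
  \<comment> \<open>By invariance the orbit stays in the projection of \<open>Y\<close>, which is
    compact as a continuous image; \<open>avg_derivative_tendsto\<close> needs this bound.\<close>
  obtain R where R: "\<And>t. norm (x t) \<le> R"
  proof -
    have "compactin euclidean (fst ` Y)"
      using assms(6) unfolding state_top_def by (rule image_compactin[OF _ continuous_map_fst])
    then have "bounded (fst ` Y)" by (simp add: compact_imp_bounded)
    then obtain R where "\<And>v. v \<in> fst ` Y \<Longrightarrow> norm v \<le> R" unfolding bounded_iff by blast
    moreover have "x t \<in> fst ` Y" for t
    proof -
      have "fst (skew t y) = x t" by (simp add: skew_def y x_def)
      then show ?thesis using skew_in[OF y(1), of t] by (metis imageI)
    qed
    ultimately show ?thesis using that by blast
  qed
  obtain Dg where F: "coop_field \<epsilon>0 g Dg" using field[OF y(1)] y(3) by auto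
  have Blin: "Blin y t = Dg t (x t)" for t using Blin_eq[of y Dg] F by (simp add: y x_def)
  obtain \<Psi> where P: "fundamental_pair (Blin y) (fund y) \<Psi>" using fundamental_pair_fund[OF y(1)] by blast
  note dich = dichotomy_two_times[OF y(1) assms(9) P]
  have K: "K > 0" "\<alpha> > 0" and QQ: "Q y o\<^sub>L Q y = Q y"
    using assms(9) y(1) unfolding exp_dichotomy_def by blast+
  have Q2: "Q y (Q y v) = Q y v" for v using arg_cong[OF QQ, of "\<lambda>L. blinfun_apply L v"] by simp
  define N where "N = dim (range (blinfun_apply (Q y)))"
  have N: "dim (Vu Q (x0, g)) = N" by (simp add: Vu_def N_def y_def)

  have stable: "sigma_num z \<ge> N" if z: "z \<in> Ws (x0, g)" "z \<noteq> 0" for z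
  proof -
    obtain C \<phi> where \<phi>: "is_sol g (x0 + z) {0..} \<phi>"
      and bd: "\<And>t. t \<ge> 0 \<Longrightarrow> norm (\<phi> t - x t) \<le> C * exp (- (\<alpha> / 2) * t) * norm z"
      using assms(11,13) z(1) unfolding stable_family_def x_def by fastforce
    \<comment> \<open>\<phi> is given on a half-line only; freezing the difference at its value at 0
      extends it continuously to all times, so that a fundamental pair exists.\<close>
    define \<zeta> where "\<zeta> = (\<lambda>t. \<phi> (max t 0) - x (max t 0))"
    have c\<zeta>: "continuous_on UNIV \<zeta>" unfolding \<zeta>_def
      by (intro continuous_intros continuous_on_compose2[OF cx] continuous_on_compose2[OF is_sol_continuous_on[OF \<phi>]]) auto
    have \<zeta>: "\<zeta> t = \<phi> t - x t" if "t \<in> {0..}" for t using that by (simp add: \<zeta>_def max_def)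
    define A where "A = avg_derivative Dg x \<zeta>"
    note avg = avg_derivative[OF F cx c\<zeta>, folded A_def]
    obtain \<Phi>A \<Psi>A where FA: "fundamental_pair A \<Phi>A \<Psi>A" using fundamental_pair_exists[OF avg(1)] by blast
    have lim: "((\<lambda>t. \<phi> t - x t) \<longlongrightarrow> 0) at_top"
    proof (rule Lim_null_comparison)
      show "eventually (\<lambda>t. norm (\<phi> t - x t) \<le> C * exp (- (\<alpha> / 2) * t) * norm z) at_top"
        using bd by (auto intro: eventually_at_top_linorderI[of 0])
      have "filterlim (\<lambda>t. - (\<alpha> / 2) * t) at_bot at_top"
        using K(2) by (intro filterlim_tendsto_neg_mult_at_bot[OF tendsto_const]) (auto simp: filterlim_ident)
      then have "((\<lambda>t. exp (- (\<alpha> / 2) * t)) \<longlongrightarrow> 0) at_top" by (rule filterlim_compose[OF exp_at_bot])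
      then show "((\<lambda>t. C * exp (- (\<alpha> / 2) * t) * norm z) \<longlongrightarrow> 0) at_top"
        by (intro tendsto_mult_left_zero tendsto_mult_right_zero)
    qed
    have ev: "eventually (\<lambda>t. t \<in> {0..}) (at_top :: real filter)" by (simp add: eventually_ge_at_top)
    have "alternates CARD('n) N (cmp z)" unfolding N_def
    proof (rule alternates_if_decaying[OF avg(1) _ FA P K _ _ QQ _ z(2)])
      show "jacobi (A t)" for t using jacobi_if_ge[OF avg(2) assms(3)] .
      have "(\<zeta> \<longlongrightarrow> 0) at_top"
        by (rule Lim_transform_eventually[OF lim eventually_mono[OF ev]]) (simp add: \<zeta>)
      from avg_derivative_tendsto[OF F R this] show "((\<lambda>t. A t - Blin y t) \<longlongrightarrow> 0) at_top"
        by (simp add: A_def Blin)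
      have "\<phi> t - x t = \<Phi>A t z" if "t \<in> {0..}" for t
        by (rule difference_of_solutions[OF F x \<phi> c\<zeta> \<zeta> FA[unfolded A_def] that])
      then show "((\<lambda>t. \<Phi>A t z) \<longlongrightarrow> 0) at_top"
        by (intro Lim_transform_eventually[OF lim eventually_mono[OF ev]])
      show "norm (fund y t o\<^sub>L (id_blinfun - Q y) o\<^sub>L \<Psi> s) \<le> K * exp (- \<alpha> * (t - s))" if "s \<le> t" for s t
        using dich(1) that .
      show "norm (fund y t o\<^sub>L Q y o\<^sub>L \<Psi> s) \<le> K * exp (- \<alpha> * (s - t))" if "t \<le> s" for s t
        using dich(2)[OF that] by (simp add: algebra_simps)
    qed
    from alternates_card[OF this] show ?thesis by (simp add: sigma_num_def)
  qed

  have unstable: "sigma_num z \<le> N - 1" if z: "z \<in> Wu (x0, g)" "z \<noteq> 0" "z \<in> Lambda_set" for z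
  proof -
    obtain C \<phi> where \<phi>: "is_sol g (x0 + z) {..0} \<phi>"
      and bd: "\<And>t. t \<le> 0 \<Longrightarrow> norm (\<phi> t - x t) \<le> C * exp ((\<alpha> / 2) * t) * norm z"
      using assms(12,13) z(1) unfolding unstable_family_def x_def by fastforce
    define \<zeta> where "\<zeta> = (\<lambda>t. \<phi> (min t 0) - x (min t 0))"
    have c\<zeta>: "continuous_on UNIV \<zeta>" unfolding \<zeta>_def
      by (intro continuous_intros continuous_on_compose2[OF cx] continuous_on_compose2[OF is_sol_continuous_on[OF \<phi>]]) auto
    have \<zeta>: "\<zeta> t = \<phi> t - x t" if "t \<in> {..0}" for t using that by (simp add: \<zeta>_def min_def)
    define A where "A = avg_derivative Dg x \<zeta>"
    note avg = avg_derivative[OF F cx c\<zeta>, folded A_def]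
    obtain \<Phi>A \<Psi>A where FA: "fundamental_pair A \<Phi>A \<Psi>A" using fundamental_pair_exists[OF avg(1)] by blast
    have lim: "((\<lambda>t. \<phi> (- t) - x (- t)) \<longlongrightarrow> 0) at_top"
    proof (rule Lim_null_comparison)
      show "eventually (\<lambda>t. norm (\<phi> (- t) - x (- t)) \<le> C * exp (- (\<alpha> / 2) * t) * norm z) at_top"
        using bd[of "- t" for t] by (auto intro!: eventually_at_top_linorderI[of 0])
      have "filterlim (\<lambda>t. - (\<alpha> / 2) * t) at_bot at_top"
        using K(2) by (intro filterlim_tendsto_neg_mult_at_bot[OF tendsto_const]) (auto simp: filterlim_ident)
      then have "((\<lambda>t. exp (- (\<alpha> / 2) * t)) \<longlongrightarrow> 0) at_top" by (rule filterlim_compose[OF exp_at_bot])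
      then show "((\<lambda>t. C * exp (- (\<alpha> / 2) * t) * norm z) \<longlongrightarrow> 0) at_top"
        by (intro tendsto_mult_left_zero tendsto_mult_right_zero)
    qed
    have ev: "eventually (\<lambda>t. - t \<in> {..0}) (at_top :: real filter)" by (simp add: eventually_ge_at_top)
    \<comment> \<open>The unstable projection of the reversed and flipped system: reversal exchanges
      the roles of \<open>Q y\<close> and its complement.\<close>
    define S where "S = flip o\<^sub>L (id_blinfun - Q y) o\<^sub>L flip"
    have bl: "bounded_linear (\<lambda>L :: (real,'n) vec \<Rightarrow>\<^sub>L (real,'n) vec. flip o\<^sub>L L o\<^sub>L flip)"
      using bounded_linear_compose[OF bounded_bilinear.bounded_linear_left[OF bounded_bilinear_blinfun_compose]
        bounded_bilinear.bounded_linear_right[OF bounded_bilinear_blinfun_compose]] .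
    have "alternates CARD('n) (dim (range (blinfun_apply S))) (cmp (flip z))"
    proof (rule alternates_if_decaying[OF _ _ fundamental_pair_reverse[OF FA] fundamental_pair_reverse[OF P] K])
      show "continuous_on UNIV (\<lambda>t. - (flip o\<^sub>L A (- t) o\<^sub>L flip))"
      proof -
        have "continuous_on UNIV (\<lambda>t. A (- t))"
          by (rule continuous_on_compose2[OF avg(1)]) (auto intro: continuous_intros)
        from bounded_linear.continuous_on[OF bl this] show ?thesis by (rule continuous_on_minus)
      qed
      show "jacobi (- (flip o\<^sub>L A (- t) o\<^sub>L flip))" for t
        by (rule jacobi_reverse[OF jacobi_if_ge[OF avg(2) assms(3)]])
      show "S o\<^sub>L S = S" by (rule blinfun_eqI) (simp add: S_def blinfun.bilinear_simps Q2)
      show "flip z \<noteq> 0" using z(2) by (metis norm_eq_zero norm_flip)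
      have "\<phi> t - x t = \<Phi>A t z" if "t \<in> {..0}" for t
        by (rule difference_of_solutions[OF F x \<phi> c\<zeta> \<zeta> FA[unfolded A_def] that])
      then have "((\<lambda>t. \<Phi>A (- t) z) \<longlongrightarrow> 0) at_top"
        by (intro Lim_transform_eventually[OF lim eventually_mono[OF ev]])
      from bounded_linear.tendsto_zero[OF blinfun.bounded_linear_right[of flip] this] show "((\<lambda>t. (flip o\<^sub>L \<Phi>A (- t) o\<^sub>L flip) (flip z)) \<longlongrightarrow> 0) at_top"
        by simp
      have "((\<lambda>t. \<zeta> (- t)) \<longlongrightarrow> 0) at_top"
        by (rule Lim_transform_eventually[OF lim eventually_mono[OF ev]]) (simp add: \<zeta>)
      then have "(\<zeta> \<longlongrightarrow> 0) at_bot" by (simp add: filterlim_at_bot_mirror)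
      from avg_derivative_tendsto[OF F R this] have "((\<lambda>t. A (- t) - Blin y (- t)) \<longlongrightarrow> 0) at_top"
        by (simp add: A_def Blin filterlim_at_bot_mirror)
      from tendsto_minus[OF bounded_linear.tendsto_zero[OF bl this]]
      have "((\<lambda>t. - (flip o\<^sub>L (A (- t) - Blin y (- t)) o\<^sub>L flip)) \<longlongrightarrow> 0) at_top" by simp
      moreover have "- (flip o\<^sub>L (A (- t) - Blin y (- t)) o\<^sub>L flip) =
          - (flip o\<^sub>L A (- t) o\<^sub>L flip) - - (flip o\<^sub>L Blin y (- t) o\<^sub>L flip)" for t
        by (rule blinfun_eqI) (simp add: blinfun.bilinear_simps)
      ultimately show "((\<lambda>t. - (flip o\<^sub>L A (- t) o\<^sub>L flip) - - (flip o\<^sub>L Blin y (- t) o\<^sub>L flip)) \<longlongrightarrow> 0) at_top"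
        by simp
      show "norm ((flip o\<^sub>L fund y (- t) o\<^sub>L flip) o\<^sub>L (id_blinfun - S) o\<^sub>L (flip o\<^sub>L \<Psi> (- s) o\<^sub>L flip)) \<le> K * exp (- \<alpha> * (t - s))"
        if "s \<le> t" for s t
      proof -
        have "(flip o\<^sub>L fund y (- t) o\<^sub>L flip) o\<^sub>L (id_blinfun - S) o\<^sub>L (flip o\<^sub>L \<Psi> (- s) o\<^sub>L flip) =
            flip o\<^sub>L (fund y (- t) o\<^sub>L Q y o\<^sub>L \<Psi> (- s)) o\<^sub>L flip"
          by (rule blinfun_eqI) (simp add: S_def blinfun.bilinear_simps)
        moreover have "norm (fund y (- t) o\<^sub>L Q y o\<^sub>L \<Psi> (- s)) \<le> K * exp (- \<alpha> * (t - s))"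
          using dich(2)[of "- t" "- s"] that by (simp add: algebra_simps)
        ultimately show ?thesis by (simp only: order_trans[OF norm_flip_le])
      qed
      show "norm ((flip o\<^sub>L fund y (- t) o\<^sub>L flip) o\<^sub>L S o\<^sub>L (flip o\<^sub>L \<Psi> (- s) o\<^sub>L flip)) \<le> K * exp (- \<alpha> * (s - t))"
        if "t \<le> s" for s t
      proof -
        have "(flip o\<^sub>L fund y (- t) o\<^sub>L flip) o\<^sub>L S o\<^sub>L (flip o\<^sub>L \<Psi> (- s) o\<^sub>L flip) =
            flip o\<^sub>L (fund y (- t) o\<^sub>L (id_blinfun - Q y) o\<^sub>L \<Psi> (- s)) o\<^sub>L flip"
          by (rule blinfun_eqI) (simp add: S_def blinfun.bilinear_simps)
        moreover have "norm (fund y (- t) o\<^sub>L (id_blinfun - Q y) o\<^sub>L \<Psi> (- s)) \<le> K * exp (- \<alpha> * (s - t))"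
        proof -
          have "- t - - s = s - t" by simp
          then show ?thesis using dich(1)[of "- s" "- t"] that by (simp only: neg_le_iff_le)
        qed
        ultimately show ?thesis by (simp only: order_trans[OF norm_flip_le])
      qed
    qed
    \<comment> \<open>Three facts combine: \<open>sigma_num (flip z)\<close> is at least the rank of
      \<open>S\<close>, this rank is at least n - N, and the counts of \<open>z\<close> and
      \<open>flip z\<close> sum to n - 1. The -1 in (b) thus stems from n coordinates having n - 1
      gaps.\<close>
    from alternates_card[OF this] have "dim (range (blinfun_apply S)) \<le> sigma_num (flip z)"
      by (simp add: sigma_num_def)
    moreover have "CARD('n) \<le> N + dim (range (blinfun_apply S))"
      unfolding N_def S_def by (rule dim_complementary_range)
    moreover have "CARD('n) > 0" by simp
    ultimately show ?thesis using sigma_num_flip[OF z(3)] by linarith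
  qed

  show ?thesis unfolding N using stable unstable by auto
qed

end
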